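(* The variety of complex $3$-dimensional $\mathfrak{perm}$ algebras has dimension $9$ and it has exactly $4$ irreducible components, namely $$\overline{\mathcal{O}(\mathrm{A}_{07})},\quad \overline{\mathcal{O}(\mathrm{A}_{18})},\quad \overline{\mathcal{O}(\mathrm{A}_{24})},\quad \overline{\bigcup_{\alpha}\mathcal{O}(\mathrm{A}_{14}^{\alpha})},$$ where in the last one $\alpha$ ranges over $\mathbb{C}\setminus\{0\}$. In particular, there are exactly $3$ rigid algebras (up to isomorphism) in this variety.
   Context: A $\mathfrak{perm}$ algebra is an associative algebra (not necessarily unital) satisfying $abc=acb$ for all $a,b,c$. Let $\mathbb{V}=\mathbb{C}^3$. The variety of complex $3$-dimensional $\mathfrak{perm}$ algebras is the Zariski-closed subset of $\mathrm{Hom}(\mathbb{V}\otimes\mathbb{V},\mathbb{V})\cong\mathbb{C}^{27}$ (coordinates: structure constants) consisting of the multiplications satisfying the identities of $\mathfrak{perm}$ algebras. $\mathrm{GL}(\mathbb{V})$ acts by $(g*\mu)(x\otimes y)=g\mu(g^{-1}x\otimes g^{-1}y)$; $\mathcal{O}(\mathrm{A})$ is the orbit of a structure representing the algebra $\mathrm{A}$, and the bar denotes Zariski closure. An algebra is rigid in the variety if its orbit is an open subset of the variety. The algebras, in a basis $e_1,e_2,e_3$ (products not listed are zero): $\mathrm{A}_{07}$: $e_1e_1=e_1$, $e_2e_2=e_2$, $e_3e_3=e_3$; $\mathrm{A}_{14}^{\alpha}$: $e_1e_2=(1+\alpha)e_3$, $e_2e_1=(1-\alpha)e_3$; $\mathrm{A}_{18}$: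 $e_1e_1=e_1$, $e_2e_1=e_2$, $e_3e_1=e_3$; $\mathrm{A}_{24}$: $e_1e_1=e_1$, $e_2e_2=e_2$, $e_3e_1=e_3$. *)

theory Defs
  imports "HOL-Analysis.Analysis" "HOL-Library.Extended_Nat"
begin

definition irreducible_in :: "'a topology \<Rightarrow> 'a set \<Rightarrow> bool" where
  "irreducible_in X S \<longleftrightarrow> S \<subseteq> topspace X \<and> S \<noteq> {} \<and>
     (\<forall>F G. closedin X F \<and> closedin X G \<and> S \<subseteq> F \<union> G \<longrightarrow> S \<subseteq> F \<or> S \<subseteq> G)"

definition irreducible_components :: "'a topology \<Rightarrow> 'a set set" where
  "irreducible_components X =
     {C. irreducible_in X C \<and> (\<forall>D. irreducible_in X D \<and> C \<subseteq> D \<longrightarrow> D = C)}"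

text \<open>The supremum of the lengths \<open>n\<close> of chains
  \<open>Z 0 \<subset> \<dots> \<subset> Z n\<close> of irreducible closed subsets
  (for the empty space this convention gives \<open>0\<close>).\<close>

definition krull_dimension :: "'a topology \<Rightarrow> enat" where
  "krull_dimension X = Sup {enat n |n. \<exists>Z :: nat \<Rightarrow> 'a set.
     (\<forall>i\<le>n. closedin X (Z i) \<and> irreducible_in X (Z i)) \<and> (\<forall>i<n. Z i \<subset> Z (Suc i))}"

text \<open>A multiplication is given by its structure constants: \<open>c $ i $ j $ k\<close> is the
  coefficient of \<open>e\<^sub>k\<close> in \<open>e\<^sub>i e\<^sub>j\<close>. In the index type \<open>3\<close> the numeral \<open>3\<close>
  equals \<open>0\<close>, and \<open>1\<close>, \<open>2\<close>, \<open>3\<close> are its three distinct elements.\<close>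

type_synonym multiplication = "complex ^ 3 ^ 3 ^ 3"

definition mult :: "multiplication \<Rightarrow> complex ^ 3 \<Rightarrow> complex ^ 3 \<Rightarrow> complex ^ 3" where
  "mult c x y = (\<chi> k. \<Sum>i\<in>UNIV. \<Sum>j\<in>UNIV. x $ i * y $ j * c $ i $ j $ k)"

lemma mult_basis: "mult c (axis i 1) (axis j 1) $ k = c $ i $ j $ k"
proof -
  have "mult c (axis i 1) (axis j 1) $ k =
      (\<Sum>i'\<in>UNIV. \<Sum>j'\<in>UNIV. if i' = i then if j' = j then c $ i' $ j' $ k else 0 else 0)"
    unfolding mult_def by (simp, intro sum.cong refl) (simp add: axis_def)
  also have "\<dots> = (\<Sum>i'\<in>UNIV. if i' = i then c $ i' $ j $ k else 0)"
    by (intro sum.cong refl) simp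
  finally show ?thesis by simp
qed

definition perm_algebra :: "multiplication \<Rightarrow> bool" where
  "perm_algebra c \<longleftrightarrow> (\<forall>x y z.
     mult c (mult c x y) z = mult c x (mult c y z) \<and>
     mult c (mult c x y) z = mult c (mult c x z) y)"

definition gl_action :: "complex ^ 3 ^ 3 \<Rightarrow> multiplication \<Rightarrow> multiplication" where
  "gl_action g c = (\<chi> i j k.
     (g *v mult c (matrix_inv g *v axis i 1) (matrix_inv g *v axis j 1)) $ k)"

definition orbit :: "multiplication \<Rightarrow> multiplication set" where
  "orbit c = {gl_action g c |g. invertible g}"

definition isomorphic :: "multiplication \<Rightarrow> multiplication \<Rightarrow> bool" where
  "isomorphic c d \<longleftrightarrow> (\<exists>f. Vector_Spaces.linear (*s) (*s) f \<and> bij f \<and>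
     (\<forall>x y. f (mult c x y) = mult d (f x) (f y)))"

inductive poly_fun :: "(multiplication \<Rightarrow> complex) \<Rightarrow> bool" where
  const: "poly_fun (\<lambda>c. a)"
| coord: "poly_fun (\<lambda>c. c $ i $ j $ k)"
| add: "poly_fun p \<Longrightarrow> poly_fun q \<Longrightarrow> poly_fun (\<lambda>c. p c + q c)"
| mult: "poly_fun p \<Longrightarrow> poly_fun q \<Longrightarrow> poly_fun (\<lambda>c. p c * q c)"

definition zero_locus :: "(multiplication \<Rightarrow> complex) set \<Rightarrow> multiplication set" where
  "zero_locus P = {c. \<forall>p\<in>P. p c = 0}"

definition zariski :: "multiplication topology" where
  "zariski = topology (\<lambda>U. \<exists>P. (\<forall>p\<in>P. poly_fun p) \<and> U = - zero_locus P)"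

lemma istopology_zariski: "istopology (\<lambda>U. \<exists>P. (\<forall>p\<in>P. poly_fun p) \<and> U = - zero_locus P)"
  unfolding istopology_def
proof (intro conjI allI impI)
  fix U W
  assume "\<exists>P. (\<forall>p\<in>P. poly_fun p) \<and> U = - zero_locus P"
    and "\<exists>P. (\<forall>p\<in>P. poly_fun p) \<and> W = - zero_locus P"
  then obtain P Q where P: "\<forall>p\<in>P. poly_fun p" "U = - zero_locus P"
    and Q: "\<forall>p\<in>Q. poly_fun p" "W = - zero_locus Q" by blast
  let ?R = "{\<lambda>c. p c * q c |p q. p \<in> P \<and> q \<in> Q}"
  have "\<forall>r\<in>?R. poly_fun r" using P(1) Q(1) by (auto intro: poly_fun.mult)
  moreover have "U \<inter> W = - zero_locus ?R"
  proof (intro set_eqI)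
    fix c
    show "c \<in> U \<inter> W \<longleftrightarrow> c \<in> - zero_locus ?R"
      unfolding P(2) Q(2) zero_locus_def by (auto, metis mult_eq_0_iff)
  qed
  ultimately show "\<exists>P. (\<forall>p\<in>P. poly_fun p) \<and> U \<inter> W = - zero_locus P" by blast
next
  fix K :: "multiplication set set"
  assume K: "\<forall>U\<in>K. \<exists>P. (\<forall>p\<in>P. poly_fun p) \<and> U = - zero_locus P"
  then obtain F where F: "\<And>U. U \<in> K \<Longrightarrow> (\<forall>p\<in>F U. poly_fun p) \<and> U = - zero_locus (F U)"
    by metis
  have "\<forall>p\<in>\<Union>(F ` K). poly_fun p" using F by blast
  moreover have "\<Union>K = - zero_locus (\<Union>(F ` K))"
  proof -
    have "\<Union>K = (\<Union>U\<in>K. - zero_locus (F U))" using F by blast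
    also have "\<dots> = - zero_locus (\<Union>(F ` K))" by (auto simp: zero_locus_def)
    finally show ?thesis .
  qed
  ultimately show "\<exists>P. (\<forall>p\<in>P. poly_fun p) \<and> \<Union>K = - zero_locus P" by blast
qed

lemma closedin_zariski: "closedin zariski F \<longleftrightarrow> (\<exists>P. (\<forall>p\<in>P. poly_fun p) \<and> F = zero_locus P)"
proof -
  have op: "openin zariski U \<longleftrightarrow> (\<exists>P. (\<forall>p\<in>P. poly_fun p) \<and> U = - zero_locus P)" for U
    unfolding zariski_def by (simp add: topology_inverse' istopology_zariski)
  have "openin zariski UNIV"
    unfolding op by (rule exI[of _ "{\<lambda>c. 1}"]) (simp add: zero_locus_def poly_fun.const)
  then have "topspace zariski = UNIV" by (metis openin_subset top.extremum_uniqueI)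
  then show ?thesis by (auto simp: closedin_def op simp flip: Compl_eq_Diff_UNIV)
qed

definition perm_variety :: "multiplication topology" where
  "perm_variety = subtopology zariski {c. perm_algebra c}"

definition rigid :: "multiplication \<Rightarrow> bool" where
  "rigid c \<longleftrightarrow> perm_algebra c \<and> openin perm_variety (orbit c)"

definition perm_iso :: "(multiplication \<times> multiplication) set" where
  "perm_iso = {(c, d). perm_algebra c \<and> perm_algebra d \<and> isomorphic c d}"

definition A07 :: multiplication where
  "A07 = (\<chi> i j k. if (i, j, k) \<in> {(1, 1, 1), (2, 2, 2), (3, 3, 3)} then 1 else 0)"

definition A14 :: "complex \<Rightarrow> multiplication" where
  "A14 \<alpha> = (\<chi> i j k. if (i, j, k) = (1, 2, 3) then 1 + \<alpha>
                      else if (i, j, k) = (2, 1, 3) then 1 - \<alpha> else 0)"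

definition A18 :: multiplication where
  "A18 = (\<chi> i j k. if (i, j, k) \<in> {(1, 1, 1), (2, 1, 2), (3, 1, 3)} then 1 else 0)"

definition A24 :: multiplication where
  "A24 = (\<chi> i j k. if (i, j, k) \<in> {(1, 1, 1), (2, 2, 2), (3, 1, 3)} then 1 else 0)"

end

theory Submission
  imports Defs "HOL-Computational_Algebra.Fundamental_Theorem_Algebra"
begin

text \<open>Algebras with a generator \<open>a\<close> for which \<open>a, a\<^sup>2, a\<^sup>3\<close> is a basis are determined by the
  minimal polynomial of \<open>a\<close>, so moving its roots apart exhibits them as limits of \<open>A07 = \<complex>\<^sup>3\<close>.
  An algebra without generator is either nil, and then its products lie on an annihilated line
  (the family \<open>A14\<close> and its limits), or it has an idempotent, whose Peirce decomposition leaves only \<open>A18\<close>,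
  degenerations of \<open>A24\<close> and two commutative limits of \<open>A07\<close>. The four closures are closures of
  images of polynomial maps on the space of \<open>3 \<times> 3\<close> matrices, hence irreducible, and are separated by
  polynomial identities.

  For the dimension, each step of a chain of irreducible closed sets yields a further algebraically
  independent function, while at most nine such functions exist on the image of a polynomial map from
  a nine-dimensional space. Conversely the generated algebra with \<open>a = e\<^sub>1\<close> is determined by its left
  multiplication \<open>M\<close> by \<open>e\<^sub>1\<close>, whose nine entries are free; filling them in one at a time gives a
  chain of length nine.

  An open orbit which meets the closure of an orbit coincides with that orbit; in the fourth closure
  no orbit is open because \<open>\<alpha>\<^sup>2\<close> is an isomorphism invariant which varies.\<close>

text \<open>The 27 structure constants are rarely handled individually. Closed conditions are
  written as identities quantified over all vectors, which \<open>zero_locus\<close> permits because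
  it accepts infinite sets of polynomials; stability under GL then follows from equivariance. The
  classification is deliberately coarse: it only has to place every algebra in one of the closures,
  so monogenic and line-valued algebras are not sorted further. The obstacle is that inverses and
  quotients are not polynomial. Inverse matrices are replaced by adjugates, the division in Cramer's
  rule is postponed, and scalars lost in this way are restored by rescaling a basis, over the
  complex numbers if necessary by a root of a determinant. Degenerations are Euclidean limits, which
  suffices because polynomials are continuous. Openness of the three rigid orbits is proved
  directly: each is identified inside the variety with the set where some member of an equivariant
  family of polynomials is nonzero, namely discriminants for \<open>A07\<close> and
  \<open>A24\<close>, and the independence of two commutators for \<open>A18\<close>.\<close>

lemma mult_add_left: "mult c (x + y) z = mult c x z + mult c y z"
  and mult_add_right: "mult c x (y + z) = mult c x y + mult c x z"
  and mult_scale_left: "mult c (a *s x) y = a *s mult c x y"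
  and mult_scale_right: "mult c x (a *s y) = a *s mult c x y"
  and mult_zero_left: "mult c 0 y = 0"
  and mult_zero_right: "mult c x 0 = 0"
  by (simp_all add: vec_eq_iff mult_def sum_3 algebra_simps)

lemma mult_diff_left: "mult c (x - y) z = mult c x z - mult c y z"
  and mult_diff_right: "mult c x (y - z) = mult c x y - mult c x z"
  by (simp_all add: vec_eq_iff mult_def sum_3 algebra_simps)

lemma mult_minus_left: "mult c (- x) y = - mult c x y"
  and mult_minus_right: "mult c x (- y) = - mult c x y"
  by (simp_all add: vec_eq_iff mult_def sum_3 algebra_simps)

lemmas mult_linear = mult_minus_left mult_minus_right mult_add_left mult_add_right mult_diff_left mult_diff_right
  mult_scale_left mult_scale_right mult_zero_left mult_zero_right

lemma mult_eqI: "(\<And>x y. mult c x y = mult d x y) \<Longrightarrow> c = d"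
  by (simp add: vec_eq_iff flip: mult_basis)

lemma vec3_expand: fixes x :: "complex^3" shows "x = x$1 *s axis 1 1 + x$2 *s axis 2 1 + x$3 *s axis 3 (1::complex)"
  by (simp add: vec_eq_iff forall_3 axis_def)

text \<open>Lets \<open>gl_action\<close>, \<open>cyclic\<close> and \<open>transport\<close>, which
  are defined by structure constants, be computed with as bilinear maps on vectors.\<close>

lemma mult_of_bilinear:
  fixes B :: "complex^3 \<Rightarrow> complex^3 \<Rightarrow> complex^3"
  assumes "\<And>x y z. B (x + y) z = B x z + B y z" "\<And>x y z. B x (y + z) = B x y + B x z"
    and "\<And>a x y. B (a *s x) y = a *s B x y" "\<And>a x y. B x (a *s y) = a *s B x y"
  shows "mult (\<chi> i j k. B (axis i 1) (axis j 1) $ k) x y = B x y"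
proof -
  have "B x y = B (x$1 *s axis 1 1 + x$2 *s axis 2 1 + x$3 *s axis 3 1)
      (y$1 *s axis 1 1 + y$2 *s axis 2 1 + y$3 *s axis 3 1)"
    using vec3_expand[of x] vec3_expand[of y] by simp
  also have "\<dots> = mult (\<chi> i j k. B (axis i 1) (axis j 1) $ k) x y"
    unfolding assms by (simp add: vec_eq_iff mult_def sum_3 algebra_simps)
  finally show ?thesis by simp
qed

section \<open>The action of GL, orbits and isomorphisms\<close>

lemma mult_gl_action:
  "mult (gl_action g c) x y = g *v mult c (matrix_inv g *v x) (matrix_inv g *v y)"
proof -
  let ?B = "\<lambda>x y. g *v mult c (matrix_inv g *v x) (matrix_inv g *v y)"
  have "mult (\<chi> i j k. ?B (axis i 1) (axis j 1) $ k) x y = ?B x y"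
    by (rule mult_of_bilinear)
      (simp_all add: matrix_vector_right_distrib mult_linear matrix_vector_mult_scaleR
        vec.scale)
  then show ?thesis by (simp add: gl_action_def)
qed

lemma matrix_inv_mult:
  assumes "invertible g"
  shows "g ** matrix_inv g = mat 1" "matrix_inv g ** g = mat 1"
  using someI_ex[OF assms[unfolded invertible_def]] by (simp_all add: matrix_inv_def)

lemma matrix_inv_vec:
  fixes g :: "complex^'n^'n" assumes "invertible g"
  shows "g *v (matrix_inv g *v x) = x" "matrix_inv g *v (g *v x) = x"
  using assms by (simp_all add: matrix_vector_mul_assoc matrix_inv_mult)

text \<open>Membership becomes the existence of an algebra isomorphism from \<open>T\<close> to
  \<open>c\<close>, which keeps \<open>matrix_inv\<close> out of most later arguments.\<close>

lemma orbit_iff: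
  "c \<in> orbit T \<longleftrightarrow> (\<exists>g. invertible g \<and> (\<forall>x y. mult c (g *v x) (g *v y) = g *v mult T x y))"
proof
  assume "c \<in> orbit T"
  then show "\<exists>g. invertible g \<and> (\<forall>x y. mult c (g *v x) (g *v y) = g *v mult T x y)"
    by (auto simp: orbit_def mult_gl_action matrix_inv_vec)
next
  assume "\<exists>g. invertible g \<and> (\<forall>x y. mult c (g *v x) (g *v y) = g *v mult T x y)"
  then obtain g where g: "invertible g" "\<And>x y. mult c (g *v x) (g *v y) = g *v mult T x y"
    by blast
  have "mult c x y = mult (gl_action g T) x y" for x y
    using g(2)[of "matrix_inv g *v x" "matrix_inv g *v y"]
    by (simp add: matrix_inv_vec[OF g(1)] mult_gl_action)
  then have "c = gl_action g T" by (rule mult_eqI)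
  then show "c \<in> orbit T" using g(1) by (auto simp: orbit_def)
qed

lemma orbitE:
  assumes "c \<in> orbit T"
  obtains g where "invertible g" "\<And>x y. mult c (g *v x) (g *v y) = g *v mult T x y"
    "\<And>x. \<exists>x'. x = g *v x'" "det g \<noteq> 0"
proof -
  obtain g where g: "invertible g" "\<And>x y. mult c (g *v x) (g *v y) = g *v mult T x y"
    using assms orbit_iff by blast
  have "\<exists>x'. x = g *v x'" for x
    by (rule exI[of _ "matrix_inv g *v x"]) (simp add: matrix_inv_vec[OF g(1)])
  then show ?thesis using that[OF g(1) g(2)] g(1) invertible_det_nz by blast
qed

text \<open>The isomorphism runs from \<open>c\<close> to \<open>T\<close>. This suits algebras
  given by linear forms, which become the rows of \<open>h\<close>; \<open>orbit_basisI\<close> is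
  the counterpart for a given basis.\<close>

lemma orbit_coframeI:
  assumes "det h \<noteq> 0" and "\<And>x y. h *v mult c x y = mult T (h *v x) (h *v y)"
  shows "c \<in> orbit T"
proof -
  have h: "invertible h" using assms(1) by (simp add: invertible_det_nz)
  have i: "invertible (matrix_inv h)"
    using h by (metis invertible_def matrix_inv_mult)
  have "mult c (matrix_inv h *v x) (matrix_inv h *v y) = matrix_inv h *v mult T x y" for x y
    using assms(2)[of "matrix_inv h *v x" "matrix_inv h *v y"] 
    by (metis matrix_inv_vec[OF h])
  with i show ?thesis unfolding orbit_iff by blast
qed

lemma orbit_refl: "c \<in> orbit c"
  unfolding orbit_iff by (rule exI[of _ "mat 1"]) (simp add: invertible_det_nz)

lemma orbit_sym: "c \<in> orbit T \<Longrightarrow> T \<in> orbit c"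
  by (elim orbitE) (metis invertible_det_nz orbit_coframeI)

lemma orbit_trans: assumes "c \<in> orbit d" "d \<in> orbit T" shows "c \<in> orbit T"
proof -
  obtain g where g: "invertible g" "\<And>x y. mult c (g *v x) (g *v y) = g *v mult d x y"
    using orbitE[OF assms(1)] by metis
  obtain h where h: "invertible h" "\<And>x y. mult d (h *v x) (h *v y) = h *v mult T x y"
    using orbitE[OF assms(2)] by metis
  have "mult c ((g ** h) *v x) ((g ** h) *v y) = (g ** h) *v mult T x y" for x y
    by (simp add: g(2) h(2) flip: matrix_vector_mul_assoc)
  moreover have "invertible (g ** h)" using g(1) h(1) by (rule invertible_mult)
  ultimately show ?thesis unfolding orbit_iff by blast
qed

lemma orbit_eq: "c \<in> orbit d \<Longrightarrow> orbit c = orbit d"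
  using orbit_trans orbit_sym by blast

lemma perm_orbit: assumes "c \<in> orbit T" "perm_algebra T" shows "perm_algebra c"
proof -
  obtain g where g: "\<And>x y. mult c (g *v x) (g *v y) = g *v mult T x y" "\<And>x. \<exists>x'. x = g *v x'"
    using orbitE[OF assms(1)] by metis
  show ?thesis unfolding perm_algebra_def
  proof (intro allI)
    fix x y z
    obtain x' y' z' where "x = g *v x'" "y = g *v y'" "z = g *v z'" using g(2) by metis
    moreover have "mult T (mult T x' y') z' = mult T x' (mult T y' z')"
      "mult T (mult T x' y') z' = mult T (mult T x' z') y'"
      using assms(2) unfolding perm_algebra_def by blast+
    ultimately show "mult c (mult c x y) z = mult c x (mult c y z) \<and>
        mult c (mult c x y) z = mult c (mult c x z) y"
      by (metis g(1))
  qed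
qed

section \<open>Determinants, bases and coordinates\<close>

definition det3 :: "complex^3 \<Rightarrow> complex^3 \<Rightarrow> complex^3 \<Rightarrow> complex" where
  "det3 a b c = a$1 * (b$2 * c$3 - b$3 * c$2) - a$2 * (b$1 * c$3 - b$3 * c$1)
     + a$3 * (b$1 * c$2 - b$2 * c$1)"

definition cols :: "complex^3 \<Rightarrow> complex^3 \<Rightarrow> complex^3 \<Rightarrow> complex^3^3" where
  "cols a b c = (\<chi> i j. if j = 1 then a$i else if j = 2 then b$i else c$i)"

lemma det_cols: "det (cols a b c) = det3 a b c"
  by (simp add: det_3 cols_def det3_def algebra_simps)

lemma cols_vec: "cols a b c *v x = x$1 *s a + x$2 *s b + x$3 *s c"
  by (simp add: vec_eq_iff matrix_vector_mult_def cols_def sum_3 algebra_simps)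

lemma det3_image: "det3 (g *v a) (g *v b) (g *v c) = det g * det3 a b c"
proof -
  have "g ** cols a b c = cols (g *v a) (g *v b) (g *v c)"
    by (simp add: vec_eq_iff forall_3 matrix_matrix_mult_def matrix_vector_mult_def cols_def sum_3)
  then show ?thesis by (metis det_cols det_mul)
qed

lemma det3_linear:
  "det3 (x + y) b c = det3 x b c + det3 y b c" "det3 a (x + y) c = det3 a x c + det3 a y c"
  "det3 a b (x + y) = det3 a b x + det3 a b y"
  "det3 (x - y) b c = det3 x b c - det3 y b c" "det3 a (x - y) c = det3 a x c - det3 a y c"
  "det3 a b (x - y) = det3 a b x - det3 a b y"
  "det3 (k *s x) b c = k * det3 x b c" "det3 a (k *s x) c = k * det3 a x c"
  "det3 a b (k *s x) = k * det3 a b x"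
  "det3 0 b c = 0" "det3 a 0 c = 0" "det3 a b 0 = 0"
  "det3 a a c = 0" "det3 a c a = 0" "det3 c a a = 0"
  by (simp_all add: det3_def algebra_simps)

lemma det3_swap: "det3 b a c = - det3 a b c" "det3 a c b = - det3 a b c" "det3 c b a = - det3 a b c"
  by (simp_all add: det3_def algebra_simps)

text \<open>Keeping the determinant on the left makes Cramer's rule polynomial and valid for
  dependent vectors as well; \<open>cyclic\<close> and \<open>transport\<close> rest on this
  form.\<close>

lemma cramer3:
  "det3 a b c *s x = det3 x b c *s a + det3 a x c *s b + det3 a b x *s c"
  by (simp add: vec_eq_iff forall_3 det3_def algebra_simps)

lemma basis_coords:
  assumes "det3 a b c \<noteq> 0"
  obtains p q r where "x = p *s a + q *s b + r *s c"
proof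
  have "x = (1 / det3 a b c) *s (det3 a b c *s x)" using assms by (simp add: vector_smult_assoc)
  also have "\<dots> = (det3 x b c / det3 a b c) *s a + (det3 a x c / det3 a b c) *s b
      + (det3 a b x / det3 a b c) *s c"
    by (subst cramer3) (simp add: vector_add_ldistrib vector_smult_assoc)
  finally show "x = (det3 x b c / det3 a b c) *s a + (det3 a x c / det3 a b c) *s b
      + (det3 a b x / det3 a b c) *s c" .
qed

lemma basis_coords_eq:
  assumes "det3 a b c \<noteq> 0" "p *s a + q *s b + r *s c = p' *s a + q' *s b + r' *s c"
  shows "p = p' \<and> q = q' \<and> r = r'"
proof -
  have "det3 (p *s a + q *s b + r *s c) b c = det3 (p' *s a + q' *s b + r' *s c) b c"
    "det3 a (p *s a + q *s b + r *s c) c = det3 a (p' *s a + q' *s b + r' *s c) c"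
    "det3 a b (p *s a + q *s b + r *s c) = det3 a b (p' *s a + q' *s b + r' *s c)"
    using assms(2) by simp_all
  then show ?thesis using assms(1) by (simp add: det3_linear)
qed

lemma basis_coords_zero:
  assumes "det3 a b c \<noteq> 0" "p *s a + q *s b + r *s c = 0"
  shows "p = 0 \<and> q = 0 \<and> r = 0"
  using basis_coords_eq[OF assms(1), of p q r 0 0 0] assms(2) by simp

lemma orbit_basisI:
  assumes "det3 u v w \<noteq> 0"
    and "\<forall>i j. mult c (if i = 1 then u else if i = 2 then v else w)
         (if j = 1 then u else if j = 2 then v else w)
       = T$i$j$1 *s u + T$i$j$2 *s v + T$i$j$3 *s w"
  shows "c \<in> orbit T"
proof -
  let ?g = "cols u v w"
  have p: "mult c u u = T$1$1$1 *s u + T$1$1$2 *s v + T$1$1$3 *s w"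
    "mult c u v = T$1$2$1 *s u + T$1$2$2 *s v + T$1$2$3 *s w"
    "mult c u w = T$1$3$1 *s u + T$1$3$2 *s v + T$1$3$3 *s w"
    "mult c v u = T$2$1$1 *s u + T$2$1$2 *s v + T$2$1$3 *s w"
    "mult c v v = T$2$2$1 *s u + T$2$2$2 *s v + T$2$2$3 *s w"
    "mult c v w = T$2$3$1 *s u + T$2$3$2 *s v + T$2$3$3 *s w"
    "mult c w u = T$3$1$1 *s u + T$3$1$2 *s v + T$3$1$3 *s w"
    "mult c w v = T$3$2$1 *s u + T$3$2$2 *s v + T$3$2$3 *s w"
    "mult c w w = T$3$3$1 *s u + T$3$3$2 *s v + T$3$3$3 *s w"
    using assms(2) by (simp_all add: forall_3)
  have "mult c (?g *v x) (?g *v y) = ?g *v mult T x y" for x y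
    unfolding cols_vec mult_linear p
    by (simp add: vec_eq_iff mult_def sum_3 algebra_simps)
  moreover have "invertible ?g" using assms(1) by (simp add: invertible_det_nz det_cols)
  ultimately show ?thesis unfolding orbit_iff by blast
qed

section \<open>Polynomial maps and the Zariski topology\<close>

lemma poly_fun_scale: "poly_fun p \<Longrightarrow> poly_fun (\<lambda>c. a * p c)"
  by (rule poly_fun.mult[OF poly_fun.const])

lemma poly_fun_diff: assumes "poly_fun p" "poly_fun q" shows "poly_fun (\<lambda>c. p c - q c)"
  using poly_fun.add[OF assms(1) poly_fun_scale[OF assms(2), of "-1"]] by simp

lemma poly_fun_sum: "(\<And>i. i \<in> I \<Longrightarrow> poly_fun (p i)) \<Longrightarrow> poly_fun (\<lambda>c. \<Sum>i\<in>I. p i c)"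
  by (induction I rule: infinite_finite_induct) (auto intro: poly_fun.intros)

lemma poly_fun_power: "poly_fun p \<Longrightarrow> poly_fun (\<lambda>c. p c ^ n)"
  by (induction n) (auto intro: poly_fun.intros)

lemma poly_fun_prod: "(\<And>i. i \<in> I \<Longrightarrow> poly_fun (p i)) \<Longrightarrow> poly_fun (\<lambda>c. \<Prod>i\<in>I. p i c)"
  by (induction I rule: infinite_finite_induct) (auto intro: poly_fun.intros)

lemma poly_fun_mult_nth:
  "(\<And>i. poly_fun (\<lambda>c. X c $ i)) \<Longrightarrow> (\<And>i. poly_fun (\<lambda>c. Y c $ i)) \<Longrightarrow> poly_fun (\<lambda>c. mult c (X c) (Y c) $ k)"
  by (auto simp: mult_def intro!: poly_fun_sum poly_fun.intros)

lemma poly_fun_det3: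
  "(\<And>i. poly_fun (\<lambda>c. X c $ i)) \<Longrightarrow> (\<And>i. poly_fun (\<lambda>c. Y c $ i)) \<Longrightarrow> (\<And>i. poly_fun (\<lambda>c. Z c $ i))
   \<Longrightarrow> poly_fun (\<lambda>c. det3 (X c) (Y c) (Z c))"
  unfolding det3_def by (intro poly_fun.add poly_fun_diff poly_fun.mult)

lemma poly_fun_diff_nth:
  "(\<And>i. poly_fun (\<lambda>c. X c $ i)) \<Longrightarrow> (\<And>i. poly_fun (\<lambda>c. Y c $ i)) \<Longrightarrow> poly_fun (\<lambda>c. (X c - Y c) $ k)"
  by (auto intro!: poly_fun_diff)

lemma poly_fun_const_nth: "poly_fun (\<lambda>c. (x::complex^3) $ k)"
  by (rule poly_fun.const)

lemmas poly_fun_intros = poly_fun_det3 poly_fun_const_nth poly_fun_mult_nth poly_fun_diff_nth 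
  poly_fun_diff poly_fun_power poly_fun.add poly_fun.mult poly_fun.const 

lemma closedin_zariski_Collect:
  assumes "\<And>p. p \<in> P \<Longrightarrow> poly_fun p" shows "closedin zariski {c. \<forall>p\<in>P. p c = 0}"
  using assms unfolding closedin_zariski zero_locus_def by blast

lemma topspace_zariski: "topspace zariski = UNIV"
proof -
  show ?thesis using closedin_subset[OF closedin_zariski_Collect[of "{}"]] by auto
qed

lemma closedin_zariski_all:
  assumes "\<And>i. poly_fun (p i)" shows "closedin zariski {c. \<forall>i. p i c = 0}"
  using closedin_zariski_Collect[of "range p"] assms by auto

lemma closedin_zariski_eq0: "poly_fun p \<Longrightarrow> closedin zariski {c. p c = 0}"
  using closedin_zariski_Collect[of "{p}"] by simp

text \<open>A closed set is cut out by single polynomials, so the closure consists of the common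
  zeros of all polynomials vanishing on \<open>S\<close>. Most closure arguments below therefore
  treat one polynomial at a time.\<close>

lemma in_closure_iff:
  "c \<in> zariski closure_of S \<longleftrightarrow> (\<forall>p. poly_fun p \<and> (\<forall>s\<in>S. p s = 0) \<longrightarrow> p c = 0)"
proof
  assume c: "c \<in> zariski closure_of S"
  show "\<forall>p. poly_fun p \<and> (\<forall>s\<in>S. p s = 0) \<longrightarrow> p c = 0"
  proof (intro allI impI)
    fix p assume p: "poly_fun p \<and> (\<forall>s\<in>S. p s = 0)"
    then have "zariski closure_of S \<subseteq> {c. p c = 0}"
      by (intro closure_of_minimal closedin_zariski_eq0) auto
    then show "p c = 0" using c by blast
  qed
next
  assume c: "\<forall>p. poly_fun p \<and> (\<forall>s\<in>S. p s = 0) \<longrightarrow> p c = 0"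
  have "closedin zariski (zariski closure_of S)" by simp
  then obtain P where P: "\<forall>p\<in>P. poly_fun p" "zariski closure_of S = zero_locus P"
    unfolding closedin_zariski by blast
  have "S \<subseteq> zero_locus P" using closure_of_subset[of S zariski] P(2) topspace_zariski by auto
  then have "c \<in> zero_locus P" using c P(1) unfolding zero_locus_def by blast
  then show "c \<in> zariski closure_of S" using P(2) by simp
qed

lemma subset_closure: "S \<subseteq> zariski closure_of S"
  by (simp add: closure_of_subset topspace_zariski)

text \<open>Polynomials are continuous, so Euclidean limits stay in the Zariski closure. The filter
  \<open>at 0\<close> is punctured: the algebra at \<open>t = 0\<close> itself may lie outside
  \<open>U\<close>.\<close>

lemma in_closure_limit:
  fixes S :: "complex \<Rightarrow> multiplication"
  assumes lim: "\<And>i j k. ((\<lambda>t. S t $ i $ j $ k) \<longlongrightarrow> c $ i $ j $ k) (at 0)"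
    and ev: "eventually (\<lambda>t. S t \<in> U) (at 0)"
  shows "c \<in> zariski closure_of U"
  unfolding in_closure_iff
proof (intro allI impI)
  fix p assume p: "poly_fun p \<and> (\<forall>s\<in>U. p s = 0)"
  have "poly_fun p" using p ..
  then have "((\<lambda>t. p (S t)) \<longlongrightarrow> p c) (at 0)"
    by induction (auto intro: tendsto_intros lim)
  moreover have "eventually (\<lambda>t. p (S t) = 0) (at 0)" using ev by eventually_elim (use p in blast)
  then have "((\<lambda>t. p (S t)) \<longlongrightarrow> 0) (at 0)" by (rule tendsto_eventually)
  ultimately show "p c = 0" using tendsto_unique[of "at (0::complex)"] by auto
qed

lemma poly_fun_gl_action:
  assumes "poly_fun p" shows "poly_fun (\<lambda>c. p (gl_action g c))"
  using assms
proof induction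
  case (coord i j k)
  then show ?case
    by (auto simp: gl_action_def matrix_vector_mult_def intro!: poly_fun_sum poly_fun_scale
        poly_fun_mult_nth poly_fun.const)
qed (auto intro: poly_fun.intros)

text \<open>A fixed \<open>g\<close> acts linearly on the structure constants, so composing with it
  turns a polynomial vanishing on the stable set \<open>U\<close> into another one.\<close>

lemma closure_orbit_stable:
  assumes "T \<in> zariski closure_of U" "c \<in> orbit T" "\<And>d e. d \<in> U \<Longrightarrow> e \<in> orbit d \<Longrightarrow> e \<in> U"
  shows "c \<in> zariski closure_of U"
proof -
  obtain g where g: "c = gl_action g T" "invertible g" using assms(2) by (auto simp: orbit_def)
  show ?thesis unfolding in_closure_iff
  proof (intro allI impI)
    fix p assume p: "poly_fun p \<and> (\<forall>s\<in>U. p s = 0)"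
    have "\<forall>s\<in>U. p (gl_action g s) = 0" using p assms(3) g(2) by (auto simp: orbit_def)
    then show "p c = 0"
      using assms(1) p poly_fun_gl_action[of p g] unfolding in_closure_iff g(1) by blast
  qed
qed

section \<open>Polynomial functions on matrices and closures of their images\<close>

inductive pol :: "('i \<Rightarrow> 'v \<Rightarrow> complex) \<Rightarrow> ('v \<Rightarrow> complex) \<Rightarrow> bool" for X where
  const: "pol X (\<lambda>v. a)"
| coord: "pol X (X i)"
| add: "pol X p \<Longrightarrow> pol X q \<Longrightarrow> pol X (\<lambda>v. p v + q v)"
| mult: "pol X p \<Longrightarrow> pol X q \<Longrightarrow> pol X (\<lambda>v. p v * q v)"

lemma pol_scale: "pol X p \<Longrightarrow> pol X (\<lambda>c. a * p c)"
  by (rule pol.mult[OF pol.const])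

lemma pol_diff: assumes "pol X p" "pol X q" shows "pol X (\<lambda>c. p c - q c)"
  using pol.add[OF assms(1) pol_scale[OF assms(2), of "-1"]] by simp

lemma pol_sum: "(\<And>i. i \<in> I \<Longrightarrow> pol X (p i)) \<Longrightarrow> pol X (\<lambda>c. \<Sum>i\<in>I. p i c)"
  by (induction I rule: infinite_finite_induct) (auto intro: pol.intros)

lemma pol_power: "pol X p \<Longrightarrow> pol X (\<lambda>c. p c ^ n)"
  by (induction n) (auto intro: pol.intros)

lemma pol_poly_fun:
  assumes "poly_fun p" "\<And>i j k. pol X (\<lambda>v. \<psi> v $ i $ j $ k)"
  shows "pol X (\<lambda>v. p (\<psi> v))"
  using assms(1) by induction (auto intro: pol.intros assms(2))

definition entry :: "3 \<times> 3 \<Rightarrow> complex^3^3 \<Rightarrow> complex" where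
  "entry = (\<lambda>(i, j) \<phi>. \<phi> $ i $ j)"

lemma pol_entry: "pol entry (\<lambda>\<phi>. \<phi> $ i $ j)"
  using pol.coord[of entry "(i, j)"] by (simp add: entry_def)

lemmas pol_intros = pol_entry pol.add pol.mult pol_diff pol_power pol.const

lemma pol_line:
  assumes "pol entry p"
  shows "\<exists>P. \<forall>t. p (\<chi> i j. u $ i $ j + t * (v $ i $ j - u $ i $ j)) = poly P t"
  using assms
proof induction
  case (const a)
  show ?case by (rule exI[of _ "[:a:]"]) simp
next
  case (coord x)
  obtain i j where "x = (i, j)" by (cases x)
  then show ?case
    by (intro exI[of _ "[:u $ i $ j, v $ i $ j - u $ i $ j:]"]) (simp add: entry_def)
next
  case (add p q)
  then obtain P Q where "\<forall>t. p (\<chi> i j. u $ i $ j + t * (v $ i $ j - u $ i $ j)) = poly P t"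
    "\<forall>t. q (\<chi> i j. u $ i $ j + t * (v $ i $ j - u $ i $ j)) = poly Q t" by blast
  then show ?case by (intro exI[of _ "P + Q"]) simp
next
  case (mult p q)
  then obtain P Q where "\<forall>t. p (\<chi> i j. u $ i $ j + t * (v $ i $ j - u $ i $ j)) = poly P t"
    "\<forall>t. q (\<chi> i j. u $ i $ j + t * (v $ i $ j - u $ i $ j)) = poly Q t" by blast
  then show ?case by (intro exI[of _ "P * Q"]) simp
qed

text \<open>Restricted to a line, a polynomial has finitely many zeros or vanishes.\<close>

lemma pol_domain:
  assumes "pol entry p" "pol entry q" "\<And>\<phi>. p \<phi> * q \<phi> = 0"
  shows "(\<forall>\<phi>. p \<phi> = 0) \<or> (\<forall>\<phi>. q \<phi> = 0)"
proof (rule ccontr)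
  assume "\<not> ?thesis"
  then obtain u v where uv: "p u \<noteq> 0" "q v \<noteq> 0" by blast
  let ?l = "\<lambda>t. \<chi> i j. u $ i $ j + t * (v $ i $ j - u $ i $ j)"
  obtain P Q where P: "\<And>t. p (?l t) = poly P t" and Q: "\<And>t. q (?l t) = poly Q t"
    using pol_line[OF assms(1)] pol_line[OF assms(2)] by metis
  have "?l 0 = u" "?l 1 = v" by (simp_all add: vec_eq_iff)
  then have "P \<noteq> 0" "Q \<noteq> 0" using uv P[of 0] Q[of 1] by auto
  moreover have "poly (P * Q) t = 0" for t using assms(3)[of "?l t"] P[of t] Q[of t] by simp
  then have "P * Q = 0" using poly_all_0_iff_0 by blast
  ultimately show False by simp
qed

definition polymap :: "(complex^3^3 \<Rightarrow> multiplication) \<Rightarrow> bool" where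
  "polymap \<psi> \<longleftrightarrow> (\<forall>i j k. pol entry (\<lambda>\<phi>. \<psi> \<phi> $ i $ j $ k))"

lemma pol_polymap: "polymap \<psi> \<Longrightarrow> poly_fun p \<Longrightarrow> pol entry (\<lambda>\<phi>. p (\<psi> \<phi>))"
  by (rule pol_poly_fun) (auto simp: polymap_def)

text \<open>If neither closed set contains the image, two of their equations pull back to nonzero
  polynomials on matrices whose product vanishes everywhere, against
  \<open>pol_domain\<close>.\<close>

lemma irreducible_closure_range:
  assumes "polymap \<psi>" shows "irreducible_in zariski (zariski closure_of range \<psi>)"
  unfolding irreducible_in_def
proof (intro conjI allI impI)
  show "zariski closure_of range \<psi> \<subseteq> topspace zariski" by (rule closure_of_subset_topspace)
  show "zariski closure_of range \<psi> \<noteq> {}" using subset_closure[of "range \<psi>"] by blast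
next
  fix F G
  assume "closedin zariski F \<and> closedin zariski G \<and> zariski closure_of range \<psi> \<subseteq> F \<union> G"
  then have cl: "closedin zariski F" "closedin zariski G" and sub: "range \<psi> \<subseteq> F \<union> G"
    using subset_closure[of "range \<psi>"] by blast+
  obtain P Q where P: "\<forall>p\<in>P. poly_fun p" "F = zero_locus P"
    and Q: "\<forall>p\<in>Q. poly_fun p" "G = zero_locus Q"
    using cl unfolding closedin_zariski by blast
  have "range \<psi> \<subseteq> F \<or> range \<psi> \<subseteq> G"
  proof (rule ccontr)
    assume "\<not> ?thesis"
    then obtain u v p q where pq: "p \<in> P" "p (\<psi> u) \<noteq> 0" "q \<in> Q" "q (\<psi> v) \<noteq> 0"
      unfolding P(2) Q(2) zero_locus_def by auto
    have "p (\<psi> \<phi>) * q (\<psi> \<phi>) = 0" for \<phi>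
      using sub pq unfolding P(2) Q(2) zero_locus_def by auto
    then have "(\<forall>\<phi>. p (\<psi> \<phi>) = 0) \<or> (\<forall>\<phi>. q (\<psi> \<phi>) = 0)"
      by (intro pol_domain pol_polymap[OF assms]) (use P(1) Q(1) pq in auto)
    then show False using pq by blast
  qed
  then show "zariski closure_of range \<psi> \<subseteq> F \<or> zariski closure_of range \<psi> \<subseteq> G"
    using closure_of_minimal cl by blast
qed

text \<open>If \<open>p\<close> vanishes on \<open>S\<close>, the product of its pullback with
  \<open>D\<close> vanishes at every matrix; as \<open>D\<close> is not identically zero, the
  pullback is. Hence only generic parameters have to be examined.\<close>

lemma closure_dense:
  assumes "polymap \<psi>" "pol entry D" "D \<phi>\<^sub>0 \<noteq> 0" "\<And>\<phi>. D \<phi> \<noteq> 0 \<Longrightarrow> \<psi> \<phi> \<in> S"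
  shows "range \<psi> \<subseteq> zariski closure_of S"
proof
  fix c assume "c \<in> range \<psi>"
  then obtain \<phi> where \<phi>: "c = \<psi> \<phi>" by blast
  show "c \<in> zariski closure_of S" unfolding in_closure_iff
  proof (intro allI impI)
    fix p assume p: "poly_fun p \<and> (\<forall>s\<in>S. p s = 0)"
    have "p (\<psi> \<phi>) * D \<phi> = 0" for \<phi> using p assms(4) by (cases "D \<phi> = 0") auto
    then have "(\<forall>\<phi>. p (\<psi> \<phi>) = 0) \<or> (\<forall>\<phi>. D \<phi> = 0)"
      by (intro pol_domain assms(2) pol_polymap[OF assms(1)]) (use p in auto)
    then show "p c = 0" unfolding \<phi> using assms(3) by blast
  qed
qed

lemma closure_eq_range:
  assumes "polymap \<psi>" "pol entry D" "D \<phi>\<^sub>0 \<noteq> 0" "\<And>\<phi>. D \<phi> \<noteq> 0 \<Longrightarrow> \<psi> \<phi> \<in> S" "S \<subseteq> range \<psi>"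
  shows "zariski closure_of S = zariski closure_of range \<psi>"
proof
  show "zariski closure_of S \<subseteq> zariski closure_of range \<psi>" by (rule closure_of_mono[OF assms(5)])
  show "zariski closure_of range \<psi> \<subseteq> zariski closure_of S"
    by (rule closure_of_minimal[OF closure_dense[OF assms(1-4)]]) auto
qed

section \<open>Chains of irreducible closed sets\<close>

text \<open>Gaussian elimination by induction on the equations: one with a nonzero coefficient at
  \<open>a0\<close> is used to eliminate that unknown from all others.\<close>

lemma homogeneous_solution:
  fixes m :: "'a \<Rightarrow> 'b \<Rightarrow> 'c::field"
  assumes "finite B" "finite A" "card B < card A"
  shows "\<exists>u. (\<exists>a\<in>A. u a \<noteq> 0) \<and> (\<forall>b\<in>B. (\<Sum>a\<in>A. u a * m a b) = 0)"
  using assms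
proof (induction B arbitrary: A m rule: finite_induct)
  case empty
  then obtain a where "a \<in> A" by fastforce
  then show ?case by (intro exI[of _ "\<lambda>_. 1"]) auto
next
  case (insert b B)
  show ?case
  proof (cases "\<forall>a\<in>A. m a b = 0")
    case True
    obtain u where "(\<exists>a\<in>A. u a \<noteq> 0) \<and> (\<forall>b\<in>B. (\<Sum>a\<in>A. u a * m a b) = 0)"
      using insert.IH[of A m] insert.prems insert.hyps by auto
    with True show ?thesis by (intro exI[of _ u]) auto
  next
    case False
    then obtain a0 where a0: "a0 \<in> A" "m a0 b \<noteq> 0" by blast
    define m' where "m' a b' = m a b' - m a b / m a0 b * m a0 b'" for a b'
    have "card B < card (A - {a0})" using insert.prems insert.hyps a0 by simp
    then obtain u where u: "\<exists>a\<in>A - {a0}. u a \<noteq> 0" "\<forall>b\<in>B. (\<Sum>a\<in>A - {a0}. u a * m' a b) = 0"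
      using insert.IH[of "A - {a0}" m'] insert.prems(1) by auto
    define w where "w = u(a0 := - (\<Sum>a\<in>A - {a0}. u a * m a b) / m a0 b)"
    have S: "(\<Sum>a\<in>A. w a * m a b') = w a0 * m a0 b' + (\<Sum>a\<in>A - {a0}. u a * m a b')" for b'
    proof -
      have "(\<Sum>a\<in>A. w a * m a b') = w a0 * m a0 b' + (\<Sum>a\<in>A - {a0}. w a * m a b')"
        by (rule sum.remove) (use a0 insert.prems in auto)
      also have "(\<Sum>a\<in>A - {a0}. w a * m a b') = (\<Sum>a\<in>A - {a0}. u a * m a b')"
        by (rule sum.cong) (auto simp: w_def)
      finally show ?thesis .
    qed
    have "(\<Sum>a\<in>A. w a * m a b') = 0" if "b' \<in> insert b B" for b'
    proof (cases "b' = b")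
      case True
      then show ?thesis unfolding S using a0 by (simp add: w_def)
    next
      case False
      then have "0 = (\<Sum>a\<in>A - {a0}. u a * m' a b')" using u(2) that by auto
      also have "\<dots> = (\<Sum>a\<in>A - {a0}. u a * m a b') - (\<Sum>a\<in>A - {a0}. u a * m a b) / m a0 b * m a0 b'"
        by (simp add: m'_def right_diff_distrib sum_subtractf sum_divide_distrib sum_distrib_right
            mult.assoc)
      finally show ?thesis unfolding S by (simp add: w_def)
    qed
    moreover have "\<exists>a\<in>A. w a \<noteq> 0" using u(1) by (auto simp: w_def)
    ultimately show ?thesis by blast
  qed
qed

text \<open>The bound applies to the exponent of each variable separately and not to the total
  degree, so that the admissible monomials form a box whose cardinality is exactly a power.\<close>

inductive bounded_pol :: "('i::finite \<Rightarrow> 'v \<Rightarrow> complex) \<Rightarrow> nat \<Rightarrow> ('v \<Rightarrow> complex) \<Rightarrow> bool"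
  for X D where
  monomial: "(\<And>i. b i \<le> D) \<Longrightarrow> bounded_pol X D (\<lambda>v. \<Prod>i\<in>UNIV. X i v ^ b i)"
| add: "bounded_pol X D p \<Longrightarrow> bounded_pol X D q \<Longrightarrow> bounded_pol X D (\<lambda>v. p v + q v)"
| scale: "bounded_pol X D p \<Longrightarrow> bounded_pol X D (\<lambda>v. a * p v)"

lemma bounded_pol_const: "bounded_pol X D (\<lambda>v. a)"
  using bounded_pol.scale[OF bounded_pol.monomial[of "\<lambda>_. 0" D X], of a] by simp

lemma bounded_pol_mono: "bounded_pol X D f \<Longrightarrow> D \<le> E \<Longrightarrow> bounded_pol X E f"
  by (induction rule: bounded_pol.induct)
    (auto intro: bounded_pol.add bounded_pol.scale bounded_pol.monomial le_trans)

lemma bounded_pol_mult: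
  assumes "bounded_pol X D f" "bounded_pol X E g"
  shows "bounded_pol X (D + E) (\<lambda>v. f v * g v)"
  using assms(1)
proof induction
  case (monomial b)
  show ?case using assms(2)
  proof induction
    case (monomial b')
    have "bounded_pol X (D + E) (\<lambda>v. \<Prod>i\<in>UNIV. X i v ^ (b i + b' i))"
      by (rule bounded_pol.monomial) (simp add: monomial \<open>\<And>i. b i \<le> D\<close> add_mono)
    then show ?case by (simp add: power_add prod.distrib)
  next
    case (add p q)
    then show ?case using bounded_pol.add[OF add.IH] by (simp add: distrib_left)
  next
    case (scale p a)
    then show ?case using bounded_pol.scale[OF scale.IH, of a] by (simp add: mult.left_commute)
  qed
next
  case (add p q)
  then show ?case using bounded_pol.add[OF add.IH] by (simp add: distrib_right)
next
  case (scale p a)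
  then show ?case using bounded_pol.scale[OF scale.IH, of a] by (simp add: mult.assoc)
qed

lemma pol_bounded: "pol X f \<Longrightarrow> \<exists>D. bounded_pol X D f"
proof (induction rule: pol.induct)
  case (const a)
  then show ?case using bounded_pol_const by blast
next
  case (coord i)
  have "bounded_pol X 1 (\<lambda>v. \<Prod>j\<in>UNIV. X j v ^ (if j = i then 1 else 0))"
    by (rule bounded_pol.monomial) simp
  moreover have "(\<Prod>j\<in>UNIV. X j v ^ (if j = i then 1 else 0)) = X i v" for v
    by (simp add: if_distrib cong: if_cong)
  ultimately show ?case by auto
next
  case (add p q)
  then obtain D E where "bounded_pol X D p" "bounded_pol X E q" by blast
  then have "bounded_pol X (D + E) p" "bounded_pol X (D + E) q"
    by (auto elim: bounded_pol_mono)
  then show ?case using bounded_pol.add by blast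
next
  case (mult p q)
  then show ?case using bounded_pol_mult by blast
qed

lemma bounded_pol_power: "bounded_pol X D f \<Longrightarrow> bounded_pol X (D * k) (\<lambda>v. f v ^ k)"
proof (induction k)
  case (Suc k)
  then show ?case using bounded_pol_mult[OF Suc.prems Suc.IH] by simp
qed (simp add: bounded_pol_const)

lemma bounded_pol_prod:
  assumes "\<And>i. i < n \<Longrightarrow> bounded_pol X D (f i)"
  shows "bounded_pol X (D * n) (\<lambda>v. \<Prod>i<n. f i v)"
  using assms
proof (induction n)
  case (Suc n)
  then show ?case using bounded_pol_mult[of X "D * n" "\<lambda>v. \<Prod>i<n. f i v" D "f n"]
    by (simp add: add.commute)
qed (simp add: bounded_pol_const)

lemma bounded_pol_coeffs:
  fixes X :: "'i::finite \<Rightarrow> 'v \<Rightarrow> complex"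
  assumes "bounded_pol X D f"
  shows "\<exists>m. \<forall>v. f v = (\<Sum>b\<in>UNIV \<rightarrow>\<^sub>E {..D}. m b * (\<Prod>i\<in>UNIV. X i v ^ b i))"
  using assms
proof induction
  case (monomial b)
  have fin: "finite ((UNIV::'i set) \<rightarrow>\<^sub>E {..D})" by (simp add: finite_PiE)
  have "b \<in> UNIV \<rightarrow>\<^sub>E {..D}" using monomial by auto
  then show ?case using fin
    by (intro exI[of _ "\<lambda>b'. if b' = b then 1 else 0"]) (simp add: if_distrib[of "\<lambda>x. x * _"] cong: if_cong)
next
  case (add p q)
  then obtain m m' where "\<forall>v. p v = (\<Sum>b\<in>UNIV \<rightarrow>\<^sub>E {..D}. m b * (\<Prod>i\<in>UNIV. X i v ^ b i))"
    "\<forall>v. q v = (\<Sum>b\<in>UNIV \<rightarrow>\<^sub>E {..D}. m' b * (\<Prod>i\<in>UNIV. X i v ^ b i))" by blast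
  then show ?case by (intro exI[of _ "\<lambda>b. m b + m' b"]) (simp add: distrib_right sum.distrib)
next
  case (scale p a)
  then obtain m where "\<forall>v. p v = (\<Sum>b\<in>UNIV \<rightarrow>\<^sub>E {..D}. m b * (\<Prod>i\<in>UNIV. X i v ^ b i))" by blast
  then show ?case by (intro exI[of _ "\<lambda>b. a * m b"]) (simp add: sum_distrib_left mult.assoc)
qed

text \<open>A polynomial relation is encoded by its coefficients \<open>u\<close> on a box of
  exponent vectors. Extensional functions make each exponent vector unique, so the box can be
  counted.\<close>

definition alg_indep :: "'a set \<Rightarrow> nat \<Rightarrow> (nat \<Rightarrow> 'a \<Rightarrow> complex) \<Rightarrow> bool" where
  "alg_indep Z d f \<longleftrightarrow> (\<forall>N u.
     (\<forall>x\<in>Z. (\<Sum>a\<in>{..<d} \<rightarrow>\<^sub>E {..N}. u a * (\<Prod>i<d. f i x ^ a i)) = 0) \<longrightarrow>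
     (\<forall>a\<in>{..<d} \<rightarrow>\<^sub>E {..N::nat}. u a = 0))"

text \<open>Compare \<open>(N + 1)\<^sup>n\<close> monomials in the \<open>f i\<close> with the
  \<open>O(N\<^sup>d)\<close>-dimensional space of polynomials in \<open>d\<close> variables which contains their pullbacks.\<close>

lemma alg_indep_bound:
  fixes X :: "'i::finite \<Rightarrow> 'v \<Rightarrow> complex" and f :: "nat \<Rightarrow> 'a \<Rightarrow> complex"
  assumes "alg_indep (range \<psi>) n f" "\<And>i. i < n \<Longrightarrow> pol X (\<lambda>v. f i (\<psi> v))"
  shows "n \<le> CARD('i)"
proof (rule ccontr)
  assume n: "\<not> n \<le> CARD('i)"
  obtain E where E: "\<And>i. i < n \<Longrightarrow> bounded_pol X (E i) (\<lambda>v. f i (\<psi> v))"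
    using pol_bounded[OF assms(2)] by metis
  define D where "D = (\<Sum>i<n. E i)"
  have D: "bounded_pol X D (\<lambda>v. f i (\<psi> v))" if "i < n" for i
    using E[OF that] by (rule bounded_pol_mono) (use that in \<open>simp add: D_def member_le_sum\<close>)
  have le: "(N + 1) ^ n \<le> (D * N * n + 1) ^ CARD('i)" for N
  proof (rule ccontr)
    assume less: "\<not> ?thesis"
    let ?A = "{..<n} \<rightarrow>\<^sub>E {..N}" and ?B = "(UNIV::'i set) \<rightarrow>\<^sub>E {..D * N * n}"
    have "\<forall>a\<in>?A. \<exists>m. \<forall>v. (\<Prod>i<n. f i (\<psi> v) ^ a i) = (\<Sum>b\<in>?B. m b * (\<Prod>i\<in>UNIV. X i v ^ b i))"
    proof (rule ballI, rule bounded_pol_coeffs, rule bounded_pol_prod)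
      fix a i assume a: "a \<in> ?A" and i: "i < n"
      have "a i \<le> N" using a i by (auto simp: PiE_iff)
      then show "bounded_pol X (D * N) (\<lambda>v. f i (\<psi> v) ^ a i)"
        by (intro bounded_pol_mono[OF bounded_pol_power[OF D[OF i]]]) simp
    qed
    from bchoice[OF this] obtain m where m: "\<forall>a\<in>?A. \<forall>v.
        (\<Prod>i<n. f i (\<psi> v) ^ a i) = (\<Sum>b\<in>?B. m a b * (\<Prod>i\<in>UNIV. X i v ^ b i))" by blast
    have "finite ?A" "finite ?B" by (simp_all add: finite_PiE)
    moreover have "card ?B < card ?A" using less by (simp add: card_PiE)
    ultimately obtain u where u: "\<exists>a\<in>?A. u a \<noteq> 0" "\<forall>b\<in>?B. (\<Sum>a\<in>?A. u a * m a b) = 0"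
      using homogeneous_solution[of ?B ?A m] by blast
    have "(\<Sum>a\<in>?A. u a * (\<Prod>i<n. f i (\<psi> v) ^ a i)) = 0" for v
    proof -
      have "(\<Sum>a\<in>?A. u a * (\<Prod>i<n. f i (\<psi> v) ^ a i))
          = (\<Sum>a\<in>?A. \<Sum>b\<in>?B. u a * m a b * (\<Prod>i\<in>UNIV. X i v ^ b i))"
        by (rule sum.cong) (simp_all add: m sum_distrib_left mult.assoc)
      also have "\<dots> = (\<Sum>b\<in>?B. \<Sum>a\<in>?A. u a * m a b * (\<Prod>i\<in>UNIV. X i v ^ b i))"
        by (rule sum.swap)
      also have "\<dots> = (\<Sum>b\<in>?B. (\<Sum>a\<in>?A. u a * m a b) * (\<Prod>i\<in>UNIV. X i v ^ b i))"
        by (simp add: sum_distrib_right)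
      also have "\<dots> = 0" using u(2) by simp
      finally show ?thesis .
    qed
    then show False using assms(1) u(1) unfolding alg_indep_def by blast
  qed
  \<comment> \<open>The right side is at most
    \<open>(D * n + 1) ^ CARD('i) * (N + 1) ^ CARD('i)\<close>, while the left side has at least one
    more factor \<open>N + 1\<close>. Taking \<open>N\<close> equal to the constant \<open>K\<close>
    gives the contradiction.\<close>
  define K where "K = (D * n + 1) ^ CARD('i)"
  have "(K + 1) ^ Suc CARD('i) \<le> (K + 1) ^ n" by (rule power_increasing) (use n in auto)
  also have "\<dots> \<le> (D * K * n + 1) ^ CARD('i)" by (rule le)
  also have "\<dots> \<le> ((D * n + 1) * (K + 1)) ^ CARD('i)" by (rule power_mono) (auto simp: algebra_simps)
  also have "\<dots> = K * (K + 1) ^ CARD('i)" by (simp only: K_def power_mult_distrib)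
  finally show False by simp
qed

text \<open>Order a relation by powers of \<open>h\<close>, with coefficients \<open>g k\<close>
  that are polynomials in the old functions. Irreducibility of \<open>Z'\<close> allows cancelling
  the lowest power of \<open>h\<close>; on \<open>Z\<close>, where \<open>h\<close> vanishes, only
  the lowest coefficient survives, and independence on \<open>Z\<close> kills it.\<close>

lemma alg_indep_extend:
  assumes ind: "alg_indep Z d f" and f: "\<And>i. i < d \<Longrightarrow> poly_fun (f i)" and sub: "Z \<subseteq> Z'"
    and irr: "irreducible_in zariski Z'" and h: "poly_fun h" "\<And>x. x \<in> Z \<Longrightarrow> h x = 0" "\<exists>x\<in>Z'. h x \<noteq> 0"
  shows "alg_indep Z' (Suc d) (f(d := h))"
  unfolding alg_indep_def
proof (intro allI impI)
  fix N :: nat and u :: "(nat \<Rightarrow> nat) \<Rightarrow> complex"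
  let ?A = "{..<d} \<rightarrow>\<^sub>E {..N}"
  define g where "g k x = (\<Sum>a\<in>?A. u (a(d := k)) * (\<Prod>i<d. f i x ^ a i))" for k x
  have expand: "(\<Sum>a\<in>{..<Suc d} \<rightarrow>\<^sub>E {..N}. u a * (\<Prod>i<Suc d. (f(d := h)) i x ^ a i))
      = (\<Sum>k\<le>N. h x ^ k * g k x)" for x
  proof -
    have S: "{..<Suc d} \<rightarrow>\<^sub>E {..N} = (\<lambda>(k, a). a(d := k)) ` ({..N} \<times> ?A)"
      unfolding lessThan_Suc PiE_insert_eq ..
    have inj: "inj_on (\<lambda>(k, a). a(d := k)) ({..N} \<times> ?A)"
      using inj_combinator[of d "{..<d}" "\<lambda>_. {..N}"] by simp
    have "(\<Sum>a\<in>{..<Suc d} \<rightarrow>\<^sub>E {..N}. u a * (\<Prod>i<Suc d. (f(d := h)) i x ^ a i))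
      = (\<Sum>(k, a)\<in>{..N} \<times> ?A. u (a(d := k)) * (\<Prod>i<Suc d. (f(d := h)) i x ^ (a(d := k)) i))"
      unfolding S by (subst sum.reindex[OF inj]) (simp add: case_prod_unfold)
    also have "\<dots> = (\<Sum>(k, a)\<in>{..N} \<times> ?A. h x ^ k * (u (a(d := k)) * (\<Prod>i<d. f i x ^ a i)))"
      by (intro sum.cong) (auto simp: mult_ac)
    also have "\<dots> = (\<Sum>k\<le>N. h x ^ k * g k x)"
      by (simp add: sum.cartesian_product[symmetric] g_def sum_distrib_left)
    finally show ?thesis .
  qed
  assume "\<forall>x\<in>Z'. (\<Sum>a\<in>{..<Suc d} \<rightarrow>\<^sub>E {..N}. u a * (\<Prod>i<Suc d. (f(d := h)) i x ^ a i)) = 0"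
  then have z: "(\<Sum>k\<le>N. h x ^ k * g k x) = 0" if "x \<in> Z'" for x using that unfolding expand by blast
  have g_poly: "poly_fun (g k)" for k
    unfolding g_def by (intro poly_fun_sum poly_fun_scale poly_fun_prod poly_fun_power f) auto
  have u0: "\<forall>a\<in>?A. u (a(d := k)) = 0" if "k \<le> N" for k
    using that
  proof (induction k rule: less_induct)
    case (less k)
    have g0: "g k' x = 0" if "k' < k" for k' x
    proof -
      have "\<forall>a\<in>?A. u (a(d := k')) = 0" by (rule less.IH[OF that]) (use less.prems that in simp)
      then show ?thesis unfolding g_def by (intro sum.neutral) auto
    qed
    \<comment> \<open>By induction all terms below \<open>k\<close> are zero, so \<open>G\<close> is
      the relation divided by \<open>h x ^ k\<close>.\<close>
    define G where "G x = (\<Sum>k'\<in>{k..N}. h x ^ (k' - k) * g k' x)" for x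
    have "poly_fun G" unfolding G_def
      by (intro poly_fun_sum poly_fun.mult poly_fun_power h g_poly)
    have "h x * G x = 0" if "x \<in> Z'" for x
    proof -
      have "0 = (\<Sum>k'\<le>N. h x ^ k' * g k' x)" using z[OF that] by simp
      also have "\<dots> = (\<Sum>k'\<in>{k..N}. h x ^ k' * g k' x)"
        by (rule sum.mono_neutral_right) (auto simp: g0 not_le)
      also have "\<dots> = h x ^ k * G x"
        unfolding G_def sum_distrib_left
        by (intro sum.cong) (auto simp: mult.assoc[symmetric] power_add[symmetric])
      finally show ?thesis by (cases "h x = 0") auto
    qed
    then have "Z' \<subseteq> {x. h x = 0} \<union> {x. G x = 0}" by auto
    then have "Z' \<subseteq> {x. h x = 0} \<or> Z' \<subseteq> {x. G x = 0}"
      using irr closedin_zariski_eq0[OF h(1)] closedin_zariski_eq0[OF \<open>poly_fun G\<close>]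
      unfolding irreducible_in_def by blast
    then have "Z' \<subseteq> {x. G x = 0}" using h(3) by blast
    moreover have "G x = g k x" if "x \<in> Z" for x
    proof -
      have "G x = (\<Sum>k'\<in>{k}. h x ^ (k' - k) * g k' x)"
        unfolding G_def by (rule sum.mono_neutral_right) (use less.prems h(2)[OF that] in auto)
      then show ?thesis by simp
    qed
    ultimately have "\<forall>x\<in>Z. g k x = 0" using sub by auto
    then show ?case
      using spec[OF spec[OF ind[unfolded alg_indep_def], of N], of "\<lambda>a. u (a(d := k))"] by (simp only: g_def) blast
  qed
  show "\<forall>a\<in>{..<Suc d} \<rightarrow>\<^sub>E {..N}. u a = 0"
    unfolding lessThan_Suc PiE_insert_eq using u0 by auto
qed

lemma chain_alg_indep:
  assumes "\<forall>i\<le>n. closedin zariski (Z i) \<and> irreducible_in zariski (Z i)" "\<forall>i<n. Z i \<subset> Z (Suc i)"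
  shows "\<exists>f. alg_indep (Z n) n f \<and> (\<forall>i<n. poly_fun (f i))"
  using assms
proof (induction n)
  case 0
  then obtain z where "z \<in> Z 0" by (auto simp: irreducible_in_def)
  then show ?case by (auto simp: alg_indep_def)
next
  case (Suc n)
  then obtain f where f: "alg_indep (Z n) n f" "\<forall>i<n. poly_fun (f i)" by auto
  obtain P where P: "\<forall>p\<in>P. poly_fun p" "Z n = zero_locus P"
    using Suc.prems(1) closedin_zariski by (metis le_SucI order_refl)
  have sub: "Z n \<subset> Z (Suc n)" using Suc.prems(2) by blast
  then obtain p x where p: "p \<in> P" "x \<in> Z (Suc n)" "p x \<noteq> 0" unfolding P(2) zero_locus_def by auto
  have "alg_indep (Z (Suc n)) (Suc n) (f(n := p))"
  proof (rule alg_indep_extend[OF f(1)])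
    show "irreducible_in zariski (Z (Suc n))" using Suc.prems(1) by blast
    show "p x = 0" if "x \<in> Z n" for x using that p(1) unfolding P(2) zero_locus_def by blast
  qed (use f(2) sub p P(1) in auto)
  then show ?case using f(2) P(1) p(1) by (intro exI[of _ "f(n := p)"] conjI) (assumption, auto simp: less_Suc_eq)
qed

text \<open>A relation valid on \<open>range \<psi>\<close> persists on its closure and hence on
  \<open>Z n\<close>. Thus independence passes from \<open>Z n\<close> to the image, where the only
  variables are the nine matrix entries.\<close>

lemma chain_length_le:
  assumes "\<forall>i\<le>n. closedin zariski (Z i) \<and> irreducible_in zariski (Z i)" "\<forall>i<n. Z i \<subset> Z (Suc i)"
    and "polymap \<psi>" "Z n \<subseteq> zariski closure_of range \<psi>"
  shows "n \<le> 9"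
proof -
  obtain f where f: "alg_indep (Z n) n f" "\<forall>i<n. poly_fun (f i)"
    using chain_alg_indep[OF assms(1,2)] by blast
  have "alg_indep (range \<psi>) n f" unfolding alg_indep_def
  proof (intro allI impI)
    fix N u
    let ?p = "\<lambda>x. \<Sum>a\<in>{..<n} \<rightarrow>\<^sub>E {..N::nat}. u a * (\<Prod>i<n. f i x ^ a i)"
    assume "\<forall>x\<in>range \<psi>. ?p x = 0"
    moreover have "poly_fun ?p"
      by (intro poly_fun_sum poly_fun_scale poly_fun_prod poly_fun_power) (use f(2) in auto)
    ultimately have "\<forall>x\<in>Z n. ?p x = 0" using assms(4) unfolding in_closure_iff subset_eq by blast
    then show "\<forall>a\<in>{..<n} \<rightarrow>\<^sub>E {..N}. u a = 0" using f(1) unfolding alg_indep_def by blast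
  qed
  moreover have "pol entry (\<lambda>\<phi>. f i (\<psi> \<phi>))" if "i < n" for i
    using pol_polymap[OF assms(3)] f(2) that by blast
  ultimately have "n \<le> CARD(3 \<times> 3)" by (rule alg_indep_bound)
  then show ?thesis by simp
qed

section \<open>The perm variety\<close>

lemma closedin_perm: "closedin zariski {c. perm_algebra c}"
proof -
  have "closedin zariski {c. \<forall>i. (case i of (x, y, z, k) \<Rightarrow>
      (\<lambda>c. (mult c (mult c x y) z - mult c x (mult c y z)) $ k)) c = 0}" (is "closedin _ ?A")
    by (rule closedin_zariski_all) (auto intro!: poly_fun_intros split: prod.splits)
  moreover have "closedin zariski {c. \<forall>i. (case i of (x, y, z, k) \<Rightarrow>
      (\<lambda>c. (mult c (mult c x y) z - mult c (mult c x z) y) $ k)) c = 0}" (is "closedin _ ?B")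
    by (rule closedin_zariski_all) (auto intro!: poly_fun_intros split: prod.splits)
  moreover have "?A = {c. \<forall>x y z. mult c (mult c x y) z = mult c x (mult c y z)}"
    by (simp add: vec_eq_iff[of "mult _ _ _"])
  moreover have "?B = {c. \<forall>x y z. mult c (mult c x y) z = mult c (mult c x z) y}"
    by (simp add: vec_eq_iff[of "mult _ _ _"])
  ultimately have "closedin zariski ({c. \<forall>x y z. mult c (mult c x y) z = mult c x (mult c y z)} \<inter>
      {c. \<forall>x y z. mult c (mult c x y) z = mult c (mult c x z) y})"
    by (simp only: closedin_Int)
  moreover have "{c. \<forall>x y z. mult c (mult c x y) z = mult c x (mult c y z)} \<inter>
      {c. \<forall>x y z. mult c (mult c x y) z = mult c (mult c x z) y} = {c. perm_algebra c}"
    unfolding perm_algebra_def by blast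
  ultimately show ?thesis by simp
qed

lemma topspace_perm_variety: "topspace perm_variety = {c. perm_algebra c}"
  by (simp add: perm_variety_def topspace_zariski)

lemma closedin_perm_variety:
  "closedin perm_variety S \<longleftrightarrow> closedin zariski S \<and> (\<forall>c\<in>S. perm_algebra c)"
  unfolding perm_variety_def closedin_closed_subtopology[OF closedin_perm] by auto

lemma irreducible_in_perm_variety:
  "irreducible_in perm_variety S \<longleftrightarrow> irreducible_in zariski S \<and> (\<forall>c\<in>S. perm_algebra c)"
proof
  assume S: "irreducible_in perm_variety S"
  then have p: "\<forall>c\<in>S. perm_algebra c" by (auto simp: irreducible_in_def topspace_perm_variety)
  have "S \<subseteq> F \<or> S \<subseteq> G" if FG: "closedin zariski F" "closedin zariski G" "S \<subseteq> F \<union> G" for F G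
  proof -
    have "closedin perm_variety (F \<inter> {c. perm_algebra c})"
      "closedin perm_variety (G \<inter> {c. perm_algebra c})"
      using FG closedin_perm by (auto simp: closedin_perm_variety)
    moreover have "S \<subseteq> (F \<inter> {c. perm_algebra c}) \<union> (G \<inter> {c. perm_algebra c})" using FG p by auto
    ultimately show ?thesis using S unfolding irreducible_in_def by blast
  qed
  with S p show "irreducible_in zariski S \<and> (\<forall>c\<in>S. perm_algebra c)"
    by (auto simp: irreducible_in_def topspace_zariski)
next
  assume "irreducible_in zariski S \<and> (\<forall>c\<in>S. perm_algebra c)"
  then show "irreducible_in perm_variety S"
    unfolding irreducible_in_def closedin_perm_variety topspace_perm_variety by auto
qed

section \<open>Classification\<close>

lemma exists_basis2:
  assumes "a \<noteq> 0" "\<And>k. b \<noteq> k *s a"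
  shows "\<exists>n. det3 a b n \<noteq> 0"
proof (rule ccontr)
  assume "\<not> ?thesis"
  then have d: "det3 a b n = 0" for n by simp
  have m: "b$2 * a$3 = b$3 * a$2" "b$1 * a$3 = b$3 * a$1" "b$1 * a$2 = b$2 * a$1"
    using d[of "axis 1 1"] d[of "axis 2 1"] d[of "axis 3 1"]
    by (simp_all add: det3_def axis_def algebra_simps)
  obtain i where i: "a$i \<noteq> 0" using assms(1) by (auto simp: vec_eq_iff)
  have "b = (b$i / a$i) *s a"
    using i m exhaust_3[of i] by (auto simp: vec_eq_iff forall_3 field_simps)
  then show False using assms(2) by blast
qed

lemma exists_basis1:
  assumes "a \<noteq> 0" shows "\<exists>b n. det3 a b n \<noteq> 0"
proof (rule ccontr)
  assume "\<not> ?thesis"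
  then have "\<And>b n. det3 a b n = 0" by simp
  from this[of "axis 1 1" "axis 2 1"] this[of "axis 1 1" "axis 3 1"] this[of "axis 2 1" "axis 3 1"]
  have "a = 0" by (simp add: det3_def axis_def vec_eq_iff forall_3)
  with assms show False by simp
qed

lemma det3_comb:
  "det3 (p1 *s e + q1 *s u + r1 *s v) (p2 *s e + q2 *s u + r2 *s v) (p3 *s e + q3 *s u + r3 *s v)
   = (p1 * (q2 * r3 - q3 * r2) - q1 * (p2 * r3 - p3 * r2) + r1 * (p2 * q3 - p3 * q2)) * det3 e u v"
  unfolding det3_def by simp algebra

lemma nonroot: "(P :: complex poly) \<noteq> 0 \<Longrightarrow> \<exists>x. poly P x \<noteq> 0"
  using poly_all_0_iff_0 by blast

lemma quadratic_nonroot: "\<exists>x::complex. x * x + b * x + c \<noteq> 0"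
  using nonroot[of "[:c, b, 1:]"] by (auto simp: algebra_simps)

text \<open>The quotient of \<open>C[x, y]\<close> by the square of the ideal \<open>(x, y)\<close>.
  Next to it, \<open>D2\<close> is the direct sum of the field and a plane with zero
  product.\<close>

definition D1 :: multiplication where
  "D1 = (\<chi> i j k. if (i, j, k) \<in> {(1, 1, 1), (1, 2, 2), (2, 1, 2), (1, 3, 3), (3, 1, 3)} then 1 else 0)"

definition D2 :: multiplication where
  "D2 = (\<chi> i j k. if (i, j, k) = (1, 1, 1) then 1 else 0)"

text \<open>For nonzero parameter both \<open>E1\<close> and \<open>E2\<close> are isomorphic to
  \<open>A24\<close>. The value 0 is included because the Peirce analysis leaves one structure
  constant undetermined.\<close>

definition E1 :: "complex \<Rightarrow> multiplication" where
  "E1 \<gamma> = (\<chi> i j k. if (i, j, k) \<in> {(1, 1, 1), (2, 1, 2)} then 1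
                     else if (i, j, k) = (3, 3, 3) then \<gamma> else 0)"

definition E2 :: "complex \<Rightarrow> multiplication" where
  "E2 \<beta> = (\<chi> i j k. if (i, j, k) \<in> {(1, 1, 1), (1, 2, 2), (2, 1, 2), (3, 1, 3)} then 1
                     else if (i, j, k) = (2, 2, 2) then \<beta> else 0)"

definition monogenic :: "multiplication \<Rightarrow> bool" where
  "monogenic c \<longleftrightarrow> (\<exists>a. det3 a (mult c a a) (mult c a (mult c a a)) \<noteq> 0)"

definition line_valued :: "multiplication \<Rightarrow> bool" where
  "line_valued c \<longleftrightarrow> (\<exists>w. w \<noteq> 0 \<and> (\<forall>x y. \<exists>k. mult c x y = k *s w)
     \<and> (\<forall>x. mult c x w = 0 \<and> mult c w x = 0))"

lemma idx3: "(1::3) \<noteq> 2" "(1::3) \<noteq> 3" "(2::3) \<noteq> 3" "(2::3) \<noteq> 1" "(3::3) \<noteq> 1" "(3::3) \<noteq> 2"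
  by simp_all

locale perm_alg =
  fixes c :: multiplication
  assumes perm_algebra: "perm_algebra c"
begin

abbreviation prd :: "complex^3 \<Rightarrow> complex^3 \<Rightarrow> complex^3" (infixl "\<odot>" 70) where
  "x \<odot> y \<equiv> mult c x y"

lemma assoc: "(x \<odot> y) \<odot> z = x \<odot> (y \<odot> z)"
  using perm_algebra unfolding perm_algebra_def by blast

lemma perm: "x \<odot> (y \<odot> z) = x \<odot> (z \<odot> y)"
  using perm_algebra unfolding perm_algebra_def by metis

lemma line_valuedI:
  assumes b: "det3 u v w \<noteq> 0"
    and "u \<odot> u = k1 *s w" "u \<odot> v = k2 *s w" "v \<odot> u = k3 *s w" "v \<odot> v = k4 *s w"
    and "u \<odot> w = 0" "w \<odot> u = 0" "v \<odot> w = 0" "w \<odot> v = 0" "w \<odot> w = 0"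
  shows "line_valued c"
  unfolding line_valued_def
proof (intro exI[of _ w] conjI allI)
  show "w \<noteq> 0" using b by (auto simp: det3_linear)
  fix x
  obtain p q r where x: "x = p *s u + q *s v + r *s w" using basis_coords[OF b] .
  show "x \<odot> w = 0" "w \<odot> x = 0" unfolding x by (simp_all add: mult_linear assms)
  fix y
  obtain p' q' r' where y: "y = p' *s u + q' *s v + r' *s w" using basis_coords[OF b] .
  have "x \<odot> y = (p * p' * k1 + p * q' * k2 + q * p' * k3 + q * q' * k4) *s w"
    unfolding x y by (simp add: mult_linear assms) (simp add: vec_eq_iff algebra_simps)
  then show "\<exists>k. x \<odot> y = k *s w" by blast
qed

text \<open>If all squares vanish, the product is anticommutative and all triple products vanish, so
  a single nonzero product spans the line. Otherwise the line is spanned by a nonzero square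
  \<open>s\<close>: it is first shown that \<open>s\<close> annihilates everything, then that every
  product is a multiple of it.\<close>

lemma nil_line_valued:
  assumes nil: "\<And>a. a \<odot> (a \<odot> a) = 0"
  shows "line_valued c"
proof (cases "\<forall>a. a \<odot> a = 0")
  case True
  have anti: "x \<odot> y = - (y \<odot> x)" for x y
  proof -
    have "(x + y) \<odot> (x + y) = 0" using True by blast
    then have "x \<odot> y + y \<odot> x = 0" using True by (simp add: mult_linear add.commute)
    then show ?thesis by (simp add: eq_neg_iff_add_eq_0)
  qed
  \<comment> \<open>The perm identity makes the expression symmetric in \<open>y, z\<close>,
    anticommutativity makes it skew.\<close>
  have triple: "x \<odot> (y \<odot> z) = 0" for x y z
  proof -
    have "x \<odot> (y \<odot> z) = x \<odot> (- (y \<odot> z))" using perm[of x y z] anti[of z y] by simp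
    also have "\<dots> = - (x \<odot> (y \<odot> z))"
      using mult_scale_right[of c x "-1" "y \<odot> z"] by simp
    finally show ?thesis by (simp add: vec_eq_iff)
  qed
  show ?thesis
  proof (cases "\<forall>x y. x \<odot> y = 0")
    case True
    then show ?thesis
      unfolding line_valued_def by (intro exI[of _ "axis 1 1"]) (auto intro: exI[of _ 0])
  next
    case False
    then obtain x y where xy: "x \<odot> y \<noteq> 0" by blast
    let ?w = "x \<odot> y"
    have "x \<noteq> 0" using xy by (auto simp: mult_linear)
    moreover have "y \<noteq> k *s x" for k using xy True by (auto simp: mult_linear)
    ultimately obtain n where n: "det3 x y n \<noteq> 0" using exists_basis2 by blast
    obtain p q r where w: "?w = p *s x + q *s y + r *s n" using basis_coords[OF n] .
    \<comment> \<open>Were \<open>?w\<close> in the span of \<open>x, y\<close>, multiplying it by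
      \<open>x\<close> on the left and by \<open>y\<close> on the right would give \<open>q\<close>
      and \<open>p\<close> times \<open>?w\<close>, although both triple products are zero.\<close>
    have "r \<noteq> 0"
    proof
      assume r: "r = 0"
      have "x \<odot> (p *s x + q *s y + r *s n) = q *s ?w" "(p *s x + q *s y + r *s n) \<odot> y = p *s ?w"
        using r True by (simp_all add: mult_linear)
      then have "q *s ?w = 0" "p *s ?w = 0" unfolding w[symmetric] by (simp_all add: triple assoc)
      then have "p = 0" "q = 0" using xy by simp_all
      with r w xy show False by simp
    qed
    then have b: "det3 x y ?w \<noteq> 0" unfolding w using n by (simp add: det3_linear)
    have [simp]: "x \<odot> x = 0" "y \<odot> y = 0" using True by auto
    show ?thesis
      by (rule line_valuedI[OF b, of 0 1 "-1" 0]) (use anti[of y x] in \<open>simp_all add: triple assoc mult_linear\<close>)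
  qed
next
  case False
  then obtain a where aa: "a \<odot> a \<noteq> 0" by blast
  define s where "s = a \<odot> a"
  have s0: "s \<noteq> 0" using aa by (simp add: s_def)
  have a0: "a \<noteq> 0" using aa by (auto simp: mult_linear)
  have as: "a \<odot> s = 0" using nil by (simp add: s_def)
  have sa: "s \<odot> a = 0" using nil by (simp add: s_def assoc)
  have ss: "s \<odot> s = 0" by (simp add: s_def assoc) (metis as s_def mult_zero_right)
  have "s \<noteq> k *s a" for k
  proof
    assume s: "s = k *s a"
    have "0 = k *s s" using as unfolding s by (simp add: mult_linear flip: s_def) (simp add: s)
    with s0 s show False by simp
  qed
  then obtain b where b: "det3 a s b \<noteq> 0" using exists_basis2[OF a0] by blast
  have saab: "s \<odot> x = a \<odot> (a \<odot> x)" for x by (simp add: s_def assoc)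
  have lin: "b \<odot> s = (-2) *s (s \<odot> b)"
  proof -
    have p: "a \<odot> (b \<odot> a) = a \<odot> (a \<odot> b)" "b \<odot> (b \<odot> a) = b \<odot> (a \<odot> b)" by (rule perm)+
    \<comment> \<open>The difference of these cubes keeps the terms of odd degree in
      \<open>b\<close>. The cube of \<open>b\<close> vanishes, which leaves the linearization of the
      nil identity.\<close>
    have "(a + b) \<odot> ((a + b) \<odot> (a + b)) - (a - b) \<odot> ((a - b) \<odot> (a - b)) = 0" using nil by simp
    then have "2 *s (2 *s (a \<odot> (a \<odot> b)) + b \<odot> (a \<odot> a)) = 0"
      using nil[of a] nil[of b] by (simp add: mult_linear p) (simp add: vec_eq_iff algebra_simps)
    then show ?thesis unfolding saab s_def[symmetric] by (simp add: vec_eq_iff add_eq_0_iff)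
  qed
  have sb: "s \<odot> b = 0"
  proof -
    obtain p q r where e: "s \<odot> b = p *s a + q *s s + r *s b" using basis_coords[OF b] .
    have "a \<odot> (s \<odot> b) = 0" by (simp add: as mult_linear flip: assoc)
    then have ab: "p *s s + r *s (a \<odot> b) = 0" unfolding e by (simp add: mult_linear as flip: s_def)
    have "r = 0"
    proof (rule ccontr)
      assume r: "r \<noteq> 0"
      have "a \<odot> (p *s s + r *s (a \<odot> b)) = 0" unfolding ab by (simp add: mult_linear)
      then have "s \<odot> b = 0" using r by (simp add: mult_linear as saab)
      then have "p *s a + q *s s + r *s b = 0" using e by simp
      then show False using basis_coords_zero[OF b] r by blast
    qed
    then have p: "p = 0" using ab s0 by simp
    \<comment> \<open>At this point \<open>s\<close> is an eigenvector of right multiplication by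
      \<open>b\<close> with eigenvalue \<open>q\<close>, and the cube of \<open>b\<close> is
      zero.\<close>
    have "s \<odot> (b \<odot> (b \<odot> b)) = ((s \<odot> b) \<odot> b) \<odot> b" by (simp add: assoc)
    also have "\<dots> = (q * q * q) *s s" using e p \<open>r = 0\<close> by (simp add: mult_linear)
    finally have "q = 0" using nil s0 by (simp add: mult_linear)
    with e p \<open>r = 0\<close> show ?thesis by simp
  qed
  have bs: "b \<odot> s = 0" using lin sb by simp
  \<comment> \<open>The second relation comes from multiplying the expansion of \<open>x\<close> by
    \<open>a\<close> on one side. It puts \<open>x\<close> on the line of \<open>s\<close>: by
    division if \<open>r\<close> is nonzero, and through \<open>p = 0\<close> otherwise.\<close>
  have inL: "\<exists>k. x = k *s s" if x: "x = p *s a + q *s s + r *s b" and "p *s s + r *s x = 0" for x p q r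
  proof (cases "r = 0")
    case True
    then show ?thesis using that s0 by auto
  next
    case False
    have "x = (1 / r) *s (r *s x)" using False by (simp add: vector_smult_assoc)
    also have "r *s x = (- p) *s s" using that(2) by (simp add: vec_eq_iff eq_neg_iff_add_eq_0 add.commute)
    finally show ?thesis by (metis vector_smult_assoc)
  qed
  have "\<exists>k. a \<odot> b = k *s s"
  proof -
    obtain p q r where e: "a \<odot> b = p *s a + q *s s + r *s b" using basis_coords[OF b] .
    have "0 = a \<odot> (a \<odot> b)" using sb saab by simp
    also have "\<dots> = p *s s + r *s (a \<odot> b)" by (subst e) (simp add: mult_linear as flip: s_def)
    finally show ?thesis using inL[OF e] by simp
  qed
  then obtain k2 where ab: "a \<odot> b = k2 *s s" ..
  have "\<exists>k. b \<odot> a = k *s s"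
  proof -
    obtain p q r where e: "b \<odot> a = p *s a + q *s s + r *s b" using basis_coords[OF b] .
    have "0 = (b \<odot> a) \<odot> a" using bs by (simp add: assoc s_def)
    also have "\<dots> = p *s s + r *s (b \<odot> a)" by (subst e) (simp add: mult_linear sa flip: s_def)
    finally show ?thesis using inL[OF e] by simp
  qed
  then obtain k3 where ba: "b \<odot> a = k3 *s s" ..
  have "\<exists>k. b \<odot> b = k *s s"
  proof -
    obtain p q r where e: "b \<odot> b = p *s a + q *s s + r *s b" using basis_coords[OF b] .
    have "0 = (b \<odot> b) \<odot> a" by (simp add: assoc ba mult_linear bs)
    also have "\<dots> = p *s s + (r * k3) *s s"
      by (subst e) (simp add: mult_linear sa ba flip: s_def)
    finally have "(p + r * k3) *s s = 0" by (simp add: vec_eq_iff algebra_simps)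
    then have p: "p + r * k3 = 0" using s0 by (metis vector_mul_eq_0)
    have "0 = (b \<odot> b) \<odot> b" using nil by (simp add: assoc)
    also have "\<dots> = (p * k2) *s s + r *s (b \<odot> b)" by (subst e) (simp add: mult_linear sb ab)
    finally have bb: "(p * k2) *s s + r *s (b \<odot> b) = 0" by simp
    show ?thesis
    proof (cases "r = 0")
      case True
      then show ?thesis using e p by auto
    next
      case False
      have "b \<odot> b = (1 / r) *s (r *s (b \<odot> b))" using False by (simp add: vector_smult_assoc)
      also have "r *s (b \<odot> b) = (- (p * k2)) *s s"
        using bb by (simp add: vec_eq_iff eq_neg_iff_add_eq_0 add.commute)
      finally show ?thesis by (metis vector_smult_assoc)
    qed
  qed
  then obtain k4 where bb: "b \<odot> b = k4 *s s" ..
  have "det3 a b s \<noteq> 0" using b det3_swap(2)[of a s b] by simp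
  then show ?thesis
    by (rule line_valuedI[of a b s 1 k2 k3 k4]) (simp_all add: as sa ss sb bs ab ba bb flip: s_def)
qed

text \<open>Without a generator, the cube of \<open>a\<close> is a combination of \<open>a\<close>
  and its square, so an idempotent can be written down as a polynomial in \<open>a\<close>.\<close>

lemma exists_idempotent:
  assumes "\<not> monogenic c" "a \<odot> (a \<odot> a) \<noteq> 0"
  shows "\<exists>e. e \<noteq> 0 \<and> e \<odot> e = e"
proof -
  define s where "s = a \<odot> a"
  have s0: "s \<noteq> 0" using assms(2) by (auto simp: s_def mult_linear)
  have a0: "a \<noteq> 0" using assms(2) by (auto simp: mult_linear)
  have d: "det3 a s (a \<odot> s) = 0" using assms(1) unfolding monogenic_def s_def by blast
  show ?thesis
  proof (cases "\<exists>k. s = k *s a")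
    case True
    then obtain k where k: "a \<odot> a = k *s a" unfolding s_def by blast
    then have "k \<noteq> 0" using s0 s_def by auto
    then have "((1 / k) *s a) \<odot> ((1 / k) *s a) = (1 / k) *s a"
      by (simp add: mult_linear k vector_smult_assoc)
    moreover have "(1 / k) *s a \<noteq> 0" using \<open>k \<noteq> 0\<close> a0 by simp
    ultimately show ?thesis by blast
  next
    case False
    then obtain n where n: "det3 a s n \<noteq> 0" using exists_basis2[OF a0] by blast
    obtain p q r where e: "a \<odot> s = p *s a + q *s s + r *s n" using basis_coords[OF n] .
    have "r = 0" using d n unfolding e by (simp add: det3_linear)
    with e have as: "a \<odot> s = p *s a + q *s s" by simp
    have sa: "s \<odot> a = a \<odot> s" by (simp add: s_def assoc)
    show ?thesis
    proof (cases "p = 0")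
      case True
      then have q: "q \<noteq> 0" using as assms(2) by (auto simp: s_def)
      have as': "a \<odot> s = q *s s" using as True by simp
      have "s \<odot> s = a \<odot> (a \<odot> s)" by (metis assoc s_def)
      then have "s \<odot> s = (q * q) *s s" by (simp add: as' mult_linear)
      then have "((1 / (q * q)) *s s) \<odot> ((1 / (q * q)) *s s) = (1 / (q * q)) *s s"
        using q by (simp add: mult_linear vector_smult_assoc)
      moreover have "(1 / (q * q)) *s s \<noteq> 0" using q s0 by simp
      ultimately show ?thesis by blast
    next
      case p: False
      \<comment> \<open>The relation \<open>a^3 = p a + q a^2\<close> says that this element fixes
        \<open>a\<close>; it is the unit of the subalgebra generated by \<open>a\<close>.\<close>
      define e where "e = (1 / p) *s (s - q *s a)"
      have ea: "e \<odot> a = a"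
        using p unfolding e_def by (simp add: mult_linear sa as vector_smult_assoc flip: s_def)
      then have es: "e \<odot> s = s" unfolding s_def by (simp flip: assoc)
      have "e \<odot> e = (1 / p) *s (e \<odot> s - q *s (e \<odot> a))"
        by (subst (2) e_def) (simp add: mult_linear)
      then have "e \<odot> e = e" by (simp only: ea es flip: e_def)
      moreover have "e \<noteq> 0" using ea a0 by (auto simp: mult_linear)
      ultimately show ?thesis by blast
    qed
  qed
qed

text \<open>The perm identity gives \<open>e (y e) = e y\<close>, which rules out left eigenvalue 1
  with right eigenvalue 0. Of the Peirce spaces (1,1), (0,1), (0,0) the middle one contains
  \<open>m\<close>; a third basis vector from each of them in turn leads to \<open>E2\<close>,
  \<open>A18\<close> and \<open>E1\<close>.\<close>

lemma noncentral_idempotent: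
  assumes e: "e \<odot> e = e" and x: "e \<odot> x \<noteq> x \<odot> e"
  shows "c \<in> orbit A18 \<or> (\<exists>\<gamma>. c \<in> orbit (E1 \<gamma>)) \<or> (\<exists>\<beta>. c \<in> orbit (E2 \<beta>))"
proof -
  have eex: "e \<odot> (e \<odot> y) = e \<odot> y" "e \<odot> (y \<odot> e) = e \<odot> y" "(e \<odot> y) \<odot> e = e \<odot> y"
    "(y \<odot> e) \<odot> e = y \<odot> e" for y
    using assoc[of e e y] perm[of e y e] assoc[of e y e] assoc[of y e e] e by simp_all
  define m where "m = x \<odot> e - e \<odot> x"
  have m0: "m \<noteq> 0" using x by (simp add: m_def)
  have em: "e \<odot> m = 0" and me: "m \<odot> e = m" by (simp_all add: m_def mult_linear eex)
  have e0: "e \<noteq> 0" using x by (auto simp: mult_linear)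
  have "m \<noteq> k *s e" for k
  proof
    assume "m = k *s e"
    with em e have "k *s e = 0" by (simp add: mult_linear)
    with \<open>m = k *s e\<close> m0 show False by simp
  qed
  then obtain n where n: "det3 e m n \<noteq> 0" using exists_basis2[OF e0] by blast
  have mm: "m \<odot> m = 0" using assoc[of m e m] by (simp add: em me mult_linear)
  \<comment> \<open>Here \<open>y m = y (m e) = y (e m) = 0\<close>.\<close>
  have nm: "y \<odot> m = 0" for y using assoc[of y m e] perm[of y m e] by (simp add: em me mult_linear)
  have "det3 e m n = det3 e m (e \<odot> n) + det3 e m (n \<odot> e - e \<odot> n) + det3 e m (n - n \<odot> e)"
    by (simp add: det3_linear)
  then consider (1) "det3 e m (e \<odot> n) \<noteq> 0" | (2) "det3 e m (n \<odot> e - e \<odot> n) \<noteq> 0"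
    | (3) "det3 e m (n - n \<odot> e) \<noteq> 0" using n by force
  then show ?thesis
  proof cases
    case 1
    define u where "u = e \<odot> n"
    have eu: "e \<odot> u = u" and ue: "u \<odot> e = u" by (simp_all add: u_def eex)
    have d: "det3 e m u \<noteq> 0" using 1 by (simp add: u_def)
    obtain p q r where mu: "m \<odot> u = p *s e + q *s m + r *s u" using basis_coords[OF d] .
    have "e \<odot> (m \<odot> u) = 0" by (simp add: em mult_linear flip: assoc)
    then have "p *s e + 0 *s m + r *s u = 0" unfolding mu by (simp add: mult_linear e em eu)
    then have pr: "p = 0" "r = 0" using basis_coords_zero[OF d] by blast+
    \<comment> \<open>Since \<open>m u = q m\<close> and \<open>m e = m\<close>, this shift makes
      the product of \<open>m\<close> and \<open>v\<close> vanish.\<close>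
    define v where "v = u - q *s e"
    have ev: "e \<odot> v = v" and ve: "v \<odot> e = v" by (simp_all add: v_def mult_linear eu ue e)
    have mv: "m \<odot> v = 0" by (simp add: v_def mult_linear mu pr me)
    have d': "det3 e v m \<noteq> 0"
      using d det3_swap(2)[of e m u] by (simp add: v_def det3_linear)
    obtain \<alpha> \<beta> \<delta> where vv: "v \<odot> v = \<alpha> *s e + \<beta> *s v + \<delta> *s m" using basis_coords[OF d'] .
    have "e \<odot> (v \<odot> v) = v \<odot> v" by (simp add: ev flip: assoc)
    then have "\<alpha> *s e + \<beta> *s v + \<delta> *s m = \<alpha> *s e + \<beta> *s v + 0 *s m"
      unfolding vv by (simp add: mult_linear e ev em)
    then have \<delta>: "\<delta> = 0" using basis_coords_eq[OF d'] by blast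
    have "m \<odot> (v \<odot> v) = 0" by (simp add: mv mult_linear flip: assoc)
    then have "\<alpha> *s m = 0" unfolding vv \<delta> by (simp add: mult_linear me mv)
    then have \<alpha>: "\<alpha> = 0" using m0 by simp
    have "c \<in> orbit (E2 \<beta>)"
      by (rule orbit_basisI[OF d'])
        (use vv \<alpha> \<delta> in \<open>simp add: forall_3 E2_def idx3 e ev ve em me mv mm nm\<close>)
    then show ?thesis by blast
  next
    case 2
    define u where "u = n \<odot> e - e \<odot> n"
    have eu: "e \<odot> u = 0" and ue: "u \<odot> e = u" by (simp_all add: u_def mult_linear eex)
    have yu: "y \<odot> u = 0" for y using assoc[of y u e] perm[of y u e] by (simp add: eu ue mult_linear)
    have d: "det3 e m u \<noteq> 0" using 2 by (simp add: u_def)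
    have "c \<in> orbit A18"
      by (rule orbit_basisI[OF d]) (simp add: forall_3 A18_def idx3 e eu ue em me nm yu)
    then show ?thesis by blast
  next
    case 3
    define u where "u = n - n \<odot> e"
    have eu: "e \<odot> u = 0" and ue: "u \<odot> e = 0" by (simp_all add: u_def mult_linear eex)
    have d: "det3 e m u \<noteq> 0" using 3 by (simp add: u_def)
    have mu: "m \<odot> u = 0" using assoc[of m e u] by (simp add: eu me mult_linear)
    obtain p q r where uu: "u \<odot> u = p *s e + q *s m + r *s u" using basis_coords[OF d] .
    have "(u \<odot> u) \<odot> e = 0" by (simp add: ue mult_linear assoc)
    then have "p *s e + q *s m + 0 *s u = 0" unfolding uu by (simp add: mult_linear e me ue)
    then have pq: "p = 0" "q = 0" using basis_coords_zero[OF d] by blast+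
    have "c \<in> orbit (E1 r)"
      by (rule orbit_basisI[OF d]) (use uu pq in \<open>simp add: forall_3 E1_def idx3 e eu ue em me nm mu\<close>)
    then show ?thesis by blast
  qed
qed

section \<open>Algebras with only central idempotents\<close>

lemma not_monogenicI:
  assumes "\<not> monogenic c" shows "det3 a (a \<odot> a) (a \<odot> (a \<odot> a)) = 0"
  using assms unfolding monogenic_def by blast

lemma comb_eq_0:
  assumes "det3 e u v \<noteq> 0"
    "det3 (p1 *s e + q1 *s u + r1 *s v) (p2 *s e + q2 *s u + r2 *s v) (p3 *s e + q3 *s u + r3 *s v) = 0"
  shows "p1 * (q2 * r3 - q3 * r2) - q1 * (p2 * r3 - p3 * r2) + r1 * (p2 * q3 - p3 * q2) = 0"
  using assms unfolding det3_comb by simp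

text \<open>If \<open>e, x, x\<^sup>2\<close> were a basis, then \<open>t e + x\<close> would generate the algebra for generic \<open>t\<close>.\<close>

lemma square_dependent:
  assumes nm: "\<not> monogenic c" and e: "e \<odot> e = e"
    and x: "(e \<odot> x = x \<and> x \<odot> e = x) \<or> (e \<odot> x = 0 \<and> x \<odot> e = 0)"
  shows "det3 e x (x \<odot> x) = 0"
proof (rule ccontr)
  assume d: "det3 e x (x \<odot> x) \<noteq> 0"
  let ?s = "x \<odot> x"
  obtain p q r where xs: "x \<odot> ?s = p *s e + q *s x + r *s ?s" using basis_coords[OF d] .
  show False using x
  proof
    assume "e \<odot> x = x \<and> x \<odot> e = x"
    then have ex: "e \<odot> x = x" and xe: "x \<odot> e = x" by auto
    have es: "e \<odot> ?s = ?s" by (simp add: ex flip: assoc)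
    have "t * t * t + r * (t * t) - q * t + p = 0" for t
    proof -
      let ?a = "t *s e + 1 *s x + 0 *s ?s"
      have aa: "?a \<odot> ?a = (t * t) *s e + (2 * t) *s x + 1 *s ?s"
        by (simp add: mult_linear e ex xe) (simp add: vec_eq_iff algebra_simps)
      have aaa: "?a \<odot> (?a \<odot> ?a) = (t * t * t + p) *s e + (3 * (t * t) + q) *s x + (3 * t + r) *s ?s"
        unfolding aa by (simp add: mult_linear e ex xe es xs) (simp add: vec_eq_iff algebra_simps)
      show ?thesis
        using comb_eq_0[OF d not_monogenicI[OF nm, of ?a, unfolded aaa, unfolded aa]]
        by (simp add: algebra_simps)
    qed
    moreover have "[:p, - q, r, 1:] \<noteq> 0" by simp
    ultimately show False using nonroot[of "[:p, - q, r, 1:]"] by (auto simp: algebra_simps)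
  next
    assume "e \<odot> x = 0 \<and> x \<odot> e = 0"
    then have ex: "e \<odot> x = 0" and xe: "x \<odot> e = 0" by auto
    have es: "e \<odot> ?s = 0" and se: "?s \<odot> e = 0"
      using assoc[of e x x] assoc[of x x e] by (simp_all add: ex xe mult_linear)
    have "e \<odot> (x \<odot> ?s) = 0" using assoc[of e x ?s] by (simp add: ex mult_linear)
    then have "p *s e + 0 *s x + 0 *s ?s = 0" unfolding xs by (simp add: mult_linear e ex es)
    then have p: "p = 0" using basis_coords_zero[OF d] by blast
    have "t * t * t - q * t - r * (t * t) = 0" for t
    proof -
      let ?a = "t *s e + 1 *s x + 0 *s ?s"
      have aa: "?a \<odot> ?a = (t * t) *s e + 0 *s x + 1 *s ?s"
        by (simp add: mult_linear e ex xe)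
      have aaa: "?a \<odot> (?a \<odot> ?a) = (t * t * t) *s e + q *s x + r *s ?s"
        unfolding aa by (simp add: mult_linear e ex xe es xs p)
      show ?thesis
        using comb_eq_0[OF d not_monogenicI[OF nm, of ?a, unfolded aaa, unfolded aa]]
        by (simp add: algebra_simps)
    qed
    moreover have "[:0, - q, - r, 1:] \<noteq> 0" by simp
    ultimately show False using nonroot[of "[:0, - q, - r, 1:]"] by (auto simp: algebra_simps)
  qed
qed

text \<open>For \<open>x = t f + n\<close>, \<open>square_dependent\<close> makes
  \<open>e, x, x^2\<close> dependent for every \<open>t\<close>, but in the basis
  \<open>e, f, n\<close> their determinant is a monic quadratic polynomial in
  \<open>t\<close>.\<close>

lemma idempotent_pair_contradiction:
  assumes nm: "\<not> monogenic c" and e: "e \<odot> e = e" and f: "f \<odot> f = f"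
    and ef: "e \<odot> f = 0" "f \<odot> e = 0" and n: "f \<odot> n = n" "n \<odot> f = n" "e \<odot> n = 0" "n \<odot> e = 0"
  shows "det3 e f n = 0"
proof (rule ccontr)
  assume d: "det3 e f n \<noteq> 0"
  obtain p q r where nn: "n \<odot> n = p *s e + q *s f + r *s n" using basis_coords[OF d] .
  have "e \<odot> (n \<odot> n) = 0" using assoc[of e n n] by (simp add: n mult_linear)
  then have "p *s e + 0 *s f + 0 *s n = 0" unfolding nn by (simp add: mult_linear e ef n)
  then have p: "p = 0" using basis_coords_zero[OF d] by blast
  have "t * t + r * t + (- q) = 0" for t
  proof -
    let ?x = "0 *s e + t *s f + 1 *s n"
    have xx: "?x \<odot> ?x = 0 *s e + (t * t + q) *s f + (2 * t + r) *s n"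
      by (simp add: mult_linear f n nn p) (simp add: vec_eq_iff algebra_simps)
    have "det3 (1 *s e + 0 *s f + 0 *s n) ?x (?x \<odot> ?x) = 0"
      using square_dependent[OF nm e, of ?x] by (simp add: mult_linear ef n)
    from comb_eq_0[OF d this[unfolded xx]] show ?thesis by (simp add: algebra_simps)
  qed
  then show False using quadratic_nonroot[of r "- q"] by blast
qed

text \<open>A nonzero square in the annihilator of \<open>e\<close> would yield an idempotent
  \<open>f\<close> orthogonal to \<open>e\<close>. The last basis vector would split into a part
  fixed by \<open>f\<close> and a part \<open>g\<close> killed by it; the first is excluded by
  \<open>idempotent_pair_contradiction\<close>, the second because \<open>t f + g\<close> has an
  independent square for suitable \<open>t\<close>.\<close>

lemma rank1_case:
  assumes nm: "\<not> monogenic c" and central: "\<And>f x. f \<odot> f = f \<Longrightarrow> f \<odot> x = x \<odot> f"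
    and e: "e \<odot> e = e" and d: "det3 e u v \<noteq> 0"
    and eu: "e \<odot> u = 0" and ev: "e \<odot> v = 0"
  shows "c \<in> orbit D2"
proof -
  have ue: "u \<odot> e = 0" and ve: "v \<odot> e = 0" using central[OF e] eu ev by metis+
  have e0: "e \<noteq> 0" using d by (auto simp: det3_linear)
  have sq: "b \<odot> b = 0" if b: "e \<odot> b = 0" for b
  proof (rule ccontr)
    assume bb: "b \<odot> b \<noteq> 0"
    have be: "b \<odot> e = 0" using central[OF e] b by metis
    have b0: "b \<noteq> 0" using bb by (auto simp: mult_linear)
    have "\<exists>k. b \<odot> b = k *s b"
    proof -
      have "b \<noteq> k *s e" for k using b e b0 e0 by (auto simp: mult_linear)
      then obtain n where n: "det3 e b n \<noteq> 0" using exists_basis2[OF e0] by blast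
      obtain p q r where s: "b \<odot> b = p *s e + q *s b + r *s n" using basis_coords[OF n] .
      have "det3 e b (b \<odot> b) = 0" using square_dependent[OF nm e] b be by blast
      then have r: "r = 0" using n unfolding s by (simp add: det3_linear)
      have "e \<odot> (b \<odot> b) = 0" using assoc[of e b b] by (simp add: b mult_linear)
      then have "p = 0" unfolding s r using e0 by (simp add: mult_linear e b)
      with s r show ?thesis by auto
    qed
    then obtain k where k: "b \<odot> b = k *s b" ..
    have k0: "k \<noteq> 0" using k bb by auto
    define f where "f = (1 / k) *s b"
    have f: "f \<odot> f = f" using k0 by (simp add: f_def mult_linear k vector_smult_assoc)
    have f0: "f \<noteq> 0" using b0 k0 by (simp add: f_def)
    have ef: "e \<odot> f = 0" "f \<odot> e = 0" by (simp_all add: f_def mult_linear b be)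
    obtain p q r where fc: "f = p *s e + q *s u + r *s v" using basis_coords[OF d] .
    have "e \<odot> f = p *s e" unfolding fc by (simp add: mult_linear e eu ev)
    then have p: "p = 0" using ef e0 by simp
    have "\<exists>n. det3 e f n \<noteq> 0 \<and> e \<odot> n = 0"
    proof (cases "q = 0")
      case True
      then have "r \<noteq> 0" using fc p f0 by auto
      then have "det3 e f u \<noteq> 0" using d det3_swap(2)[of e u v] unfolding fc p True by (simp add: det3_linear)
      then show ?thesis using eu by blast
    next
      case False
      then have "det3 e f v \<noteq> 0" using d unfolding fc p by (simp add: det3_linear)
      then show ?thesis using ev by blast
    qed
    then obtain n where n: "det3 e f n \<noteq> 0" and en: "e \<odot> n = 0" by blast
    have ne: "n \<odot> e = 0" using central[OF e] en by metis
    have ffn: "f \<odot> (f \<odot> n) = f \<odot> n" using assoc[of f f n] f by simp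
    have efn: "e \<odot> (f \<odot> n) = 0" using assoc[of e f n] ef by (simp add: mult_linear)
    have "det3 e f (f \<odot> n) = 0"
      by (rule idempotent_pair_contradiction[OF nm e f ef])
        (use ffn efn central[OF e] central[OF f] in \<open>metis+\<close>)
    then have d2: "det3 e f (n - f \<odot> n) \<noteq> 0" using n by (simp add: det3_linear)
    define g where "g = n - f \<odot> n"
    have fg: "f \<odot> g = 0" and eg: "e \<odot> g = 0" by (simp_all add: g_def mult_linear ffn efn en)
    have gf: "g \<odot> f = 0" and ge: "g \<odot> e = 0" using central[OF e] central[OF f] fg eg by metis+
    have d3: "det3 e f g \<noteq> 0" using d2 by (simp add: g_def)
    obtain p q r where gg: "g \<odot> g = p *s e + q *s f + r *s g" using basis_coords[OF d3] .
    have "e \<odot> (g \<odot> g) = 0" "f \<odot> (g \<odot> g) = 0" using assoc[of e g g] assoc[of f g g]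
      by (simp_all add: eg fg mult_linear)
    then have pq: "p = 0" "q = 0" unfolding gg using e0 f0 by (simp_all add: mult_linear e f ef eg fg)
    have "t * t + (- r) * t + 0 = 0" for t
    proof -
      let ?x = "0 *s e + t *s f + 1 *s g"
      have xx: "?x \<odot> ?x = 0 *s e + (t * t) *s f + r *s g"
        by (simp add: mult_linear f fg gf gg pq)
      have "det3 (1 *s e + 0 *s f + 0 *s g) ?x (?x \<odot> ?x) = 0"
        using square_dependent[OF nm e, of ?x] by (simp add: mult_linear ef eg ge)
      from comb_eq_0[OF d3 this[unfolded xx]] show ?thesis by (auto simp: algebra_simps)
    qed
    then show False using quadratic_nonroot[of "- r" 0] by blast
  qed
  have prod0: "x \<odot> y = 0" if xy: "det3 e x y \<noteq> 0" "e \<odot> x = 0" "e \<odot> y = 0" for x y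
  proof (rule ccontr)
    assume w: "x \<odot> y \<noteq> 0"
    obtain p q r where pqr: "x \<odot> y = p *s e + q *s x + r *s y" using basis_coords[OF xy(1)] .
    have "e \<odot> (x \<odot> y) = 0" using assoc[of e x y] by (simp add: xy mult_linear)
    then have p: "p = 0" unfolding pqr using e0 by (simp add: mult_linear e xy)
    have "x \<odot> (x \<odot> y) = 0" using assoc[of x x y] sq[OF xy(2)] by (simp add: mult_linear)
    then have "r *s (x \<odot> y) = 0" by (subst (asm) pqr) (simp add: p mult_linear sq[OF xy(2)])
    then have r: "r = 0" using w by simp
    have "(x \<odot> y) \<odot> y = 0" using assoc[of x y y] sq[OF xy(3)] by (simp add: mult_linear)
    then have "q *s (x \<odot> y) = 0" by (subst (asm) pqr) (simp add: p r mult_linear)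
    then have "q = 0" using w by simp
    with p r pqr w show False by simp
  qed
  have "det3 e v u \<noteq> 0" using d det3_swap(2)[of e v u] by simp
  then have uv: "u \<odot> v = 0" "v \<odot> u = 0" using prod0 d eu ev by blast+
  show ?thesis
    by (rule orbit_basisI[OF d])
      (simp add: forall_3 D2_def idx3 e eu ev ue ve uv sq[OF eu] sq[OF ev])
qed

lemma rank2_case:
  assumes nm: "\<not> monogenic c" and central: "\<And>f x. f \<odot> f = f \<Longrightarrow> f \<odot> x = x \<odot> f"
    and e: "e \<odot> e = e" and eu: "e \<odot> u = u" and ev: "e \<odot> v = 0"
  shows "det3 e u v = 0"
proof (rule ccontr)
  assume d: "det3 e u v \<noteq> 0"
  have ue: "u \<odot> e = u" and ve: "v \<odot> e = 0" using central[OF e] eu ev by metis+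
  have uv: "u \<odot> v = 0" using assoc[of u e v] by (simp add: ue ev mult_linear)
  have vu: "v \<odot> u = 0" using assoc[of v e u] by (simp add: ve eu mult_linear)
  obtain p q r where uu: "u \<odot> u = p *s e + q *s u + r *s v" using basis_coords[OF d] .
  have "e \<odot> (u \<odot> u) = u \<odot> u" using assoc[of e u u] by (simp add: eu)
  then have "p *s e + q *s u + r *s v = p *s e + q *s u + 0 *s v"
    unfolding uu by (simp add: mult_linear e eu ev)
  then have r: "r = 0" using basis_coords_eq[OF d] by blast
  obtain p' q' s where vv: "v \<odot> v = p' *s e + q' *s u + s *s v" using basis_coords[OF d] .
  have "e \<odot> (v \<odot> v) = 0" using assoc[of e v v] by (simp add: ev mult_linear)
  then have "p' *s e + q' *s u + 0 *s v = 0" unfolding vv by (simp add: mult_linear e eu ev)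
  then have pq: "p' = 0" "q' = 0" using basis_coords_zero[OF d] by blast+
  \<comment> \<open>If \<open>u\<close> has eigenvalues \<open>l, m\<close> on the span of
    \<open>e, u\<close>, the factors are \<open>(t + l) (t + m)\<close> and
    \<open>(t + l - s) (t + m - s)\<close>: the element \<open>?a\<close> generates when its
    eigenvalues there avoid both 0 and \<open>s\<close>.\<close>
  let ?P = "[:- p, q, 1:] * [:s * s - s * q - p, q - 2 * s, 1:]"
  have "poly ?P t = 0" for t
  proof -
    let ?a = "t *s e + 1 *s u + 1 *s v"
    define A B where "A = t * t + p" and "B = 2 * t + q"
    have aa: "?a \<odot> ?a = A *s e + B *s u + s *s v"
      by (simp add: mult_linear e eu ev ue ve uv vu uu vv r pq A_def B_def) (simp add: vec_eq_iff algebra_simps)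
    have aaa: "?a \<odot> (?a \<odot> ?a) = (t * A + B * p) *s e + (t * B + A + B * q) *s u + (s * s) *s v"
      unfolding aa by (simp add: mult_linear e eu ev ue ve uv vu uu vv r pq) (simp add: vec_eq_iff algebra_simps)
    show ?thesis
      using comb_eq_0[OF d not_monogenicI[OF nm, of ?a, unfolded aaa, unfolded aa]]
      unfolding A_def B_def by (simp add: algebra_simps)
  qed
  then have "?P = 0" using poly_all_0_iff_0 by blast
  then show False by simp
qed

lemma rank3_case:
  assumes nm: "\<not> monogenic c" and e: "e \<odot> e = e" and unit: "\<And>x. e \<odot> x = x" "\<And>x. x \<odot> e = x"
    and central: "\<And>f x. f \<odot> f = f \<Longrightarrow> f \<odot> x = x \<odot> f" and d: "det3 e u v \<noteq> 0"
  shows "c \<in> orbit D1"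
proof -
  have e0: "e \<noteq> 0" using d by (auto simp: det3_linear)
  have shift: "\<exists>k. (x - k *s e) \<odot> (x - k *s e) = 0" if xy: "det3 e x y \<noteq> 0" for x y
  proof -
    obtain p q r where s: "x \<odot> x = p *s e + q *s x + r *s y" using basis_coords[OF xy] .
    have "det3 e x (x \<odot> x) = 0" using square_dependent[OF nm e] unit by blast
    then have r: "r = 0" using xy unfolding s by (simp add: det3_linear)
    \<comment> \<open>A root of \<open>k^2 = q k + p\<close>: subtracting this multiple of the unit
      makes the square of \<open>x\<close> proportional to the shifted vector itself.\<close>
    define k where "k = (q + csqrt (q^2 + 4 * p)) / 2"
    have k: "k * k - q * k - p = 0"
    proof -
      have "csqrt (q^2 + 4 * p) = 2 * k - q" by (simp add: k_def add_divide_distrib)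
      then have "(2 * k - q)^2 = q^2 + 4 * p" by (metis power2_csqrt)
      then have "4 * (k * k - q * k - p) = 0" by (simp add: power2_eq_square algebra_simps)
      then show ?thesis by (simp only: mult_eq_0_iff) simp
    qed
    define x' where "x' = x - k *s e"
    define b where "b = q - 2 * k"
    have x'x': "x' \<odot> x' = b *s x'"
    proof -
      have "x' \<odot> x' = (p + k * k) *s e + b *s x"
        unfolding x'_def by (simp add: mult_linear unit s r b_def) (simp add: vec_eq_iff algebra_simps)
      also have "p + k * k = - b * k" using k unfolding b_def by algebra
      finally show ?thesis by (simp add: x'_def vec_eq_iff algebra_simps)
    qed
    have d': "det3 e x' y \<noteq> 0" using xy by (simp add: x'_def det3_linear)
    \<comment> \<open>Otherwise \<open>x'\<close> rescales to an idempotent \<open>f\<close>. The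
      vector \<open>y\<close> splits into parts belonging to \<open>f\<close> and to
      \<open>e - f\<close>, and \<open>idempotent_pair_contradiction\<close>, applied in both
      orders, excludes both parts.\<close>
    have "b = 0"
    proof (rule ccontr)
      assume b: "b \<noteq> 0"
      define f where "f = (1 / b) *s x'"
      have f: "f \<odot> f = f" using b by (simp add: f_def mult_linear x'x' vector_smult_assoc)
      have d'': "det3 e f y \<noteq> 0" using d' b by (simp add: f_def det3_linear)
      have g: "(e - f) \<odot> (e - f) = e - f" by (simp add: mult_linear unit f)
      have ffy: "f \<odot> (f \<odot> y) = f \<odot> y" using assoc[of f f y] f by simp
      have "(f \<odot> y) \<odot> f = f \<odot> y" using central[OF f, of "f \<odot> y"] ffy by simp
      then have "det3 (e - f) f (f \<odot> y) = 0"
        by (intro idempotent_pair_contradiction[OF nm g f]) (simp_all add: mult_linear unit f ffy)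
      moreover have "(y - f \<odot> y) \<odot> f = 0" using central[OF f, of "y - f \<odot> y"] ffy by (simp add: mult_linear)
      then have "det3 f (e - f) (y - f \<odot> y) = 0"
        by (intro idempotent_pair_contradiction[OF nm f g]) (simp_all add: mult_linear unit f ffy)
      then have "det3 (e - f) f (y - f \<odot> y) = 0" using det3_swap(1)[of f "e - f"] by simp
      ultimately have "det3 (e - f) f y = 0" by (simp add: det3_linear)
      then show False using d'' by (simp add: det3_linear)
    qed
    then show ?thesis using x'x' unfolding x'_def by auto
  qed
  have prod0: "x \<odot> y = 0" if xy: "det3 e x y \<noteq> 0" "x \<odot> x = 0" "y \<odot> y = 0" for x y
  proof (rule ccontr)
    assume w: "x \<odot> y \<noteq> 0"
    obtain p q r where pqr: "x \<odot> y = p *s e + q *s x + r *s y" using basis_coords[OF xy(1)] .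
    have x0: "x \<noteq> 0" using xy(1) by (auto simp: det3_linear)
    have "x \<odot> (x \<odot> y) = 0" using assoc[of x x y] xy(2) by (simp add: mult_linear)
    then have 1: "p *s x + r *s (x \<odot> y) = 0"
      by (subst (asm) pqr) (simp add: mult_linear xy(2) unit)
    have wy: "(x \<odot> y) \<odot> y = 0" using assoc[of x y y] xy(3) by (simp add: mult_linear)
    have "(p *s x + r *s (x \<odot> y)) \<odot> y = 0" unfolding 1 by (simp add: mult_linear)
    then have p: "p = 0" using w by (simp add: mult_linear wy)
    then have r: "r = 0" using 1 w by simp
    have "q *s (x \<odot> y) = 0" using wy by (subst (asm) pqr) (simp add: p r mult_linear)
    then have "q = 0" using w by simp
    with p r pqr w show False by simp
  qed
  obtain k where k: "(u - k *s e) \<odot> (u - k *s e) = 0" using shift[OF d] by blast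
  have "det3 e v u \<noteq> 0" using d det3_swap(2)[of e v u] by simp
  then obtain l where l: "(v - l *s e) \<odot> (v - l *s e) = 0" using shift by blast
  define x y where "x = u - k *s e" and "y = v - l *s e"
  have xy: "det3 e x y \<noteq> 0" using d by (simp add: x_def y_def det3_linear)
  then have yx: "det3 e y x \<noteq> 0" using det3_swap(2)[of e y x] by simp
  have sq: "x \<odot> x = 0" "y \<odot> y = 0" using k l by (simp_all add: x_def y_def)
  show ?thesis
    by (rule orbit_basisI[OF xy])
      (simp add: forall_3 D1_def idx3 unit sq prod0[OF xy sq] prod0[OF yx sq(2) sq(1)])
qed

text \<open>Multiplication by a central \<open>e\<close> has only the eigenvalues 1 and 0. Expanding
  the determinant of a basis over the two eigenspaces, \<open>rank2_case\<close> removes the mixed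
  terms, so \<open>e\<close> is a unit or kills a complement.\<close>

lemma central_idempotents:
  assumes nm: "\<not> monogenic c" and e: "e \<odot> e = e" "e \<noteq> 0"
    and central: "\<And>f x. f \<odot> f = f \<Longrightarrow> f \<odot> x = x \<odot> f"
  shows "c \<in> orbit D1 \<or> c \<in> orbit D2"
proof -
  obtain u v where d: "det3 e u v \<noteq> 0" using exists_basis1[OF e(2)] by blast
  have ee: "e \<odot> (e \<odot> x) = e \<odot> x" for x using assoc[of e e x] e by simp
  have "det3 e (e \<odot> u) (v - e \<odot> v) = 0" "det3 e (e \<odot> v) (u - e \<odot> u) = 0"
    by (rule rank2_case[OF nm central e(1)]; simp add: mult_linear ee)+
  moreover have "det3 e u v = det3 e (e \<odot> u) (e \<odot> v) + det3 e (u - e \<odot> u) (v - e \<odot> v)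
      + det3 e (e \<odot> u) (v - e \<odot> v) - det3 e (e \<odot> v) (u - e \<odot> u)"
    using det3_swap(2)[of e "e \<odot> v" u] det3_swap(2)[of e "e \<odot> v" "e \<odot> u"]
    by (simp add: det3_linear)
  ultimately consider (1) "det3 e (e \<odot> u) (e \<odot> v) \<noteq> 0" | (2) "det3 e (u - e \<odot> u) (v - e \<odot> v) \<noteq> 0"
    using d by force
  then show ?thesis
  proof cases
    case 1
    have unit: "e \<odot> x = x" for x
    proof -
      obtain p q r where x: "x = p *s e + q *s (e \<odot> u) + r *s (e \<odot> v)" using basis_coords[OF 1] .
      show ?thesis unfolding x by (simp add: mult_linear e ee)
    qed
    then have "x \<odot> e = x" for x using central[OF e(1)] by metis
    then show ?thesis using rank3_case[OF nm e(1) unit _ central d] by blast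
  next
    case 2
    have "c \<in> orbit D2"
      by (rule rank1_case[OF nm central e(1) 2]) (simp_all add: mult_linear ee)
    then show ?thesis ..
  qed
qed

end

lemma perm_classification:
  assumes "perm_algebra c"
  shows "monogenic c \<or> line_valued c \<or> c \<in> orbit D1 \<or> c \<in> orbit D2 \<or> c \<in> orbit A18
    \<or> (\<exists>\<gamma>. c \<in> orbit (E1 \<gamma>)) \<or> (\<exists>\<beta>. c \<in> orbit (E2 \<beta>))"
proof -
  interpret perm_alg c by unfold_locales (rule assms)
  show ?thesis
  proof (cases "monogenic c \<or> (\<forall>a. a \<odot> (a \<odot> a) = 0)")
    case True
    then show ?thesis using nil_line_valued by blast
  next
    case False
    then obtain e where e: "e \<noteq> 0" "e \<odot> e = e" using exists_idempotent by blast
    show ?thesis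
    proof (cases "\<exists>f x. f \<odot> f = f \<and> f \<odot> x \<noteq> x \<odot> f")
      case True
      then show ?thesis using noncentral_idempotent by blast
    next
      case central: False
      show ?thesis using central_idempotents[OF _ e(2,1)] central False by blast
    qed
  qed
qed

section \<open>Algebras generated by one element\<close>

lemma pol_mv: "(\<And>i. pol entry (\<lambda>\<phi>. X \<phi> $ i)) \<Longrightarrow> pol entry (\<lambda>\<phi>. (\<phi> *v X \<phi>) $ k)"
  by (auto simp: matrix_vector_mult_def intro!: pol_sum pol_intros)

lemma pol_det3:
  "(\<And>i. pol entry (\<lambda>\<phi>. X \<phi> $ i)) \<Longrightarrow> (\<And>i. pol entry (\<lambda>\<phi>. Y \<phi> $ i)) \<Longrightarrow>
   (\<And>i. pol entry (\<lambda>\<phi>. Z \<phi> $ i)) \<Longrightarrow> pol entry (\<lambda>\<phi>. det3 (X \<phi>) (Y \<phi>) (Z \<phi>))"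
  unfolding det3_def by (intro pol.add pol_diff pol.mult)

lemma pol_tendsto:
  assumes "pol entry f" "\<And>i j. ((\<lambda>t. M t $ i $ j) \<longlongrightarrow> M0 $ i $ j) F"
  shows "((\<lambda>t. f (M t)) \<longlongrightarrow> f M0) F"
  using assms(1)
proof induction
  case (coord x)
  then show ?case using assms(2) by (cases x) (simp add: entry_def)
qed (auto intro: tendsto_intros)

lemma eventually_poly_nonzero:
  assumes "(P::complex poly) \<noteq> 0"
  shows "eventually (\<lambda>t. poly P t \<noteq> 0) (at 0)"
proof -
  have "finite ({t. poly P t = 0} - {0})" using poly_roots_finite[OF assms] by simp
  then have "open (- ({t. poly P t = 0} - {0}))" by (intro open_Compl finite_imp_closed)
  then show ?thesis unfolding eventually_at_topological by blast
qed

definition krylov_det :: "complex^3^3 \<Rightarrow> complex" where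
  "krylov_det M = det3 (axis 1 1) (M *v axis 1 1) (M *v (M *v axis 1 1))"

definition cyclic_form :: "complex^3^3 \<Rightarrow> complex^3 \<Rightarrow> complex^3 \<Rightarrow> complex^3" where
  "cyclic_form M x y = 
     det3 x (M *v axis 1 1) (M *v (M *v axis 1 1)) *s (M *v y)
   + det3 (axis 1 1) x (M *v (M *v axis 1 1)) *s (M *v (M *v y))
   + det3 (axis 1 1) (M *v axis 1 1) x *s (M *v (M *v (M *v y)))"

text \<open>By Cramer's rule, \<open>cyclic M\<close> is \<open>krylov_det M\<close> times the multiplication for which
  \<open>M\<close> is left multiplication by \<open>e\<^sub>1\<close> and \<open>M\<^sup>i e\<^sub>1\<close> is the \<open>(i + 1)\<close>-st power of \<open>e\<^sub>1\<close>.
  Clearing the denominator makes it polynomial in \<open>M\<close>.\<close>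

definition cyclic :: "complex^3^3 \<Rightarrow> multiplication" where
  "cyclic M = (\<chi> i j k. cyclic_form M (axis i 1) (axis j 1) $ k)"

lemma mult_cyclic: "mult (cyclic M) x y = cyclic_form M x y"
  unfolding cyclic_def
  by (rule mult_of_bilinear)
    (simp_all add: cyclic_form_def det3_linear matrix_vector_right_distrib vec.scale
      vec_eq_iff algebra_simps)

lemma mult_cyclic_1: "mult (cyclic M) (axis 1 1) y = krylov_det M *s (M *v y)"
  unfolding mult_cyclic cyclic_form_def krylov_det_def by (simp add: det3_linear)

lemma polymap_cyclic: "polymap cyclic"
  unfolding polymap_def cyclic_def cyclic_form_def
  by (auto intro!: pol_det3 pol_mv pol_intros)

lemma pol_krylov_det: "pol entry krylov_det"
  unfolding krylov_det_def by (intro pol_det3 pol_mv pol.const)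

text \<open>Left multiplication by \<open>a\<close> in the basis \<open>a, a^2, a^3\<close> when
  \<open>a^4 = p a + q a^2 + r a^3\<close>; its characteristic polynomial is
  \<open>X^3 - r X^2 - q X - p\<close>, which \<open>cubic_roots\<close> factors.\<close>

definition companion :: "complex \<Rightarrow> complex \<Rightarrow> complex \<Rightarrow> complex^3^3" where
  "companion p q r = cols (axis 2 1) (axis 3 1) (\<chi> i. if i = 1 then p else if i = 2 then q else r)"

lemma companion_axis:
  "companion p q r *v axis 1 1 = axis 2 1" "companion p q r *v axis 2 1 = axis 3 1"
  "companion p q r *v axis 3 1 = p *s axis 1 1 + q *s axis 2 1 + r *s axis 3 1"
  by (simp_all add: companion_def cols_vec vec_eq_iff forall_3 axis_def)

lemma det3_axis: "det3 (axis 1 1) (axis 2 1) (axis 3 1) = 1"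
  by (simp add: det3_def axis_def)

lemma krylov_det_companion: "krylov_det (companion p q r) = 1"
  by (simp add: krylov_det_def companion_axis det3_axis)

lemma companion_intertwine:
  assumes "M *v d = p *s a + q *s b + r *s d" "M *v a = b" "M *v b = d"
  shows "M *v (cols a b d *v x) = cols a b d *v (companion p q r *v x)"
proof -
  have "companion p q r *v x = (p * x$3) *s axis 1 1 + (x$1 + q * x$3) *s axis 2 1 + (x$2 + r * x$3) *s axis 3 1"
    by (simp add: vec_eq_iff forall_3 companion_def cols_vec axis_def mult.commute)
  then show ?thesis
    by (simp add: cols_vec matrix_vector_right_distrib vec.scale assms axis_def)
      (simp add: vec_eq_iff algebra_simps)
qed

text \<open>The form is built from \<open>e\<^sub>1\<close>, \<open>M\<close> and one determinant in
  each term. A change of basis fixing \<open>e\<^sub>1\<close> and conjugating \<open>M\<close>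
  therefore costs exactly one factor \<open>det g\<close>.\<close>

lemma cyclic_form_intertwine:
  assumes g: "\<And>x. M *v (g *v x) = g *v (M' *v x)" "g *v axis 1 1 = axis 1 1"
  shows "cyclic_form M (g *v x) (g *v y) = det g *s (g *v cyclic_form M' x y)"
proof -
  have "M *v axis 1 1 = g *v (M' *v axis 1 1)" using g(1)[of "axis 1 1"] g(2) by simp
  then show ?thesis
    unfolding cyclic_form_def
    by (subst (1 3) g(2)[symmetric])
      (simp add: g(1) det3_image matrix_vector_right_distrib vec.scale vector_add_ldistrib
        vector_smult_assoc)
qed

lemma cubic_roots:
  obtains x y z :: complex where "p = x * y * z" "q = - (x * y + x * z + y * z)" "r = x + y + z"
proof -
  have "\<not> constant (poly [:- p, - q, - r, 1:])"
    by (simp add: constant_degree)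
  then obtain x where "poly [:- p, - q, - r, 1:] x = 0" using fundamental_theorem_of_algebra by blast
  then have x: "p = x * x * x - q * x - r * (x * x)" by (simp add: algebra_simps)
  define s where "s = r - x"
  define m where "m = - q - x * s"
  define w where "w = csqrt (s^2 - 4 * m)"
  have w: "w * w = s * s - 4 * m" unfolding w_def by (metis power2_csqrt power2_eq_square)
  define y z where "y = (s + w) / 2" and "z = (s - w) / 2"
  have yz: "y + z = s" "y * z = m"
    using w by (simp_all add: y_def z_def field_simps)
  show ?thesis
  proof (rule that)
    show "q = - (x * y + x * z + y * z)" using yz unfolding m_def by (simp add: algebra_simps flip: yz(1))
    show "r = x + y + z" using yz(1) by (simp add: s_def algebra_simps)
    show "p = x * y * z" using x yz unfolding m_def s_def by algebra
  qed
qed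

definition root_companion :: "complex \<Rightarrow> complex \<Rightarrow> complex \<Rightarrow> complex^3^3" where
  "root_companion x y z = companion (x * y * z) (- (x * y + x * z + y * z)) (x + y + z)"

lemma (in perm_alg) cramer_product:
  "det3 a (a \<odot> a) (a \<odot> (a \<odot> a)) *s (x \<odot> y) =
     det3 x (a \<odot> a) (a \<odot> (a \<odot> a)) *s (a \<odot> y)
   + det3 a x (a \<odot> (a \<odot> a)) *s (a \<odot> (a \<odot> y))
   + det3 a (a \<odot> a) x *s (a \<odot> (a \<odot> (a \<odot> y)))"
proof -
  have "det3 a (a \<odot> a) (a \<odot> (a \<odot> a)) *s (x \<odot> y) = (det3 a (a \<odot> a) (a \<odot> (a \<odot> a)) *s x) \<odot> y"
    by (simp add: mult_linear)
  also have "\<dots> = (det3 x (a \<odot> a) (a \<odot> (a \<odot> a)) *s a + det3 a x (a \<odot> (a \<odot> a)) *s (a \<odot> a)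
      + det3 a (a \<odot> a) x *s (a \<odot> (a \<odot> a))) \<odot> y"
    by (subst cramer3) simp
  also have "\<dots> = det3 x (a \<odot> a) (a \<odot> (a \<odot> a)) *s (a \<odot> y)
   + det3 a x (a \<odot> (a \<odot> a)) *s (a \<odot> (a \<odot> y))
   + det3 a (a \<odot> a) x *s (a \<odot> (a \<odot> (a \<odot> y)))"
    by (simp add: mult_linear assoc)
  finally show ?thesis .
qed

text \<open>By \<open>cramer_product\<close> the whole product is determined by left multiplication
  by \<open>a\<close>. In the basis of powers this is a companion matrix, whose Krylov determinant
  is 1, so the postponed denominator disappears.\<close>

lemma (in perm_alg) generated_orbit:
  assumes k: "det3 a (a \<odot> a) (a \<odot> (a \<odot> a)) \<noteq> 0"
    and r: "a \<odot> (a \<odot> (a \<odot> a)) = p *s a + q *s (a \<odot> a) + r *s (a \<odot> (a \<odot> a))"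
  shows "c \<in> orbit (cyclic (companion p q r))"
proof -
  define s t where "s = a \<odot> a" and "t = a \<odot> s"
  define g where "g = cols a s t"
  let ?M = "companion p q r"
  have k': "det3 a s t \<noteq> 0" using k by (simp add: s_def t_def)
  have detg: "det g = det3 a s t" by (simp add: g_def det_cols)
  have g1: "g *v axis 1 1 = a" "g *v axis 2 1 = s" "g *v axis 3 1 = t"
    by (simp_all add: g_def cols_vec axis_def)
  have ag: "a \<odot> (g *v x) = g *v (?M *v x)" for x
  proof -
    have "?M *v x = (p * x$3) *s axis 1 1 + (x$1 + q * x$3) *s axis 2 1 + (x$2 + r * x$3) *s axis 3 1"
      by (simp add: vec_eq_iff forall_3 companion_def cols_vec axis_def mult.commute)
    moreover have "a \<odot> a = s" "a \<odot> s = t" "a \<odot> t = p *s a + q *s s + r *s t"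
      using r by (simp_all add: s_def t_def)
    ultimately show ?thesis
      by (simp add: g_def cols_vec mult_linear axis_def) (simp add: vec_eq_iff algebra_simps)
  qed
  have gs: "s = g *v (?M *v axis 1 1)" "t = g *v (?M *v (?M *v axis 1 1))"
    by (simp_all add: companion_axis g1)
  have "mult c (g *v x) (g *v y) = g *v mult (cyclic ?M) x y" for x y
  proof -
    have "det g *s ((g *v x) \<odot> (g *v y)) = det3 (g *v x) s t *s (a \<odot> (g *v y))
      + det3 a (g *v x) t *s (a \<odot> (a \<odot> (g *v y))) + det3 a s (g *v x) *s (a \<odot> (a \<odot> (a \<odot> (g *v y))))"
      unfolding detg s_def t_def by (rule cramer_product)
    also have "\<dots> = det g *s (g *v cyclic_form ?M x y)"
      unfolding ag gs cyclic_form_def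
      by (subst (1 2) g1(1)[symmetric]) 
        (simp only: det3_image matrix_vector_right_distrib vec.scale vector_add_ldistrib vector_smult_assoc)
    finally show ?thesis using k' unfolding detg mult_cyclic by simp
  qed
  moreover have "invertible g" using k' by (simp add: invertible_det_nz detg)
  ultimately show ?thesis unfolding orbit_iff by blast
qed

lemma mult_A07: "mult A07 x y = (\<chi> k. x $ k * y $ k)"
  by (simp add: vec_eq_iff forall_3 mult_def sum_3 A07_def)

lemma mult_A18: "mult A18 x y = y $ 1 *s x"
  by (simp add: vec_eq_iff forall_3 mult_def sum_3 A18_def mult.commute)

lemma mult_A24: "mult A24 x y = x $ 1 * y $ 1 *s axis 1 1 + x $ 2 * y $ 2 *s axis 2 1 + x $ 3 * y $ 1 *s axis 3 1"
  by (simp add: vec_eq_iff forall_3 mult_def sum_3 A24_def axis_def)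

lemma mult_A14: "mult (A14 \<alpha>) x y = ((1 + \<alpha>) * x $ 1 * y $ 2 + (1 - \<alpha>) * x $ 2 * y $ 1) *s axis 3 1"
  by (simp add: vec_eq_iff forall_3 mult_def sum_3 A14_def axis_def algebra_simps)

lemma perm_A07: "perm_algebra A07"
  by (simp add: perm_algebra_def mult_A07 vec_eq_iff mult_ac)

lemma perm_A18: "perm_algebra A18"
  by (simp add: perm_algebra_def mult_A18 vec_eq_iff mult_ac)

lemma perm_A24: "perm_algebra A24"
  by (simp add: perm_algebra_def mult_A24 vec_eq_iff forall_3 axis_def mult_ac)

lemma perm_A14: "perm_algebra (A14 \<alpha>)"
  by (simp add: perm_algebra_def mult_A14 vec_eq_iff forall_3 axis_def)

text \<open>The element \<open>(x, y, z)\<close> of \<open>A07\<close> generates by a Vandermonde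
  determinant and satisfies the required relation. The roots must be nonzero because the powers
  start with the first.\<close>

lemma cyclic_distinct_roots:
  assumes "x \<noteq> 0" "y \<noteq> 0" "z \<noteq> 0" "x \<noteq> y" "x \<noteq> z" "y \<noteq> z"
  shows "cyclic (root_companion x y z) \<in> orbit A07"
proof -
  interpret perm_alg A07 by unfold_locales (rule perm_A07)
  define a :: "complex^3" where "a = (\<chi> i. if i = 1 then x else if i = 2 then y else z)"
  have "det3 a (mult A07 a a) (mult A07 a (mult A07 a a))
      = x * y * z * (y - x) * (z - x) * (z - y)"
    unfolding det3_def by (simp add: a_def mult_A07) algebra
  then have "det3 a (mult A07 a a) (mult A07 a (mult A07 a a)) \<noteq> 0" using assms by simp
  moreover have "mult A07 a (mult A07 a (mult A07 a a)) = (x * y * z) *s a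
      + (- (x * y + x * z + y * z)) *s mult A07 a a + (x + y + z) *s mult A07 a (mult A07 a a)"
    by (simp add: vec_eq_iff forall_3 a_def mult_A07 algebra_simps)
  ultimately have "A07 \<in> orbit (cyclic (root_companion x y z))"
    unfolding root_companion_def by (rule generated_orbit)
  then show ?thesis by (rule orbit_sym)
qed

lemma orbit_stable: "d \<in> orbit T \<Longrightarrow> e \<in> orbit d \<Longrightarrow> e \<in> orbit T"
  using orbit_trans by blast

lemma cyclic_in_closure: "cyclic (root_companion x y z) \<in> zariski closure_of orbit A07"
proof (rule in_closure_limit)
  \<comment> \<open>Three different nonzero speeds: even if roots coincide or vanish, each condition
    of \<open>cyclic_distinct_roots\<close> fails for only finitely many \<open>t\<close>.\<close>
  let ?S = "\<lambda>t. root_companion (x + t) (y + 2 * t) (z + 3 * t)"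
  have lim: "((\<lambda>t. ?S t $ i $ j) \<longlongrightarrow> root_companion x y z $ i $ j) (at 0)" for i j
  proof -
    have "isCont (\<lambda>t. ?S t $ i $ j) 0"
      unfolding root_companion_def companion_def cols_def by (cases "j = 1"; cases "j = 2"; cases "i = 1"; cases "i = 2"; simp)
    then show ?thesis by (simp add: isCont_def)
  qed
  show "((\<lambda>t. cyclic (?S t) $ i $ j $ k) \<longlongrightarrow> cyclic (root_companion x y z) $ i $ j $ k) (at 0)" for i j k
    by (rule pol_tendsto[OF _ lim]) (rule polymap_cyclic[unfolded polymap_def, rule_format])
  let ?P = "[:x, 1:] * [:y, 2:] * [:z, 3:] * [:x - y, -1:] * [:x - z, -2:] * [:y - z, -1:]"
  have "?P \<noteq> 0" by simp
  then have "eventually (\<lambda>t. poly ?P t \<noteq> 0) (at 0)" by (rule eventually_poly_nonzero)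
  then show "eventually (\<lambda>t. cyclic (?S t) \<in> orbit A07) (at 0)"
  proof eventually_elim
    case (elim t)
    then show ?case
      unfolding poly_mult mult_eq_0_iff de_Morgan_disj
      by (intro cyclic_distinct_roots) (auto simp: algebra_simps)
  qed
qed

lemma monogenic_in_closure:
  assumes "perm_algebra c" "monogenic c" shows "c \<in> zariski closure_of orbit A07"
proof -
  interpret perm_alg c by unfold_locales (rule assms(1))
  obtain a where k: "det3 a (a \<odot> a) (a \<odot> (a \<odot> a)) \<noteq> 0" using assms(2) unfolding monogenic_def by blast
  obtain p q r where e: "a \<odot> (a \<odot> (a \<odot> a)) = p *s a + q *s (a \<odot> a) + r *s (a \<odot> (a \<odot> a))"
    using basis_coords[OF k] .
  obtain x y z where "p = x * y * z" "q = - (x * y + x * z + y * z)" "r = x + y + z"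
    using cubic_roots .
  then have "c \<in> orbit (cyclic (root_companion x y z))"
    using generated_orbit[OF k e] by (simp only: root_companion_def)
  then show ?thesis using closure_orbit_stable[OF cyclic_in_closure] orbit_stable by blast
qed

text \<open>Cramer's rule gives \<open>k a\<^sup>4 = p a + q a\<^sup>2 + r a\<^sup>3\<close>; this is the homogenised discriminant of the
  corresponding cubic, multiplied by its constant term and by \<open>k\<close>. It is nonzero iff \<open>a\<close> generates
  the algebra and acts with three distinct nonzero eigenvalues.\<close>

definition cubic_disc :: "multiplication \<Rightarrow> complex^3 \<Rightarrow> complex" where
  "cubic_disc c a = (let s = mult c a a; t = mult c a s; u = mult c a t;
     k = det3 a s t; p = det3 u s t; q = det3 a u t; r = det3 a s u
     in k * p * (q^2 * r^2 + 4 * q^3 * k - 4 * r^3 * p - 18 * p * q * r * k - 27 * p^2 * k^2))"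

lemma cubic_disc_orbit:
  assumes "perm_algebra c" "cubic_disc c a \<noteq> 0" shows "c \<in> orbit A07"
proof -
  interpret perm_alg c by unfold_locales (rule assms(1))
  have k: "det3 a (a \<odot> a) (a \<odot> (a \<odot> a)) \<noteq> 0" using assms(2) by (auto simp: cubic_disc_def)
  obtain p q r where e: "a \<odot> (a \<odot> (a \<odot> a)) = p *s a + q *s (a \<odot> a) + r *s (a \<odot> (a \<odot> a))"
    using basis_coords[OF k] .
  obtain x y z where xyz: "p = x * y * z" "q = - (x * y + x * z + y * z)" "r = x + y + z"
    using cubic_roots .
  define k where "k = det3 a (a \<odot> a) (a \<odot> (a \<odot> a))"
  have "det3 (a \<odot> (a \<odot> (a \<odot> a))) (a \<odot> a) (a \<odot> (a \<odot> a)) = p * k"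
    "det3 a (a \<odot> (a \<odot> (a \<odot> a))) (a \<odot> (a \<odot> a)) = q * k"
    "det3 a (a \<odot> a) (a \<odot> (a \<odot> (a \<odot> a))) = r * k"
    unfolding e by (simp_all add: det3_linear k_def)
  then have "cubic_disc c a = k * (p * k) * ((q * k)^2 * (r * k)^2 + 4 * (q * k)^3 * k
      - 4 * (r * k)^3 * (p * k) - 18 * (p * k) * (q * k) * (r * k) * k - 27 * (p * k)^2 * k^2)"
    by (simp add: cubic_disc_def Let_def k_def)
  \<comment> \<open>The degree four bracket is the discriminant of the cubic with roots
    \<open>x, y, z\<close>, and \<open>p\<close> is their product.\<close>
  also have "\<dots> = k ^ 6 * (x * y * z) * ((x - y) * (x - z) * (y - z))^2"
    unfolding xyz by algebra
  finally have "x \<noteq> 0" "y \<noteq> 0" "z \<noteq> 0" "x \<noteq> y" "x \<noteq> z" "y \<noteq> z" using assms(2) by auto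
  then have "cyclic (root_companion x y z) \<in> orbit A07" by (rule cyclic_distinct_roots)
  moreover have "c \<in> orbit (cyclic (root_companion x y z))"
    using generated_orbit[OF k e] by (simp only: root_companion_def xyz)
  ultimately show ?thesis by (rule orbit_trans[rotated])
qed

text \<open>For nonzero Krylov determinant, the vectors \<open>e\<^sub>1\<close>,
  \<open>M e\<^sub>1\<close>, \<open>M^2 e\<^sub>1\<close> conjugate \<open>M\<close> to a companion
  matrix; all other matrices follow by density.\<close>

lemma cyclic_range_in_closure: "cyclic M \<in> zariski closure_of orbit A07"
proof -
  have gen: "cyclic M \<in> zariski closure_of orbit A07" if k: "krylov_det M \<noteq> 0" for M
  proof -
    define a b d where "a = (axis 1 1 :: complex^3)" and "b = M *v a" and "d = M *v b"
    have k': "det3 a b d \<noteq> 0" using k by (simp add: krylov_det_def a_def b_def d_def)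
    obtain p q r where Md: "M *v d = p *s a + q *s b + r *s d" using basis_coords[OF k'] .
    obtain x y z where xyz: "p = x * y * z" "q = - (x * y + x * z + y * z)" "r = x + y + z"
      using cubic_roots .
    let ?g = "cols a b d" and ?C = "companion p q r"
    let ?k = "1 / det3 a b d"
    have "cyclic_form M (?g *v x) (?g *v y) = det ?g *s (?g *v cyclic_form ?C x y)" for x y
      by (rule cyclic_form_intertwine)
        (simp_all add: companion_intertwine[OF Md b_def[symmetric] d_def[symmetric]], simp add: cols_vec a_def axis_def)
    then have g: "mult (cyclic M) (?g *v x) (?g *v y) = det3 a b d *s (?g *v mult (cyclic ?C) x y)" for x y
      by (simp only: mult_cyclic det_cols)
    \<comment> \<open>Dividing the basis by the determinant absorbs the scalar in \<open>g\<close>,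
      because the product is quadratic in the basis and its value is linear.\<close>
    define h where "h = cols (?k *s a) (?k *s b) (?k *s d)"
    have h: "h *v x = ?k *s (?g *v x)" for x
      by (simp add: h_def cols_vec vec_eq_iff algebra_simps)
    have "mult (cyclic M) (h *v x) (h *v y) = h *v mult (cyclic ?C) x y" for x y
      unfolding h mult_linear g using k' by (simp add: vector_smult_assoc)
    moreover have "det h \<noteq> 0" using k' by (simp add: h_def det_cols det3_linear)
    then have "invertible h" by (simp add: invertible_det_nz)
    ultimately have "cyclic M \<in> orbit (cyclic ?C)" unfolding orbit_iff by blast
    moreover have "cyclic ?C \<in> zariski closure_of orbit A07"
      using cyclic_in_closure[of x y z] by (simp only: root_companion_def xyz)
    ultimately show ?thesis using closure_orbit_stable orbit_stable by blast
  qed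
  have "range cyclic \<subseteq> zariski closure_of (zariski closure_of orbit A07)"
    by (rule closure_dense[OF polymap_cyclic pol_krylov_det, of "companion 0 0 0"])
      (simp_all add: krylov_det_companion gen)
  then show ?thesis by auto
qed

section \<open>Degenerations\<close>

lemma tendsto_if:
  assumes "P \<Longrightarrow> (f \<longlongrightarrow> l) F" "\<not> P \<Longrightarrow> (g \<longlongrightarrow> m) F"
  shows "((\<lambda>t. if P then f t else g t) \<longlongrightarrow> (if P then l else m)) F"
  using assms by simp

lemma D1_in_closure: "D1 \<in> zariski closure_of orbit A07"
proof (rule in_closure_limit)
  \<comment> \<open>The two nilpotent basis vectors become \<open>t\<close> times idempotents; in
    \<open>A07\<close> they are \<open>t e\<^sub>2\<close> and \<open>t e\<^sub>3\<close>, beside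
    the unit.\<close>
  let ?S = "\<lambda>t. \<chi> i j k. if (i, j, k) = (2, 2, 2) \<or> (i, j, k) = (3, 3, 3) then t else D1 $ i $ j $ k"
  show "((\<lambda>t. ?S t $ i $ j $ k) \<longlongrightarrow> D1 $ i $ j $ k) (at 0)" for i j k
  proof (cases "(i, j, k) = (2, 2, 2) \<or> (i, j, k) = (3, 3, 3)")
    case True
    then have "D1 $ i $ j $ k = 0" by (auto simp: D1_def idx3)
    then show ?thesis using True by simp
  next
    case False
    then show ?thesis by (simp only: vec_lambda_beta if_not_P[OF False] if_False tendsto_const)
  qed
  have "?S t \<in> orbit A07" if t: "t \<noteq> 0" for t
  proof (rule orbit_sym, rule orbit_basisI)
    show "det3 (\<chi> i. 1) (axis 2 t) (axis 3 t) \<noteq> 0" using t by (simp add: det3_def axis_def)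
  qed (simp add: forall_3 mult_A07 D1_def axis_def vec_eq_iff)
  then show "eventually (\<lambda>t. ?S t \<in> orbit A07) (at 0)" by (auto simp: eventually_at_filter)
qed

lemma D2_in_closure: "D2 \<in> zariski closure_of orbit A07"
proof (rule in_closure_limit)
  let ?S = "\<lambda>t. \<chi> i j k. if (i, j, k) = (2, 2, 2) \<or> (i, j, k) = (3, 3, 3) then t else D2 $ i $ j $ k"
  show "((\<lambda>t. ?S t $ i $ j $ k) \<longlongrightarrow> D2 $ i $ j $ k) (at 0)" for i j k
  proof (cases "(i, j, k) = (2, 2, 2) \<or> (i, j, k) = (3, 3, 3)")
    case True
    then have "D2 $ i $ j $ k = 0" by (auto simp: D2_def idx3)
    then show ?thesis using True by simp
  next
    case False
    then show ?thesis by (simp only: vec_lambda_beta if_not_P[OF False] if_False tendsto_const)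
  qed
  have "?S t \<in> orbit A07" if t: "t \<noteq> 0" for t
  proof (rule orbit_sym, rule orbit_basisI)
    show "det3 (axis 1 1) (axis 2 t) (axis 3 t) \<noteq> 0" using t by (simp add: det3_def axis_def)
  qed (simp add: forall_3 mult_A07 D2_def axis_def vec_eq_iff)
  then show "eventually (\<lambda>t. ?S t \<in> orbit A07) (at 0)" by (auto simp: eventually_at_filter)
qed

lemma E1_in_orbit: "\<gamma> \<noteq> 0 \<Longrightarrow> E1 \<gamma> \<in> orbit A24"
  by (rule orbit_sym, rule orbit_basisI[of "axis 1 1" "axis 3 1" "axis 2 \<gamma>"])
    (simp_all add: det3_def forall_3 mult_A24 E1_def axis_def vec_eq_iff)

lemma E2_in_orbit: "\<beta> \<noteq> 0 \<Longrightarrow> E2 \<beta> \<in> orbit A24"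
  by (rule orbit_sym, rule orbit_basisI[of "axis 1 1 + axis 2 1" "axis 2 \<beta>" "axis 3 1"])
    (simp_all add: det3_def forall_3 mult_A24 E2_def axis_def vec_eq_iff)

lemma E1_in_closure: "E1 \<gamma> \<in> zariski closure_of orbit A24"
proof (cases "\<gamma> = 0")
  case True
  have "E1 0 \<in> zariski closure_of orbit A24"
  proof (rule in_closure_limit)
    show "((\<lambda>t. E1 t $ i $ j $ k) \<longlongrightarrow> E1 0 $ i $ j $ k) (at 0)" for i j k
      unfolding E1_def vec_lambda_beta by (intro tendsto_if tendsto_const tendsto_ident_at)
    show "eventually (\<lambda>t. E1 t \<in> orbit A24) (at 0)"
      using E1_in_orbit by (auto simp: eventually_at_filter)
  qed
  with True show ?thesis by simp
qed (use E1_in_orbit subset_closure in blast)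

lemma E2_in_closure: "E2 \<beta> \<in> zariski closure_of orbit A24"
proof (cases "\<beta> = 0")
  case True
  have "E2 0 \<in> zariski closure_of orbit A24"
  proof (rule in_closure_limit)
    show "((\<lambda>t. E2 t $ i $ j $ k) \<longlongrightarrow> E2 0 $ i $ j $ k) (at 0)" for i j k
      unfolding E2_def vec_lambda_beta by (intro tendsto_if tendsto_const tendsto_ident_at)
    show "eventually (\<lambda>t. E2 t \<in> orbit A24) (at 0)"
      using E2_in_orbit by (auto simp: eventually_at_filter)
  qed
  with True show ?thesis by simp
qed (use E2_in_orbit subset_closure in blast)

section \<open>Polynomial parametrizations of the components\<close>

definition adj3 :: "complex^3^3 \<Rightarrow> complex^3 \<Rightarrow> complex^3" where
  "adj3 \<phi> v = (\<chi> i. if i = 1 then det3 v (\<phi> *v axis 2 1) (\<phi> *v axis 3 1)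
     else if i = 2 then det3 (\<phi> *v axis 1 1) v (\<phi> *v axis 3 1)
     else det3 (\<phi> *v axis 1 1) (\<phi> *v axis 2 1) v)"

lemma mv_expand: "(\<phi>::complex^3^3) *v x = x$1 *s (\<phi> *v axis 1 1) + x$2 *s (\<phi> *v axis 2 1) + x$3 *s (\<phi> *v axis 3 1)"
  by (subst vec3_expand) (simp only: matrix_vector_right_distrib vec.scale)

lemma det_columns: "det \<phi> = det3 (\<phi> *v axis 1 1) (\<phi> *v axis 2 1) (\<phi> *v axis 3 1)"
  by (simp add: det3_image det3_axis)

lemma mv_adj3: "\<phi> *v adj3 \<phi> v = det \<phi> *s v"
  unfolding det_columns by (subst mv_expand, subst cramer3) (simp add: adj3_def)

text \<open>Transporting \<open>A\<close> by \<open>\<phi>\<^sup>-\<^sup>1\<close>, with the inverse replaced by the adjugate.\<close>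

definition transport :: "multiplication \<Rightarrow> complex^3^3 \<Rightarrow> multiplication" where
  "transport A \<phi> = (\<chi> i j k. adj3 \<phi> (mult A (\<phi> *v axis i 1) (\<phi> *v axis j 1)) $ k)"

lemma mult_transport: "mult (transport A \<phi>) x y = adj3 \<phi> (mult A (\<phi> *v x) (\<phi> *v y))"
  unfolding transport_def
  by (rule mult_of_bilinear)
    (simp_all add: adj3_def mult_linear det3_linear matrix_vector_right_distrib vec.scale vec_eq_iff)

lemma pol_mult_nth:
  "(\<And>i. pol entry (\<lambda>\<phi>. X \<phi> $ i)) \<Longrightarrow> (\<And>i. pol entry (\<lambda>\<phi>. Y \<phi> $ i)) \<Longrightarrow> pol entry (\<lambda>\<phi>. mult c (X \<phi>) (Y \<phi>) $ k)"
  by (auto simp: mult_def intro!: pol_sum pol.intros)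

lemma polymap_transport: "polymap (transport A)"
  unfolding polymap_def
proof (intro allI)
  fix i j k
  show "pol entry (\<lambda>\<phi>. transport A \<phi> $ i $ j $ k)"
    by (cases "k = 1"; cases "k = 2")
      (auto simp: transport_def adj3_def intro!: pol_det3 pol_mult_nth pol_mv pol.const)
qed

lemma transport_in_orbit:
  assumes "det \<phi> \<noteq> 0" shows "transport A \<phi> \<in> orbit A"
proof (rule orbit_coframeI)
  \<comment> \<open>By \<open>mv_adj3\<close>, \<open>\<phi>\<close> itself respects products only
    up to the factor \<open>det \<phi>\<close>, which this scaling removes.\<close>
  let ?h = "\<chi> i j. det \<phi> * \<phi> $ i $ j"
  have h: "?h *v x = det \<phi> *s (\<phi> *v x)" for x
    by (simp add: vec_eq_iff matrix_vector_mult_def sum_distrib_left mult.assoc)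
  show "?h *v mult (transport A \<phi>) x y = mult A (?h *v x) (?h *v y)" for x y
    by (simp add: h mult_transport mv_adj3 mult_linear vector_smult_assoc)
  have "det ?h = det \<phi> ^ 4"
    unfolding det_columns[of ?h] h by (simp add: det3_linear flip: det_columns) (simp add: power_numeral_reduce)
  then show "det ?h \<noteq> 0" using assms by simp
qed

lemma orbit_subset_transport: "orbit A \<subseteq> range (transport A)"
proof
  fix c assume "c \<in> orbit A"
  then obtain g where g: "\<And>x y. mult A (g *v x) (g *v y) = g *v mult c x y" "det g \<noteq> 0" "invertible g"
    using orbitE[OF orbit_sym] by metis
  \<comment> \<open>Replacing \<open>g\<close> by \<open>s g\<close> multiplies the transported
    product by \<open>s^4\<close>: two factors from the adjugate, two from the arguments. The fourth
    root compensates \<open>det g\<close>.\<close>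
  define s where "s = csqrt (csqrt (1 / det g))"
  have "s ^ 4 = (s^2)^2" by (simp flip: power_mult)
  then have s: "s ^ 4 * det g = 1" using g(2) by (simp add: s_def power2_csqrt)
  let ?\<phi> = "\<chi> i j. s * g $ i $ j"
  have \<phi>: "?\<phi> *v x = s *s (g *v x)" for x
    by (simp add: vec_eq_iff matrix_vector_mult_def sum_distrib_left mult.assoc)
  have det: "det ?\<phi> = s ^ 3 * det g"
    unfolding det_columns[of ?\<phi>] \<phi> by (simp add: det3_linear flip: det_columns) (simp add: power_numeral_reduce)
  have "mult (transport A ?\<phi>) x y = mult c x y" for x y
  proof -
    have "g *v (s *s mult (transport A ?\<phi>) x y) = ?\<phi> *v mult (transport A ?\<phi>) x y"
      by (simp add: \<phi> vec.scale)
    also have "\<dots> = (s ^ 3 * det g) *s mult A (s *s (g *v x)) (s *s (g *v y))"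
      unfolding mult_transport mv_adj3 det \<phi> ..
    also have "\<dots> = (s ^ 4 * det g * s) *s (g *v mult c x y)"
      by (simp add: mult_linear g(1) vector_smult_assoc power_numeral_reduce mult_ac)
    also have "\<dots> = g *v (s *s mult c x y)" by (simp add: s vec.scale)
    finally have "s *s mult (transport A ?\<phi>) x y = s *s mult c x y"
      by (metis matrix_inv_vec(2)[OF g(3)])
    moreover have "s \<noteq> 0" using s by auto
    ultimately show ?thesis by simp
  qed
  then have "transport A ?\<phi> = c" by (rule mult_eqI)
  then show "c \<in> range (transport A)" by blast
qed

lemma closure_orbit_eq: "zariski closure_of orbit A = zariski closure_of range (transport A)"
proof (rule closure_eq_range[OF polymap_transport])
  show "pol entry det"
    unfolding det_columns by (intro pol_det3 pol_mv pol.const)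
  show "det (mat 1 :: complex^3^3) \<noteq> 0" by simp
qed (use transport_in_orbit orbit_subset_transport in auto)

section \<open>Line-valued algebras and the family \<open>A14\<close>\<close>

definition cross :: "complex^3 \<Rightarrow> complex^3 \<Rightarrow> complex^3" where
  "cross u v = (\<chi> i. if i = 1 then u$2 * v$3 - u$3 * v$2
     else if i = 2 then u$3 * v$1 - u$1 * v$3 else u$1 * v$2 - u$2 * v$1)"

text \<open>The first two rows \<open>l\<^sub>1, l\<^sub>2\<close> of \<open>\<phi>\<close> are linear forms which vanish on their cross product,
  and the third row lists the coefficients of \<open>l\<^sub>1 \<otimes> l\<^sub>2\<close>, \<open>l\<^sub>2 \<otimes> l\<^sub>1\<close> and \<open>l\<^sub>2 \<otimes> l\<^sub>2\<close>. The term
  \<open>l\<^sub>1 \<otimes> l\<^sub>1\<close> can be omitted since every binary quadratic form has an isotropic vector.\<close>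

definition line_family :: "complex^3^3 \<Rightarrow> multiplication" where
  "line_family \<phi> = (\<chi> i j k. (\<phi>$3$1 * (\<phi>$1$i * \<phi>$2$j) + \<phi>$3$2 * (\<phi>$2$i * \<phi>$1$j) + \<phi>$3$3 * (\<phi>$2$i * \<phi>$2$j))
     * cross (\<phi>$1) (\<phi>$2) $ k)"

lemma mult_line_family:
  "mult (line_family \<phi>) x y = (let l = (\<lambda>i x. (\<phi> *v x) $ i) in
     (\<phi>$3$1 * (l 1 x * l 2 y) + \<phi>$3$2 * (l 2 x * l 1 y) + \<phi>$3$3 * (l 2 x * l 2 y)) *s cross (\<phi>$1) (\<phi>$2))"
  by (simp add: vec_eq_iff mult_def line_family_def matrix_vector_mult_def sum_3 algebra_simps)

lemma polymap_line_family: "polymap line_family"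
  unfolding polymap_def
proof (intro allI)
  fix i j k
  show "pol entry (\<lambda>\<phi>. line_family \<phi> $ i $ j $ k)"
    by (cases "k = 1"; cases "k = 2")
      (auto simp: line_family_def cross_def intro!: pol_intros)
qed

lemma line_family_in_orbit:
  assumes "(\<phi>$3$1 + \<phi>$3$2) * (\<phi>$3$1 - \<phi>$3$2) * cross (\<phi>$1) (\<phi>$2) $ 3 \<noteq> 0"
  shows "line_family \<phi> \<in> (\<Union>\<alpha>\<in>- {0}. orbit (A14 \<alpha>))"
proof -
  define p q r \<kappa> where "p = \<phi>$3$1" and "q = \<phi>$3$2" and "r = \<phi>$3$3" and "\<kappa> = cross (\<phi>$1) (\<phi>$2) $ 3"
  have nz: "p + q \<noteq> 0" "p - q \<noteq> 0" "\<kappa> \<noteq> 0" using assms by (auto simp: p_def q_def \<kappa>_def)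
  \<comment> \<open>The parameter is the ratio of the skew to the symmetric part. Replacing
    \<open>l 1\<close> by \<open>l 1 + \<mu> l 2\<close> absorbs the coefficient \<open>r\<close>,
    and \<open>\<rho>\<close> rescales the line of values to match \<open>A14\<close>.\<close>
  define \<alpha> \<mu> \<rho> where "\<alpha> = (p - q) / (p + q)" and "\<mu> = r / (p + q)" and "\<rho> = 2 / (p + q)"
  have \<alpha>: "1 + \<alpha> = \<rho> * p" "1 - \<alpha> = \<rho> * q"
    using nz(1) by (simp_all add: \<alpha>_def \<rho>_def field_simps)
  have "(p + q) * \<mu> = r" using nz(1) by (simp add: \<mu>_def)
  then have \<mu>: "r = p * \<mu> + q * \<mu>" by (simp add: distrib_right)
  define h :: "complex^3^3" where "h = (\<chi> i. if i = 1 then \<phi>$1 + \<mu> *s \<phi>$2 else if i = 2 then \<phi>$2 else axis 3 (\<rho> / \<kappa>))"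
  define l where "l i x = (\<phi> *v x) $ i" for i x
  have hx: "h *v x = (\<chi> i. if i = 1 then l 1 x + \<mu> * l 2 x else if i = 2 then l 2 x else \<rho> / \<kappa> * x $ 3)" for x
    by (simp add: vec_eq_iff forall_3 h_def l_def matrix_vector_mult_def sum_3 axis_def algebra_simps)
  have hc: "h *v cross (\<phi>$1) (\<phi>$2) = axis 3 \<rho>"
  proof -
    have "l 1 (cross (\<phi>$1) (\<phi>$2)) = 0" "l 2 (cross (\<phi>$1) (\<phi>$2)) = 0"
      by (simp_all add: l_def cross_def matrix_vector_mult_def sum_3 algebra_simps)
    then show ?thesis using nz(3) by (simp add: hx vec_eq_iff forall_3 axis_def flip: \<kappa>_def)
  qed
  have "det h = \<rho>"
  proof -
    have "det (\<chi> i. if i = 1 then \<phi>$1 + \<mu> *s \<phi>$2 else if i = 2 then \<phi>$2 else axis 3 m)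
        = m * cross (\<phi>$1) (\<phi>$2) $ 3" for m
      by (simp add: det_3 axis_def cross_def algebra_simps)
    then have "det h = (\<rho> / \<kappa>) * \<kappa>" unfolding h_def \<kappa>_def .
    then show ?thesis using nz(3) by simp
  qed
  then have "det h \<noteq> 0" using nz(1) by (simp add: \<rho>_def)
  moreover have "h *v mult (line_family \<phi>) x y = mult (A14 \<alpha>) (h *v x) (h *v y)" for x y
  proof -
    have "h *v mult (line_family \<phi>) x y
        = (p * (l 1 x * l 2 y) + q * (l 2 x * l 1 y) + r * (l 2 x * l 2 y)) *s axis 3 \<rho>"
      unfolding mult_line_family Let_def vec.scale hc l_def p_def q_def r_def ..
    also have "\<dots> = mult (A14 \<alpha>) (h *v x) (h *v y)"
      unfolding mult_A14 \<alpha> hx \<mu> by (simp add: vec_eq_iff forall_3 axis_def algebra_simps)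
    finally show ?thesis .
  qed
  ultimately have "line_family \<phi> \<in> orbit (A14 \<alpha>)" by (rule orbit_coframeI)
  moreover have "\<alpha> \<noteq> 0" using nz by (simp add: \<alpha>_def)
  ultimately show ?thesis by blast
qed

lemma line_valued_orbit:
  assumes "c \<in> orbit T" "line_valued T" shows "line_valued c"
proof -
  obtain g where g: "invertible g" "\<And>x y. mult c (g *v x) (g *v y) = g *v mult T x y"
    "\<And>x. \<exists>x'. x = g *v x'" using orbitE[OF assms(1)] by metis
  obtain w where w: "w \<noteq> 0" "\<And>x y. \<exists>k. mult T x y = k *s w" "\<And>x. mult T x w = 0 \<and> mult T w x = 0"
    using assms(2) unfolding line_valued_def by blast
  have g0: "g *v 0 = 0" by simp
  show ?thesis unfolding line_valued_def
  proof (intro exI[of _ "g *v w"] conjI allI)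
    show "g *v w \<noteq> 0" using w(1) matrix_inv_vec(2)[OF g(1), of w] by auto
    show "\<exists>k. mult c x y = k *s (g *v w)" for x y
    proof -
      obtain x' y' where xy: "x = g *v x'" "y = g *v y'" using g(3) by metis
      obtain k where k: "mult T x' y' = k *s w" using w(2) by blast
      have "mult c x y = k *s (g *v w)" unfolding xy g(2) k by (rule vec.scale)
      then show ?thesis by blast
    qed
    show "mult c x (g *v w) = 0" "mult c (g *v w) x = 0" for x
      using g(2) g(3)[of x] w(3) g0 by metis+
  qed
qed

lemma line_valued_A14: "line_valued (A14 \<alpha>)"
  unfolding line_valued_def
proof (intro exI[of _ "axis 3 1"] conjI allI)
  show "\<exists>k. mult (A14 \<alpha>) x y = k *s axis 3 1" for x y unfolding mult_A14 by blast
qed (simp_all add: mult_A14 axis_def vec_eq_iff)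

lemma line_valued_triple:
  assumes "line_valued c" shows "mult c (mult c x y) z = 0" "mult c x (mult c y z) = 0"
  using assms unfolding line_valued_def by (metis mult_scale_left mult_scale_right vector_smult_rzero)+

lemma isotropic_vector:
  fixes a b c :: complex
  shows "\<exists>x y. (x, y) \<noteq> (0, 0) \<and> a * (x * x) + b * (x * y) + c * (y * y) = 0"
proof (cases "a = 0")
  case True
  then show ?thesis by (intro exI[of _ 1] exI[of _ 0]) simp
next
  case False
  then have "\<not> constant (poly [:c, b, a:])" by (simp add: constant_degree)
  then obtain x where "poly [:c, b, a:] x = 0" using fundamental_theorem_of_algebra by blast
  then show ?thesis by (intro exI[of _ x] exI[of _ 1]) (simp add: algebra_simps)
qed

lemma line_valued_basis:
  assumes "line_valued c"
  obtains u v w k2 k3 k4 where "det3 u v w \<noteq> 0" "mult c u u = 0" "mult c u v = k2 *s w"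
    "mult c v u = k3 *s w" "mult c v v = k4 *s w" "\<And>x. mult c x w = 0" "\<And>x. mult c w x = 0"
proof -
  obtain w where w: "w \<noteq> 0" "\<And>x y. \<exists>k. mult c x y = k *s w" "\<And>x. mult c x w = 0" "\<And>x. mult c w x = 0"
    using assms unfolding line_valued_def by blast
  obtain b n where bn: "det3 w b n \<noteq> 0" using exists_basis1[OF w(1)] by blast
  obtain k1 k2 k3 k4 where k: "mult c b b = k1 *s w" "mult c b n = k2 *s w" "mult c n b = k3 *s w" "mult c n n = k4 *s w"
    using w(2) by metis
  obtain x y where xy: "(x, y) \<noteq> (0, 0)" "k1 * (x * x) + (k2 + k3) * (x * y) + k4 * (y * y) = 0"
    using isotropic_vector by blast
  define u where "u = x *s b + y *s n"
  have "mult c u u = (k1 * (x * x) + (k2 + k3) * (x * y) + k4 * (y * y)) *s w"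
    by (simp add: u_def mult_linear k) (simp add: vec_eq_iff algebra_simps)
  then have uu: "mult c u u = 0" using xy(2) by simp
  have "\<exists>v. det3 u v w \<noteq> 0"
  proof (cases "x = 0")
    case True
    then have "det3 u b w = - (y * det3 w b n)"
      using det3_swap(3)[of w b n] by (simp add: u_def det3_linear)
    then show ?thesis using bn xy(1) True by (intro exI[of _ b]) simp
  next
    case False
    have "det3 u n w = x * det3 w b n"
      using det3_swap(3)[of w n b] det3_swap(2)[of w b n] by (simp add: u_def det3_linear)
    then show ?thesis using bn False by (intro exI[of _ n]) simp
  qed
  then obtain v where "det3 u v w \<noteq> 0" ..
  moreover obtain k2 k3 k4 where "mult c u v = k2 *s w" "mult c v u = k3 *s w" "mult c v v = k4 *s w"
    using w(2) by metis
  ultimately show ?thesis using that uu w(3,4) by blast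
qed

lemma line_valued_in_range: assumes "line_valued c" shows "c \<in> range line_family"
proof -
  obtain u v w k2 k3 k4 where d: "det3 u v w \<noteq> 0" and p: "mult c u u = 0" "mult c u v = k2 *s w"
    "mult c v u = k3 *s w" "mult c v v = k4 *s w" "\<And>x. mult c x w = 0" "\<And>x. mult c w x = 0"
    using line_valued_basis[OF assms] by metis
  define \<delta> where "\<delta> = det3 u v w"
  \<comment> \<open>The first two rows are the coordinate forms for \<open>u\<close> and
    \<open>v\<close>. Their cross product is \<open>w / \<delta>\<close>, which explains the factor
    \<open>\<delta>\<close> in the third row.\<close>
  define \<phi> :: "complex^3^3" where "\<phi> = (\<chi> i j. if i = 1 then det3 (axis j 1) v w / \<delta>
    else if i = 2 then det3 u (axis j 1) w / \<delta>
    else \<delta> * (if j = 1 then k2 else if j = 2 then k3 else k4))"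
  have l: "(\<phi> *v x) $ 1 = det3 x v w / \<delta>" "(\<phi> *v x) $ 2 = det3 u x w / \<delta>" for x
    by (simp_all add: \<phi>_def matrix_vector_mult_def sum_3 det3_def axis_def add_divide_distrib diff_divide_distrib algebra_simps)
  have \<delta>: "\<delta> \<noteq> 0" using d by (simp add: \<delta>_def)
  have "\<delta> *s (\<delta> *s cross (\<phi>$1) (\<phi>$2)) = cross (\<delta> *s \<phi>$1) (\<delta> *s \<phi>$2)"
    by (simp add: vec_eq_iff forall_3 cross_def algebra_simps)
  also have "\<delta> *s \<phi>$1 = (\<chi> j. det3 (axis j 1) v w)"
    using \<delta> by (simp add: vec_eq_iff \<phi>_def)
  also have "\<dots> = cross v w"
    by (simp add: vec_eq_iff forall_3 det3_def axis_def cross_def algebra_simps)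
  also have "\<delta> *s \<phi>$2 = (\<chi> j. det3 u (axis j 1) w)"
    using \<delta> by (simp add: vec_eq_iff \<phi>_def)
  also have "\<dots> = cross w u"
    by (simp add: vec_eq_iff forall_3 det3_def axis_def cross_def algebra_simps)
  also have "cross (cross v w) (cross w u) = \<delta> *s w"
    by (simp add: vec_eq_iff forall_3 cross_def \<delta>_def det3_def) algebra
  finally have c: "\<delta> *s cross (\<phi>$1) (\<phi>$2) = w" using \<delta> by (simp only: vector_mul_lcancel) simp
  have "mult (line_family \<phi>) x y = mult c x y" for x y
  proof -
    have e: "x = (det3 x v w / \<delta>) *s u + (det3 u x w / \<delta>) *s v + (det3 u v x / \<delta>) *s w" for x
    proof -
      have "\<delta> *s x = \<delta> *s ((det3 x v w / \<delta>) *s u + (det3 u x w / \<delta>) *s v + (det3 u v x / \<delta>) *s w)"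
        unfolding \<delta>_def by (subst cramer3) (use d in \<open>simp add: vector_add_ldistrib vector_smult_assoc\<close>)
      then show ?thesis using \<delta> by (simp only: vector_mul_lcancel) simp
    qed
    define a b a' b' where "a = det3 x v w / \<delta>" and "b = det3 u x w / \<delta>"
      and "a' = det3 y v w / \<delta>" and "b' = det3 u y w / \<delta>"
    have "mult c x y = (k2 * (a * b') + k3 * (b * a') + k4 * (b * b')) *s w"
      by (subst e[of x], subst e[of y])
        (simp add: mult_linear p vec_eq_iff algebra_simps flip: a_def b_def a'_def b'_def)
    also have "\<dots> = (\<delta> * (k2 * (a * b') + k3 * (b * a') + k4 * (b * b'))) *s cross (\<phi>$1) (\<phi>$2)"
      by (subst c[symmetric]) (simp add: vector_smult_assoc mult.commute)
    also have "\<dots> = mult (line_family \<phi>) x y"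
      by (simp add: mult_line_family Let_def l a_def b_def a'_def b'_def)
        (simp add: \<phi>_def algebra_simps)
    finally show ?thesis by simp
  qed
  then have "line_family \<phi> = c" by (rule mult_eqI)
  then show ?thesis by blast
qed

text \<open>Generic members of the family have a nonzero parameter; conversely the family contains
  all line-valued algebras. So the closure also receives \<open>A14 0\<close> and all line-valued
  degenerations.\<close>

lemma closure_A14_eq:
  "zariski closure_of (\<Union>\<alpha>\<in>- {0}. orbit (A14 \<alpha>)) = zariski closure_of range line_family"
proof (rule closure_eq_range[OF polymap_line_family])
  let ?D = "\<lambda>\<phi>::complex^3^3. (\<phi>$3$1 + \<phi>$3$2) * (\<phi>$3$1 - \<phi>$3$2) * cross (\<phi>$1) (\<phi>$2) $ 3"
  show "pol entry ?D" by (simp add: cross_def) (intro pol_intros)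
  show "?D (\<chi> i j. if i = j \<or> i = 3 \<and> j = 1 then 1 else 0) \<noteq> 0" by (simp add: cross_def)
  show "line_family \<phi> \<in> (\<Union>\<alpha>\<in>- {0}. orbit (A14 \<alpha>))" if "?D \<phi> \<noteq> 0" for \<phi>
    by (rule line_family_in_orbit[OF that])
  show "(\<Union>\<alpha>\<in>- {0}. orbit (A14 \<alpha>)) \<subseteq> range line_family"
    using line_valued_in_range line_valued_orbit line_valued_A14 by blast
qed

lemma perm_subset_closures:
  assumes "perm_algebra c"
  shows "c \<in> zariski closure_of orbit A07 \<or> c \<in> zariski closure_of orbit A18
    \<or> c \<in> zariski closure_of orbit A24 \<or> c \<in> zariski closure_of (\<Union>\<alpha>\<in>- {0}. orbit (A14 \<alpha>))"
  using perm_classification[OF assms]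
proof (elim disjE exE)
  assume "monogenic c"
  then show ?thesis using monogenic_in_closure[OF assms] by blast
next
  assume "line_valued c"
  then have "c \<in> zariski closure_of range line_family" using line_valued_in_range subset_closure by blast
  then show ?thesis unfolding closure_A14_eq by blast
next
  assume "c \<in> orbit D1"
  then show ?thesis using closure_orbit_stable[OF D1_in_closure] orbit_stable by blast
next
  assume "c \<in> orbit D2"
  then show ?thesis using closure_orbit_stable[OF D2_in_closure] orbit_stable by blast
next
  assume "c \<in> orbit A18"
  then show ?thesis using subset_closure by blast
next
  fix \<gamma> assume "c \<in> orbit (E1 \<gamma>)"
  then show ?thesis using closure_orbit_stable[OF E1_in_closure] orbit_stable by blast
next
  fix \<beta> assume "c \<in> orbit (E2 \<beta>)"
  then show ?thesis using closure_orbit_stable[OF E2_in_closure] orbit_stable by blast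
qed

section \<open>Invariants\<close>

definition commutator :: "multiplication \<Rightarrow> complex^3 \<Rightarrow> complex^3 \<Rightarrow> complex^3" where
  "commutator c x y = mult c x y - mult c y x"

definition commutative :: "multiplication \<Rightarrow> bool" where
  "commutative c \<longleftrightarrow> (\<forall>x y. commutator c x y = 0)"

text \<open>The free third vector \<open>v\<close> expresses the dependence of two commutators by
  polynomial equations.\<close>

definition collinear_commutators :: "multiplication \<Rightarrow> bool" where
  "collinear_commutators c \<longleftrightarrow> (\<forall>x y z w v. det3 (commutator c x y) (commutator c z w) v = 0)"

definition planes_closed :: "multiplication \<Rightarrow> bool" where
  "planes_closed c \<longleftrightarrow> (\<forall>x y. det3 x y (mult c x y) = 0)"

text \<open>A multiplication induces a bilinear form on every plane \<open>P\<close> with values in \<open>\<complex>\<^sup>3 / P\<close>;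
  this is its determinant.\<close>

definition plane_det :: "multiplication \<Rightarrow> complex^3 \<Rightarrow> complex^3 \<Rightarrow> complex" where
  "plane_det c x y = det3 x y (mult c x x) * det3 x y (mult c y y)
     - det3 x y (mult c x y) * det3 x y (mult c y x)"

definition planes_degenerate :: "multiplication \<Rightarrow> bool" where
  "planes_degenerate c \<longleftrightarrow> (\<forall>x y. plane_det c x y = 0)"

definition two_step_nilpotent :: "multiplication \<Rightarrow> bool" where
  "two_step_nilpotent c \<longleftrightarrow> (\<forall>x y z. mult c (mult c x y) z = 0)"

lemma closedin_commutative: "closedin zariski {c. commutative c}"
proof -
  have "closedin zariski {c. \<forall>i. (case i of (x, y, k) \<Rightarrow> (\<lambda>c. (mult c x y - mult c y x) $ k)) c = 0}"
    by (rule closedin_zariski_all) (auto intro!: poly_fun_intros split: prod.splits)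
  then show ?thesis by (simp add: commutative_def commutator_def vec_eq_iff)
qed

lemma closedin_collinear_commutators: "closedin zariski {c. collinear_commutators c}"
proof -
  have "closedin zariski {c. \<forall>i. (case i of (x, y, z, w, v) \<Rightarrow>
      (\<lambda>c. det3 (mult c x y - mult c y x) (mult c z w - mult c w z) v)) c = 0}"
    by (rule closedin_zariski_all) (auto intro!: poly_fun_intros split: prod.splits)
  then show ?thesis by (simp add: collinear_commutators_def commutator_def)
qed

lemma closedin_planes_closed: "closedin zariski {c. planes_closed c}"
proof -
  have "closedin zariski {c. \<forall>i. (case i of (x, y) \<Rightarrow> (\<lambda>c. det3 x y (mult c x y))) c = 0}"
    by (rule closedin_zariski_all) (auto intro!: poly_fun_intros split: prod.splits)
  then show ?thesis by (simp add: planes_closed_def)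
qed

lemma closedin_planes_degenerate: "closedin zariski {c. planes_degenerate c}"
proof -
  have "closedin zariski {c. \<forall>i. (case i of (x, y) \<Rightarrow> (\<lambda>c. plane_det c x y)) c = 0}"
    unfolding plane_det_def
    by (rule closedin_zariski_all) (auto intro!: poly_fun_intros split: prod.splits)
  then show ?thesis by (simp add: planes_degenerate_def)
qed

lemma closedin_two_step_nilpotent: "closedin zariski {c. two_step_nilpotent c}"
proof -
  have "closedin zariski {c. \<forall>i. (case i of (x, y, z, k) \<Rightarrow> (\<lambda>c. mult c (mult c x y) z $ k)) c = 0}"
    by (rule closedin_zariski_all) (auto intro!: poly_fun_intros split: prod.splits)
  then show ?thesis by (simp add: two_step_nilpotent_def vec_eq_iff)
qed

definition equivariant :: "complex^3^3 \<Rightarrow> multiplication \<Rightarrow> multiplication \<Rightarrow> bool" where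
  "equivariant g T c \<longleftrightarrow> (\<forall>x y. mult c (g *v x) (g *v y) = g *v mult T x y)"

lemma orbit_equivariantE:
  assumes "c \<in> orbit T"
  obtains g where "equivariant g T c" "\<And>x. \<exists>x'. x = g *v x'" "det g \<noteq> 0"
  using orbitE[OF assms] unfolding equivariant_def by metis

lemma equivariant_mult: "equivariant g T c \<Longrightarrow> mult c (g *v x) (g *v y) = g *v mult T x y"
  by (simp add: equivariant_def)

lemma equivariant_commutator:
  "equivariant g T c \<Longrightarrow> commutator c (g *v x) (g *v y) = g *v commutator T x y"
  by (simp add: commutator_def equivariant_mult matrix_vector_mult_diff_distrib)

lemma equivariant_plane_det:
  "equivariant g T c \<Longrightarrow> plane_det c (g *v x) (g *v y) = det g ^ 2 * plane_det T x y"
  by (simp add: plane_det_def equivariant_mult det3_image power2_eq_square algebra_simps)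

lemma commutative_orbit: assumes "c \<in> orbit T" "commutative T" shows "commutative c"
proof -
  obtain g where g: "equivariant g T c" "\<And>x. \<exists>x'. x = g *v x'" using orbit_equivariantE[OF assms(1)] by metis
  have "commutator c (g *v x) (g *v y) = 0" for x y
    using assms(2) by (simp add: equivariant_commutator[OF g(1)] commutative_def)
  then show ?thesis unfolding commutative_def using g(2) by metis
qed

lemma collinear_commutators_orbit:
  assumes "c \<in> orbit T" "collinear_commutators T" shows "collinear_commutators c"
proof -
  obtain g where g: "equivariant g T c" "\<And>x. \<exists>x'. x = g *v x'" using orbit_equivariantE[OF assms(1)] by metis
  have "det3 (commutator c (g *v x) (g *v y)) (commutator c (g *v z) (g *v w)) (g *v v) = 0" for x y z w v
    using assms(2) by (simp add: equivariant_commutator[OF g(1)] det3_image collinear_commutators_def)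
  then show ?thesis unfolding collinear_commutators_def using g(2) by metis
qed

lemma planes_closed_orbit: assumes "c \<in> orbit T" "planes_closed T" shows "planes_closed c"
proof -
  obtain g where g: "equivariant g T c" "\<And>x. \<exists>x'. x = g *v x'" using orbit_equivariantE[OF assms(1)] by metis
  have "det3 (g *v x) (g *v y) (mult c (g *v x) (g *v y)) = 0" for x y
    using assms(2) by (simp add: equivariant_mult[OF g(1)] det3_image planes_closed_def)
  then show ?thesis unfolding planes_closed_def using g(2) by metis
qed

lemma planes_degenerate_orbit: assumes "c \<in> orbit T" "planes_degenerate T" shows "planes_degenerate c"
proof -
  obtain g where g: "equivariant g T c" "\<And>x. \<exists>x'. x = g *v x'" using orbit_equivariantE[OF assms(1)] by metis
  have "plane_det c (g *v x) (g *v y) = 0" for x y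
    using assms(2) by (simp add: equivariant_plane_det[OF g(1)] planes_degenerate_def)
  then show ?thesis unfolding planes_degenerate_def using g(2) by metis
qed

lemma commutative_A07: "commutative A07"
  by (simp add: commutative_def commutator_def mult_A07 mult.commute)

lemma planes_closed_A18: "planes_closed A18"
  by (simp add: planes_closed_def mult_A18 det3_linear)

lemma commutator_A24: "commutator A24 x y = (x $ 3 * y $ 1 - y $ 3 * x $ 1) *s axis 3 1"
  by (simp add: commutator_def mult_A24 vec_eq_iff algebra_simps)

lemma collinear_commutators_A24: "collinear_commutators A24"
  unfolding collinear_commutators_def commutator_A24 by (simp add: det3_linear)

lemma planes_degenerate_A24: "planes_degenerate A24"
proof -
  \<comment> \<open>For \<open>z\<close> among \<open>x, y\<close> the last summand is zero, so the
    form induced on the plane is a product of two linear forms and has rank at most one.\<close>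
  have "det3 x y (mult A24 z w) = z $ 2 * (w $ 2 - w $ 1) * (x $ 3 * y $ 1 - x $ 1 * y $ 3)
      + w $ 1 * det3 x y z" for x y z w
    unfolding det3_def mult_A24 by (simp add: axis_def) algebra
  then show ?thesis unfolding planes_degenerate_def plane_det_def by (simp add: det3_linear mult_ac)
qed

lemma closure_A07_commutative: "c \<in> zariski closure_of orbit A07 \<Longrightarrow> commutative c"
  using closure_of_minimal[OF _ closedin_commutative] commutative_orbit commutative_A07 by blast

lemma closure_A18_planes_closed: "c \<in> zariski closure_of orbit A18 \<Longrightarrow> planes_closed c"
  using closure_of_minimal[OF _ closedin_planes_closed] planes_closed_orbit planes_closed_A18 by blast

lemma closure_A24_collinear: "c \<in> zariski closure_of orbit A24 \<Longrightarrow> collinear_commutators c"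
  using closure_of_minimal[OF _ closedin_collinear_commutators] collinear_commutators_orbit
    collinear_commutators_A24 by blast

lemma closure_A24_degenerate: "c \<in> zariski closure_of orbit A24 \<Longrightarrow> planes_degenerate c"
  using closure_of_minimal[OF _ closedin_planes_degenerate] planes_degenerate_orbit
    planes_degenerate_A24 by blast

lemma closure_A14_nilpotent:
  "c \<in> zariski closure_of (\<Union>\<alpha>\<in>- {0}. orbit (A14 \<alpha>)) \<Longrightarrow> two_step_nilpotent c"
proof -
  have "(\<Union>\<alpha>\<in>- {0}. orbit (A14 \<alpha>)) \<subseteq> {c. two_step_nilpotent c}"
    using line_valued_orbit line_valued_A14 line_valued_triple unfolding two_step_nilpotent_def by blast
  then show "c \<in> zariski closure_of (\<Union>\<alpha>\<in>- {0}. orbit (A14 \<alpha>)) \<Longrightarrow> two_step_nilpotent c"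
    using closure_of_minimal[OF _ closedin_two_step_nilpotent] by blast
qed

lemma not_commutative_A18: "\<not> commutative A18"
proof
  assume "commutative A18"
  then have "commutator A18 (axis 2 1) (axis 1 1) $ 2 = 0" by (simp add: commutative_def)
  then show False by (simp add: commutator_def mult_A18 axis_def)
qed

lemma not_commutative_A24: "\<not> commutative A24"
proof
  assume "commutative A24"
  then have "commutator A24 (axis 3 1) (axis 1 1) $ 3 = 0" by (simp add: commutative_def)
  then show False by (simp add: commutator_A24 axis_def)
qed

lemma not_commutative_A14: assumes "\<alpha> \<noteq> 0" shows "\<not> commutative (A14 \<alpha>)"
proof
  assume "commutative (A14 \<alpha>)"
  then have "commutator (A14 \<alpha>) (axis 1 1) (axis 2 1) $ 3 = 0" by (simp add: commutative_def)
  then show False using assms by (simp add: commutator_def mult_A14 axis_def)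
qed

lemma not_planes_closed:
  "\<not> planes_closed A07" "\<not> planes_closed A24" "\<not> planes_closed (A14 2)"
proof -
  have "det3 (axis 1 1 + axis 2 1) (axis 2 1 + axis 3 1)
      (mult A07 (axis 1 1 + axis 2 1) (axis 2 1 + axis 3 1)) \<noteq> 0"
    "det3 (axis 2 1 + axis 3 1) (axis 1 1) (mult A24 (axis 2 1 + axis 3 1) (axis 1 1 )) \<noteq> 0"
    "det3 (axis 1 1) (axis 2 1) (mult (A14 2) (axis 1 1) (axis 2 1)) \<noteq> 0"
    by (simp_all add: det3_def mult_A07 mult_A24 mult_A14 axis_def)
  then show "\<not> planes_closed A07" "\<not> planes_closed A24" "\<not> planes_closed (A14 2)"
    unfolding planes_closed_def by blast+
qed

text \<open>The value 2 avoids \<open>\<alpha>^2 = 1\<close>, where the plane determinant of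
  \<open>A14 \<alpha>\<close> at \<open>e\<^sub>1, e\<^sub>2\<close> would vanish.\<close>

lemma not_planes_degenerate: "\<not> planes_degenerate A07" "\<not> planes_degenerate (A14 2)"
proof -
  have "plane_det A07 (axis 1 1 + axis 2 1) (axis 2 1 + axis 3 1) \<noteq> 0"
    "plane_det (A14 2) (axis 1 1) (axis 2 1) \<noteq> 0"
    by (simp_all add: plane_det_def det3_def mult_A07 mult_A14 axis_def)
  then show "\<not> planes_degenerate A07" "\<not> planes_degenerate (A14 2)"
    unfolding planes_degenerate_def by blast+
qed

lemma commutators_A18:
  "det3 (commutator A18 (axis 2 1) (axis 1 1)) (commutator A18 (axis 3 1) (axis 1 1)) (axis 1 1) = 1"
  by (simp add: commutator_def det3_def mult_A18 axis_def)

lemma not_collinear_commutators_A18: "\<not> collinear_commutators A18"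
  using commutators_A18 unfolding collinear_commutators_def by (metis zero_neq_one)

lemma not_two_step_nilpotent:
  "\<not> two_step_nilpotent A07" "\<not> two_step_nilpotent A18" "\<not> two_step_nilpotent A24"
proof -
  have "mult A07 (mult A07 (axis 1 1) (axis 1 1)) (axis 1 1) $ 1 = 1"
    "mult A18 (mult A18 (axis 1 1) (axis 1 1)) (axis 1 1) $ 1 = 1"
    "mult A24 (mult A24 (axis 1 1) (axis 1 1)) (axis 1 1) $ 1 = 1"
    by (simp_all add: mult_A07 mult_A18 mult_A24 axis_def)
  then show "\<not> two_step_nilpotent A07" "\<not> two_step_nilpotent A18" "\<not> two_step_nilpotent A24"
    unfolding two_step_nilpotent_def by (metis zero_index zero_neq_one)+
qed

section \<open>Irreducible components\<close>

definition four_closures :: "multiplication set set" where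
  "four_closures = {zariski closure_of orbit A07, zariski closure_of orbit A18,
     zariski closure_of orbit A24, zariski closure_of (\<Union>\<alpha>\<in>- {0}. orbit (A14 \<alpha>))}"

text \<open>The separating conditions are commutativity for \<open>A07\<close>, closed planes for
  \<open>A18\<close> and nilpotency for \<open>A14\<close>. The closure of \<open>A24\<close> takes
  two: degenerate planes keep out \<open>A07\<close> and \<open>A14 2\<close>, collinear commutators
  keep out \<open>A18\<close>.\<close>

lemma component_antichain:
  assumes "K \<in> four_closures" "L \<in> four_closures" "K \<subseteq> L" shows "K = L"
proof -
  have m: "A07 \<in> zariski closure_of orbit A07" "A18 \<in> zariski closure_of orbit A18"
    "A24 \<in> zariski closure_of orbit A24"
    "A14 2 \<in> zariski closure_of (\<Union>\<alpha>\<in>- {0}. orbit (A14 \<alpha>))"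
    using subset_closure orbit_refl by (blast, blast, blast, force)
  have 2: "(2::complex) \<noteq> 0" by simp
  have "A18 \<notin> zariski closure_of orbit A07" "A24 \<notin> zariski closure_of orbit A07"
    "A14 2 \<notin> zariski closure_of orbit A07"
    "A07 \<notin> zariski closure_of orbit A18" "A24 \<notin> zariski closure_of orbit A18"
    "A14 2 \<notin> zariski closure_of orbit A18"
    "A07 \<notin> zariski closure_of orbit A24" "A18 \<notin> zariski closure_of orbit A24"
    "A14 2 \<notin> zariski closure_of orbit A24"
    "A07 \<notin> zariski closure_of (\<Union>\<alpha>\<in>- {0}. orbit (A14 \<alpha>))"
    "A18 \<notin> zariski closure_of (\<Union>\<alpha>\<in>- {0}. orbit (A14 \<alpha>))"
    "A24 \<notin> zariski closure_of (\<Union>\<alpha>\<in>- {0}. orbit (A14 \<alpha>))"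
    using closure_A07_commutative not_commutative_A18 not_commutative_A24 not_commutative_A14[OF 2]
      closure_A18_planes_closed not_planes_closed closure_A24_degenerate not_planes_degenerate
      closure_A24_collinear not_collinear_commutators_A18 closure_A14_nilpotent not_two_step_nilpotent
    by blast+
  with m assms show ?thesis unfolding four_closures_def by auto
qed

lemma card_four_closures: "card four_closures = 4"
proof -
  have m: "A07 \<in> zariski closure_of orbit A07" "A18 \<in> zariski closure_of orbit A18"
    "A24 \<in> zariski closure_of orbit A24"
    using subset_closure orbit_refl by blast+
  have "A18 \<notin> zariski closure_of orbit A07" "A24 \<notin> zariski closure_of orbit A07"
    "A24 \<notin> zariski closure_of orbit A18"
    "A07 \<notin> zariski closure_of (\<Union>\<alpha>\<in>- {0}. orbit (A14 \<alpha>))"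
    "A18 \<notin> zariski closure_of (\<Union>\<alpha>\<in>- {0}. orbit (A14 \<alpha>))"
    "A24 \<notin> zariski closure_of (\<Union>\<alpha>\<in>- {0}. orbit (A14 \<alpha>))"
    using closure_A07_commutative not_commutative_A18 not_commutative_A24
      closure_A18_planes_closed not_planes_closed closure_A14_nilpotent not_two_step_nilpotent
    by blast+
  with m have "zariski closure_of orbit A07 \<noteq> zariski closure_of orbit A18"
    "zariski closure_of orbit A07 \<noteq> zariski closure_of orbit A24"
    "zariski closure_of orbit A18 \<noteq> zariski closure_of orbit A24"
    "zariski closure_of orbit A07 \<noteq> zariski closure_of (\<Union>\<alpha>\<in>- {0}. orbit (A14 \<alpha>))"
    "zariski closure_of orbit A18 \<noteq> zariski closure_of (\<Union>\<alpha>\<in>- {0}. orbit (A14 \<alpha>))"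
    "zariski closure_of orbit A24 \<noteq> zariski closure_of (\<Union>\<alpha>\<in>- {0}. orbit (A14 \<alpha>))"
    by blast+
  then show ?thesis unfolding four_closures_def by simp
qed

lemma closure_orbits_perm:
  assumes "\<And>c. c \<in> S \<Longrightarrow> perm_algebra c" "c \<in> zariski closure_of S" shows "perm_algebra c"
  using closure_of_minimal[OF _ closedin_perm, of S] assms by blast

lemma component_polymap:
  assumes "K \<in> four_closures" shows "\<exists>\<psi>. polymap \<psi> \<and> K = zariski closure_of range \<psi>"
  using assms closure_orbit_eq closure_A14_eq polymap_transport polymap_line_family
  unfolding four_closures_def by (elim insertE) blast+

lemma component_perm: assumes "K \<in> four_closures" "c \<in> K" shows "perm_algebra c"
proof -
  have "perm_algebra d" if "d \<in> orbit A07 \<or> d \<in> orbit A18 \<or> d \<in> orbit A24 \<or>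
      d \<in> (\<Union>\<alpha>\<in>- {0}. orbit (A14 \<alpha>))" for d
    using that perm_orbit perm_A07 perm_A18 perm_A24 perm_A14 by blast
  then show ?thesis using assms closure_orbits_perm unfolding four_closures_def by blast
qed

lemma irreducible_subset_component:
  assumes "irreducible_in zariski D" "\<And>c. c \<in> D \<Longrightarrow> perm_algebra c"
  shows "\<exists>K\<in>four_closures. D \<subseteq> K"
proof -
  have U: "D \<subseteq> \<Union>four_closures"
    using perm_subset_closures assms(2) unfolding four_closures_def by blast
  have "\<exists>K\<in>\<K>. D \<subseteq> K" if "finite \<K>" "\<And>K. K \<in> \<K> \<Longrightarrow> closedin zariski K" "D \<subseteq> \<Union>\<K>" for \<K>
    using that
  proof (induction \<K> rule: finite_induct)
    case empty
    then show ?case using assms(1) by (auto simp: irreducible_in_def)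
  next
    case (insert K \<K>)
    have "closedin zariski (\<Union>\<K>)" using insert.hyps insert.prems by (intro closedin_Union) auto
    then have "D \<subseteq> K \<or> D \<subseteq> \<Union>\<K>"
      using assms(1) insert.prems unfolding irreducible_in_def by auto
    then show ?case using insert.IH insert.prems by auto
  qed
  moreover have "finite four_closures" "\<And>K. K \<in> four_closures \<Longrightarrow> closedin zariski K"
    by (auto simp: four_closures_def)
  ultimately show ?thesis using U by blast
qed

lemma irreducible_components_eq: "irreducible_components perm_variety = four_closures"
proof -
  have irr: "irreducible_in perm_variety K" if "K \<in> four_closures" for K
    using component_polymap[OF that] irreducible_closure_range component_perm[OF that]
    unfolding irreducible_in_perm_variety by blast
  have sub: "\<exists>K\<in>four_closures. D \<subseteq> K" if "irreducible_in perm_variety D" for D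
    using that irreducible_subset_component unfolding irreducible_in_perm_variety by blast
  show ?thesis
  proof
    show "irreducible_components perm_variety \<subseteq> four_closures"
      unfolding irreducible_components_def using sub irr by blast
    show "four_closures \<subseteq> irreducible_components perm_variety"
    proof
      fix K assume K: "K \<in> four_closures"
      have "D = K" if D: "irreducible_in perm_variety D" "K \<subseteq> D" for D
      proof -
        obtain L where "L \<in> four_closures" "D \<subseteq> L" using sub[OF D(1)] by blast
        then show ?thesis using component_antichain[OF K, of L] D(2) by blast
      qed
      then show "K \<in> irreducible_components perm_variety"
        unfolding irreducible_components_def using irr[OF K] by blast
    qed
  qed
qed

section \<open>Dimension\<close>

text \<open>An enumeration of the entries of a matrix \<open>M\<close> which starts with the two entries whose
  product already makes \<open>krylov_det M\<close> nonzero.\<close>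

definition entry_index :: "3 \<Rightarrow> 3 \<Rightarrow> nat" where
  "entry_index i j = (if (i, j) = (2, 1) then 1 else if (i, j) = (3, 2) then 2
     else if (i, j) = (1, 1) then 3 else if (i, j) = (1, 2) then 4 else if (i, j) = (1, 3) then 5
     else if (i, j) = (2, 2) then 6 else if (i, j) = (2, 3) then 7 else if (i, j) = (3, 1) then 8 else 9)"

text \<open>The first step identifies the two leading entries: on a line of matrices with a single nonzero
  entry the Krylov determinant would vanish.\<close>

definition truncate :: "nat \<Rightarrow> complex^3^3 \<Rightarrow> complex^3^3" where
  "truncate n \<phi> = (\<chi> i j. if n = 1 \<and> (i, j) = (3, 2) then \<phi> $ 2 $ 1
     else if entry_index i j \<le> n then \<phi> $ i $ j else 0)"

lemma entry_index_start: "entry_index 2 1 = 1" "entry_index 3 2 = 2"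
  by (simp_all add: entry_index_def)

lemma truncate_truncate: "n \<le> m \<Longrightarrow> truncate m (truncate n \<phi>) = truncate n \<phi>"
  by (auto simp: truncate_def vec_eq_iff entry_index_start)

lemma pol_if:
  assumes "P \<Longrightarrow> pol X f" "\<not> P \<Longrightarrow> pol X g" shows "pol X (\<lambda>v. if P then f v else g v)"
  using assms by (cases P) simp_all

lemma entry_Pair: "entry (i, j) \<phi> = \<phi> $ i $ j"
  by (simp add: entry_def)

lemma polymap_cyclic_truncate: "polymap (cyclic \<circ> truncate n)"
  unfolding polymap_def
proof (intro allI)
  fix i j k
  have "pol entry f \<Longrightarrow> pol entry (\<lambda>\<phi>. f (truncate n \<phi>))" for f
  proof (induction rule: pol.induct)
    case (coord x)
    show ?case
      by (cases x; simp only: entry_Pair truncate_def vec_lambda_beta) (intro pol_if pol_entry pol.const)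
  qed (auto intro: pol.intros)
  from this[of "\<lambda>\<phi>. cyclic \<phi> $ i $ j $ k"] polymap_cyclic
  show "pol entry (\<lambda>\<phi>. (cyclic \<circ> truncate n) \<phi> $ i $ j $ k)" by (simp add: polymap_def)
qed

text \<open>Since \<open>M\<close> can be read off from \<open>cyclic M\<close> up to the factor \<open>krylov_det M\<close>, a new free entry
  of \<open>M\<close> enlarges the closure.\<close>

lemma cyclic_nth: "cyclic M $ 1 $ j $ k = krylov_det M * M $ k $ j"
proof -
  have "cyclic M $ 1 $ j $ k = mult (cyclic M) (axis 1 1) (axis j 1) $ k" by (simp add: mult_basis)
  also have "\<dots> = krylov_det M * (M *v axis j 1) $ k" by (simp add: mult_cyclic_1)
  also have "(M *v axis j 1) $ k = M $ k $ j" 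
    by (simp add: matrix_vector_mult_def axis_def if_distrib[of "(*) _"] cong: if_cong)
  finally show ?thesis .
qed

text \<open>The entries (2,1) and (3,2) are set so that the Krylov determinant is nonzero while the
  entry under test is switched on.\<close>

definition unit_matrix :: "3 \<Rightarrow> 3 \<Rightarrow> complex^3^3" where
  "unit_matrix k l = (\<chi> i j. if (i, j) \<in> {(2, 1), (3, 2), (k, l)} then 1 else 0)"

lemma cyclic_truncate_strict:
  assumes n: "n < 9"
  shows "\<exists>p \<phi>. poly_fun p \<and> (\<forall>\<psi>. p (cyclic (truncate n \<psi>)) = 0) \<and> p (cyclic (truncate (Suc n) \<phi>)) \<noteq> 0"
proof -
  have gen: ?thesis if kl: "entry_index k l = Suc n" "(k, l) \<noteq> (2, 1)" "(k, l) \<noteq> (3, 2)"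
    and kd: "krylov_det (unit_matrix k l) \<noteq> 0" for k l
  proof (intro exI conjI allI)
    show "poly_fun (\<lambda>c. c $ 1 $ l $ k)" by (rule poly_fun.coord)
    show "cyclic (truncate n \<psi>) $ 1 $ l $ k = 0" for \<psi>
      using kl by (auto simp: cyclic_nth truncate_def)
    have "n \<ge> 2" using kl by (auto simp: entry_index_def split: if_splits)
    then have "truncate (Suc n) (unit_matrix k l) = unit_matrix k l"
      using kl(1) by (auto simp: truncate_def unit_matrix_def vec_eq_iff entry_index_start)
    then show "cyclic (truncate (Suc n) (unit_matrix k l)) $ 1 $ l $ k \<noteq> 0"
      using kd by (simp add: cyclic_nth) (simp add: unit_matrix_def)
  qed
  have kd: "krylov_det M = M$2$1 * (M$2$1 * M$3$2 + M$3$1 * M$3$3) - M$3$1 * (M$2$1 * M$2$2 + M$3$1 * M$2$3)" for M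
    by (simp add: krylov_det_def det3_def matrix_vector_mult_def sum_3 axis_def) algebra
  consider "n = 0" | "n = 1" | "n = 2" | "n = 3" | "n = 4" | "n = 5" | "n = 6" | "n = 7" | "n = 8"
    using n by linarith
  then show ?thesis
  proof cases
    case 1
    show ?thesis
    proof (intro exI conjI allI)
      show "poly_fun (\<lambda>c. c $ 1 $ 1 $ 2)" by (rule poly_fun.coord)
      show "cyclic (truncate n \<psi>) $ 1 $ 1 $ 2 = 0" for \<psi>
        using 1 by (simp add: cyclic_nth truncate_def entry_index_def)
      show "cyclic (truncate (Suc n) (unit_matrix 2 1)) $ 1 $ 1 $ 2 \<noteq> 0"
        using 1 by (simp add: cyclic_nth kd truncate_def unit_matrix_def entry_index_def idx3)
    qed
  next
    case 2
    let ?\<phi> = "\<chi> i j. if (i, j) = (2, 1) then 1 else if (i, j) = (3, 2) then 2 else 0"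
    show ?thesis
    proof (intro exI conjI allI)
      \<comment> \<open>These coordinates are the entries (2,1) and (3,2) times the same Krylov
        determinant. They agree after the first truncation; the values 1 and 2 in
        \<open>?\<phi>\<close> separate them.\<close>
      show "poly_fun (\<lambda>c. c $ 1 $ 1 $ 2 - c $ 1 $ 2 $ 3)" by (intro poly_fun_diff poly_fun.coord)
      show "cyclic (truncate n \<psi>) $ 1 $ 1 $ 2 - cyclic (truncate n \<psi>) $ 1 $ 2 $ 3 = 0" for \<psi>
        using 2 by (simp add: cyclic_nth truncate_def entry_index_def idx3)
      show "cyclic (truncate (Suc n) ?\<phi>) $ 1 $ 1 $ 2 - cyclic (truncate (Suc n) ?\<phi>) $ 1 $ 2 $ 3 \<noteq> 0"
        using 2 by (simp add: cyclic_nth kd truncate_def entry_index_def idx3)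
    qed
  next
    case 3
    then show ?thesis by (intro gen[of 1 1]) (simp_all add: entry_index_def kd unit_matrix_def idx3)
  next
    case 4
    then show ?thesis by (intro gen[of 1 2]) (simp_all add: entry_index_def kd unit_matrix_def idx3)
  next
    case 5
    then show ?thesis by (intro gen[of 1 3]) (simp_all add: entry_index_def kd unit_matrix_def idx3)
  next
    case 6
    then show ?thesis by (intro gen[of 2 2]) (simp_all add: entry_index_def kd unit_matrix_def idx3)
  next
    case 7
    then show ?thesis by (intro gen[of 2 3]) (simp_all add: entry_index_def kd unit_matrix_def idx3)
  next
    case 8
    then show ?thesis by (intro gen[of 3 1]) (simp_all add: entry_index_def kd unit_matrix_def idx3)
  next
    case 9
    then show ?thesis by (intro gen[of 3 3]) (simp_all add: entry_index_def kd unit_matrix_def idx3)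
  qed
qed

lemma krull_dimension_eq: "krull_dimension perm_variety = 9"
  unfolding krull_dimension_def
proof (rule antisym)
  show "Sup {enat n |n. \<exists>Z :: nat \<Rightarrow> multiplication set. (\<forall>i\<le>n. closedin perm_variety (Z i) \<and> irreducible_in perm_variety (Z i))
      \<and> (\<forall>i<n. Z i \<subset> Z (Suc i))} \<le> 9"
  proof (rule Sup_least)
    fix d assume "d \<in> {enat n |n. \<exists>Z :: nat \<Rightarrow> multiplication set. (\<forall>i\<le>n. closedin perm_variety (Z i) \<and> irreducible_in perm_variety (Z i))
      \<and> (\<forall>i<n. Z i \<subset> Z (Suc i))}"
    then obtain n and Z :: "nat \<Rightarrow> multiplication set" where d: "d = enat n"
      and Z': "\<forall>i\<le>n. closedin perm_variety (Z i) \<and> irreducible_in perm_variety (Z i)"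
        "\<forall>i<n. Z i \<subset> Z (Suc i)" by (elim CollectE exE conjE)
    have Z: "\<forall>i\<le>n. closedin zariski (Z i) \<and> irreducible_in zariski (Z i)"
      "\<forall>i<n. Z i \<subset> Z (Suc i)" "\<forall>c\<in>Z n. perm_algebra c"
      using Z' by (auto simp: closedin_perm_variety irreducible_in_perm_variety)
    obtain K where K: "K \<in> four_closures" "Z n \<subseteq> K"
      using irreducible_subset_component[of "Z n"] Z(1,3) by blast
    obtain \<psi> where "polymap \<psi>" "K = zariski closure_of range \<psi>" using component_polymap[OF K(1)] by blast
    then have "n \<le> 9" using chain_length_le[OF Z(1,2)] K(2) by blast
    then show "d \<le> 9" unfolding d by (simp add: numeral_eq_enat)
  qed
next
  let ?Z = "\<lambda>n. zariski closure_of range (cyclic \<circ> truncate n)"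
  have "perm_algebra c" if "c \<in> ?Z n" for c n
  proof (rule closure_orbits_perm[OF _ that])
    fix c assume "c \<in> range (cyclic \<circ> truncate n)"
    then have "c \<in> zariski closure_of orbit A07" using cyclic_range_in_closure by auto
    then show "perm_algebra c" by (rule component_perm[rotated]) (simp add: four_closures_def)
  qed
  then have "\<forall>i\<le>9. closedin perm_variety (?Z i) \<and> irreducible_in perm_variety (?Z i)"
    unfolding closedin_perm_variety irreducible_in_perm_variety
    using irreducible_closure_range[OF polymap_cyclic_truncate] by auto
  moreover have "\<forall>i<9. ?Z i \<subset> ?Z (Suc i)"
  proof (intro allI impI)
    fix n :: nat assume n: "n < 9"
    have "range (cyclic \<circ> truncate n) \<subseteq> range (cyclic \<circ> truncate (Suc n))"
    proof
      fix c assume "c \<in> range (cyclic \<circ> truncate n)"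
      then obtain \<phi> where "c = cyclic (truncate n \<phi>)" by auto
      then have "c = (cyclic \<circ> truncate (Suc n)) (truncate n \<phi>)" by (simp add: truncate_truncate)
      then show "c \<in> range (cyclic \<circ> truncate (Suc n))" by blast
    qed
    then have "?Z n \<subseteq> ?Z (Suc n)" by (rule closure_of_mono)
    moreover obtain p \<phi> where p: "poly_fun p" "\<forall>\<psi>. p (cyclic (truncate n \<psi>)) = 0"
      "p (cyclic (truncate (Suc n) \<phi>)) \<noteq> 0" using cyclic_truncate_strict[OF n] by blast
    then have "cyclic (truncate (Suc n) \<phi>) \<notin> ?Z n" unfolding in_closure_iff by auto
    moreover have "cyclic (truncate (Suc n) \<phi>) \<in> ?Z (Suc n)"
      using subset_closure[of "range (cyclic \<circ> truncate (Suc n))"] by auto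
    ultimately show "?Z n \<subset> ?Z (Suc n)" by blast
  qed
  ultimately have "enat 9 \<in> {enat n |n. \<exists>Z :: nat \<Rightarrow> multiplication set. (\<forall>i\<le>n. closedin perm_variety (Z i) \<and> irreducible_in perm_variety (Z i))
      \<and> (\<forall>i<n. Z i \<subset> Z (Suc i))}" by (intro CollectI exI[of _ 9] exI[of _ ?Z] conjI refl)
  then have "enat 9 \<le> Sup {enat n |n. \<exists>Z :: nat \<Rightarrow> multiplication set. (\<forall>i\<le>n. closedin perm_variety (Z i) \<and> irreducible_in perm_variety (Z i))
      \<and> (\<forall>i<n. Z i \<subset> Z (Suc i))}" by (rule Sup_upper)
  then show "9 \<le> Sup {enat n |n. \<exists>Z :: nat \<Rightarrow> multiplication set. (\<forall>i\<le>n. closedin perm_variety (Z i) \<and> irreducible_in perm_variety (Z i))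
      \<and> (\<forall>i<n. Z i \<subset> Z (Suc i))}" by (simp add: numeral_eq_enat)
qed

section \<open>Rigid algebras\<close>

lemma openin_zariski_ex:
  assumes "\<And>i. poly_fun (p i)" shows "openin zariski {c. \<exists>i. p i c \<noteq> 0}"
proof -
  have "openin zariski (UNIV - {c. \<forall>i. p i c = 0})"
    using openin_diff[OF openin_topspace closedin_zariski_all[of p, OF assms]] by (simp add: topspace_zariski)
  moreover have "UNIV - {c. \<forall>i. p i c = 0} = {c. \<exists>i. p i c \<noteq> 0}" by auto
  ultimately show ?thesis by simp
qed

lemma openin_perm_variety_iff:
  "openin perm_variety S \<longleftrightarrow> (\<exists>W. openin zariski W \<and> S = W \<inter> {c. perm_algebra c})"
  by (simp add: perm_variety_def openin_subtopology)

text \<open>A nonzero value of \<open>cubic_disc\<close> at some vector forces membership in the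
  orbit, and conversely equivariance carries such a value from \<open>A07\<close> to its whole
  orbit.\<close>

lemma rigid_A07: "rigid A07"
  unfolding rigid_def openin_perm_variety_iff
proof (intro conjI exI)
  show "perm_algebra A07" by (rule perm_A07)
  show "openin zariski {c. \<exists>a. cubic_disc c a \<noteq> 0}"
    unfolding cubic_disc_def Let_def by (intro openin_zariski_ex poly_fun_intros)
  have "c \<in> {c. \<exists>a. cubic_disc c a \<noteq> 0}" if c: "c \<in> orbit A07" for c
  proof -
    obtain g where g: "equivariant g A07 c" "det g \<noteq> 0" using orbit_equivariantE[OF c] by metis
    \<comment> \<open>Any vector with distinct nonzero entries would serve.\<close>
    let ?a = "(\<chi> i. if i = 1 then 1 else if i = 2 then 2 else 3) :: complex^3"
    have "cubic_disc c (g *v ?a) = det g ^ 6 * cubic_disc A07 ?a"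
      unfolding cubic_disc_def Let_def equivariant_mult[OF g(1)] det3_image by algebra
    moreover have "cubic_disc A07 ?a \<noteq> 0"
      by (simp add: cubic_disc_def det3_def mult_A07)
    ultimately show ?thesis using g(2) by (intro CollectI exI[of _ "g *v ?a"]) simp
  qed
  then show "orbit A07 = {c. \<exists>a. cubic_disc c a \<noteq> 0} \<inter> {c. perm_algebra c}"
    using cubic_disc_orbit perm_orbit perm_A07 by blast
qed

lemma commutative_D: "commutative D1" "commutative D2"
proof -
  have "mult D1 x y = mult D1 y x" "mult D2 x y = mult D2 y x" for x y
    by (simp_all add: vec_eq_iff forall_3 mult_def sum_3 D1_def D2_def mult.commute)
  then show "commutative D1" "commutative D2" by (simp_all add: commutative_def commutator_def)
qed

lemma commutative_cases:
  assumes "perm_algebra c"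
  shows "commutative c \<or> line_valued c \<or> c \<in> orbit A18
    \<or> (\<exists>\<gamma>. c \<in> orbit (E1 \<gamma>)) \<or> (\<exists>\<beta>. c \<in> orbit (E2 \<beta>))"
  using perm_classification[OF assms] monogenic_in_closure[OF assms] closure_A07_commutative
    commutative_orbit commutative_D by blast

lemma line_valued_commutator:
  assumes w: "\<And>x y. \<exists>k. mult c x y = k *s w" shows "\<exists>k. commutator c x y = k *s w"
proof -
  obtain k l where "mult c x y = k *s w" "mult c y x = l *s w" using w by metis
  then have "commutator c x y = (k - l) *s w" by (simp add: commutator_def vec_eq_iff algebra_simps)
  then show ?thesis ..
qed

lemma line_valued_collinear_commutators: assumes "line_valued c" shows "collinear_commutators c"
proof -
  obtain w where "\<And>x y. \<exists>k. mult c x y = k *s w" using assms unfolding line_valued_def by blast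
  then have w: "\<exists>k. commutator c x y = k *s w" for x y by (rule line_valued_commutator)
  show ?thesis unfolding collinear_commutators_def
  proof (intro allI)
    fix x y z w' v
    obtain k l where "commutator c x y = k *s w" "commutator c z w' = l *s w" using w by metis
    then show "det3 (commutator c x y) (commutator c z w') v = 0" by (simp add: det3_linear)
  qed
qed

text \<open>Of the classified types, \<open>E1\<close> and \<open>E2\<close> inherit collinear
  commutators from the closure of \<open>A24\<close>, and commutative or line-valued algebras have
  them trivially; only \<open>A18\<close> remains.\<close>

lemma not_collinear_commutators_orbit:
  assumes "perm_algebra c" "\<not> collinear_commutators c" shows "c \<in> orbit A18"
proof -
  have "collinear_commutators c" if "c \<in> orbit (E1 \<gamma>) \<or> c \<in> orbit (E2 \<beta>)" for \<gamma> \<beta>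
    using that closure_A24_collinear E1_in_closure E2_in_closure collinear_commutators_orbit by blast
  moreover have "collinear_commutators c" if "commutative c"
    using that by (simp add: collinear_commutators_def commutative_def det3_linear)
  ultimately show ?thesis
    using commutative_cases[OF assms(1)] assms(2) line_valued_collinear_commutators by blast
qed

lemma rigid_A18: "rigid A18"
  unfolding rigid_def openin_perm_variety_iff
proof (intro conjI exI)
  show "perm_algebra A18" by (rule perm_A18)
  show "openin zariski (UNIV - {c. collinear_commutators c})"
    using openin_diff[OF openin_topspace closedin_collinear_commutators] by (simp add: topspace_zariski)
  show "orbit A18 = (UNIV - {c. collinear_commutators c}) \<inter> {c. perm_algebra c}"
    using not_collinear_commutators_orbit perm_orbit perm_A18 not_collinear_commutators_A18
      collinear_commutators_orbit orbit_sym by blast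
qed

text \<open>Modulo the line spanned by the commutator \<open>w\<close> one has \<open>k z\<^sup>3 = p z\<^sup>2 - q z\<close>; this is the
  homogenised discriminant of the corresponding quadratic, multiplied by its constant term.\<close>

definition quadratic_disc :: "multiplication \<Rightarrow> complex^3 \<Rightarrow> complex^3 \<Rightarrow> complex^3 \<Rightarrow> complex" where
  "quadratic_disc c x y z = (let w = mult c x y - mult c y x; s = mult c z z; t = mult c z s;
     k = det3 w z s; p = det3 w z t; q = det3 w s t in q * (p^2 - 4 * q * k))"

lemma quadratic_disc_equivariant:
  assumes "equivariant g T c"
  shows "quadratic_disc c (g *v x) (g *v y) (g *v z) = det g ^ 3 * quadratic_disc T x y z"
  unfolding quadratic_disc_def Let_def equivariant_mult[OF assms]
    matrix_vector_mult_diff_distrib[symmetric] det3_image by algebra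

lemma quadratic_disc_orbit_zero:
  assumes "c \<in> orbit T" "\<And>x y z. quadratic_disc T x y z = 0" shows "quadratic_disc c x y z = 0"
proof -
  obtain g where g: "equivariant g T c" "\<And>x. \<exists>x'. x = g *v x'" using orbit_equivariantE[OF assms(1)] by metis
  obtain x' y' z' where "x = g *v x'" "y = g *v y'" "z = g *v z'" using g(2) by metis
  then show ?thesis using quadratic_disc_equivariant[OF g(1)] assms(2) by simp
qed

lemma mult_E1: "mult (E1 \<gamma>) x y = x $ 1 * y $ 1 *s axis 1 1 + x $ 2 * y $ 1 *s axis 2 1 + \<gamma> * x $ 3 * y $ 3 *s axis 3 1"
  by (simp add: vec_eq_iff forall_3 mult_def sum_3 E1_def axis_def)

lemma mult_E2: "mult (E2 \<beta>) x y = x $ 1 * y $ 1 *s axis 1 1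
    + (x $ 1 * y $ 2 + x $ 2 * y $ 1 + \<beta> * x $ 2 * y $ 2) *s axis 2 1 + x $ 3 * y $ 1 *s axis 3 1"
  by (simp add: vec_eq_iff forall_3 mult_def sum_3 E2_def axis_def algebra_simps)

lemma quadratic_disc_E1: "quadratic_disc (E1 0) x y z = 0"
  by (simp add: quadratic_disc_def Let_def det3_def mult_E1 axis_def)

lemma quadratic_disc_E2: "quadratic_disc (E2 0) x y z = 0"
  unfolding quadratic_disc_def Let_def det3_def mult_E2 by (simp add: axis_def) algebra

lemma quadratic_disc_A18: "quadratic_disc A18 x y z = 0"
  by (simp add: quadratic_disc_def Let_def mult_A18 mult_linear det3_linear)

text \<open>A nonzero discriminant leaves only \<open>E1\<close> and \<open>E2\<close>. It also
  excludes their parameter 0, and for all other parameters they lie in the orbit of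
  \<open>A24\<close>.\<close>

lemma quadratic_disc_orbit:
  assumes "perm_algebra c" "quadratic_disc c x y z \<noteq> 0" shows "c \<in> orbit A24"
  using commutative_cases[OF assms(1)]
proof (elim disjE exE)
  assume "commutative c"
  then have "mult c x y - mult c y x = 0" unfolding commutative_def commutator_def by blast
  then have "quadratic_disc c x y z = 0" unfolding quadratic_disc_def by (simp only: Let_def det3_linear) simp
  then show ?thesis using assms(2) by simp
next
  assume "line_valued c"
  then have "mult c z (mult c z z) = 0" by (rule line_valued_triple)
  then have "quadratic_disc c x y z = 0" unfolding quadratic_disc_def by (simp only: Let_def det3_linear) simp
  then show ?thesis using assms(2) by simp
next
  assume "c \<in> orbit A18"
  then show ?thesis using quadratic_disc_orbit_zero quadratic_disc_A18 assms(2) by blast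
next
  fix \<gamma> assume c: "c \<in> orbit (E1 \<gamma>)"
  then have "\<gamma> \<noteq> 0" using quadratic_disc_orbit_zero quadratic_disc_E1 assms(2) by blast
  then show ?thesis using E1_in_orbit orbit_trans c by blast
next
  fix \<beta> assume c: "c \<in> orbit (E2 \<beta>)"
  then have "\<beta> \<noteq> 0" using quadratic_disc_orbit_zero quadratic_disc_E2 assms(2) by blast
  then show ?thesis using E2_in_orbit orbit_trans c by blast
qed

lemma rigid_A24: "rigid A24"
  unfolding rigid_def openin_perm_variety_iff
proof (intro conjI exI)
  show "perm_algebra A24" by (rule perm_A24)
  let ?p = "\<lambda>(x, y, z) c. quadratic_disc c x y z"
  show "openin zariski {c. \<exists>i. ?p i c \<noteq> 0}"
    unfolding quadratic_disc_def Let_def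
    by (rule openin_zariski_ex) (auto intro!: poly_fun_intros split: prod.splits)
  have "\<exists>i. ?p i c \<noteq> 0" if c: "c \<in> orbit A24" for c
  proof -
    obtain g where g: "equivariant g A24 c" "det g \<noteq> 0" using orbit_equivariantE[OF c] by metis
    \<comment> \<open>The commutator of the first two arguments is \<open>e\<^sub>3\<close>; modulo
      it, the third has the distinct nonzero eigenvalues 1 and 2.\<close>
    have "quadratic_disc A24 (axis 3 1) (axis 1 1) (axis 1 1 + axis 2 2) \<noteq> 0"
      by (simp add: quadratic_disc_def Let_def det3_def mult_A24 axis_def)
    then have "?p (g *v axis 3 1, g *v axis 1 1, g *v (axis 1 1 + axis 2 2)) c \<noteq> 0"
      using g(2) unfolding prod.case quadratic_disc_equivariant[OF g(1)] by simp
    then show ?thesis by blast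
  qed
  moreover have "c \<in> orbit A24" if "perm_algebra c" "\<exists>i. ?p i c \<noteq> 0" for c
    using that quadratic_disc_orbit by auto
  ultimately show "orbit A24 = {c. \<exists>i. ?p i c \<noteq> 0} \<inter> {c. perm_algebra c}"
    using perm_orbit perm_A24 by blast
qed

text \<open>The ratio of the plane determinant to the squared skew part recovers \<open>\<alpha>\<^sup>2\<close>.\<close>

lemma A14_parameter:
  assumes "A14 \<beta> \<in> orbit (A14 \<alpha>)" shows "\<beta>^2 = \<alpha>^2"
proof -
  \<comment> \<open>With \<open>L = x\<^sub>1 y\<^sub>2 - x\<^sub>2 y\<^sub>1\<close>, the plane
    determinant of \<open>A14 \<alpha>\<close> is \<open>(\<alpha>^2 - 1) L^4\<close> and the skew
    determinant is \<open>2 \<alpha> L^2\<close>; this combination cancels \<open>L\<close>.\<close>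
  let ?r = "\<lambda>c x y. 4 * \<alpha>^2 * plane_det c x y + (1 - \<alpha>^2) * det3 x y (commutator c x y) ^ 2"
  have z: "?r (A14 \<alpha>) x y = 0" for x y
  proof -
    have m: "mult (A14 \<alpha>) u v = ((1 + \<alpha>) * u $ 1 * v $ 2 + (1 - \<alpha>) * u $ 2 * v $ 1) *s axis 3 1" for u v
      by (rule mult_A14)
    show ?thesis unfolding plane_det_def commutator_def m det3_linear by algebra
  qed
  obtain g where g: "equivariant g (A14 \<alpha>) (A14 \<beta>)" "\<And>x. \<exists>x'. x = g *v x'"
    using orbit_equivariantE[OF assms] by metis
  have "?r (A14 \<beta>) (g *v x) (g *v y) = det g ^ 2 * ?r (A14 \<alpha>) x y" for x y
    unfolding equivariant_plane_det[OF g(1)] equivariant_commutator[OF g(1)] det3_image by algebra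
  then have "?r (A14 \<beta>) x y = 0" for x y using g(2)[of x] g(2)[of y] z by auto
  from this[of "axis 1 1" "axis 2 1"] have "4 * (\<beta>^2 - \<alpha>^2) = 0"
    by (simp add: plane_det_def commutator_def mult_A14 det3_def axis_def) algebra
  then show ?thesis by simp
qed

text \<open>Each \<open>A14 \<alpha>\<close> is a limit of members with another squared parameter,
  which by \<open>A14_parameter\<close> lie in other orbits; an open set around it meets
  them.\<close>

lemma not_open_orbit_A14:
  assumes "openin zariski W" "orbit (A14 \<alpha>) = W \<inter> {c. perm_algebra c}" shows False
proof -
  let ?U = "A14 ` {\<beta>. \<beta>^2 \<noteq> \<alpha>^2}"
  have "A14 \<alpha> \<in> zariski closure_of ?U"
  proof (rule in_closure_limit)
    show "((\<lambda>t. A14 (\<alpha> + t) $ i $ j $ k) \<longlongrightarrow> A14 \<alpha> $ i $ j $ k) (at 0)" for i j k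
    proof -
      have "((\<lambda>t. A14 (\<alpha> + t) $ i $ j $ k) \<longlongrightarrow> (if (i, j, k) = (1, 2, 3) then 1 + (\<alpha> + 0)
          else if (i, j, k) = (2, 1, 3) then 1 - (\<alpha> + 0) else 0)) (at 0)"
        unfolding A14_def vec_lambda_beta by (intro tendsto_if tendsto_intros)
      then show ?thesis by (simp only: A14_def vec_lambda_beta add_0_right)
    qed
    \<comment> \<open>The polynomial is \<open>(\<alpha> + t)^2 - \<alpha>^2\<close>.\<close>
    have "eventually (\<lambda>t. poly [:0, 2 * \<alpha>, 1:] t \<noteq> 0) (at 0)" by (rule eventually_poly_nonzero) simp
    then show "eventually (\<lambda>t. A14 (\<alpha> + t) \<in> ?U) (at 0)"
      by eventually_elim (auto intro!: imageI simp: power2_eq_square algebra_simps)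
  qed
  moreover have "A14 \<alpha> \<in> W" using assms(2) orbit_refl by blast
  ultimately obtain \<beta> where "\<beta>^2 \<noteq> \<alpha>^2" "A14 \<beta> \<in> W"
    using assms(1) unfolding in_closure_of by blast
  then show False using A14_parameter assms(2) perm_A14 by blast
qed

lemma rigid_cases: assumes "rigid c" shows "c \<in> orbit A07 \<or> c \<in> orbit A18 \<or> c \<in> orbit A24"
proof -
  obtain W where W: "openin zariski W" "orbit c = W \<inter> {c. perm_algebra c}" and p: "perm_algebra c"
    using assms unfolding rigid_def openin_perm_variety_iff by blast
  have cW: "c \<in> W" using W(2) orbit_refl by blast
  have meet: "\<exists>d\<in>S. d \<in> orbit c"
    if S: "c \<in> zariski closure_of S" "\<And>d. d \<in> S \<Longrightarrow> perm_algebra d" for S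
  proof -
    obtain d where "d \<in> S" "d \<in> W" using S(1) W(1) cW unfolding in_closure_of by blast
    then show ?thesis using W(2) S(2) by blast
  qed
  have fixed: "c \<in> orbit A" if "c \<in> zariski closure_of orbit A" "perm_algebra A" for A
    using meet[OF that(1)] perm_orbit[OF _ that(2)] orbit_sym orbit_trans by blast
  have "c \<notin> zariski closure_of (\<Union>\<alpha>\<in>- {0}. orbit (A14 \<alpha>))"
  proof
    assume "c \<in> zariski closure_of (\<Union>\<alpha>\<in>- {0}. orbit (A14 \<alpha>))"
    then obtain \<alpha> d where "d \<in> orbit (A14 \<alpha>)" "d \<in> orbit c"
      using meet perm_orbit perm_A14 by blast
    then have "orbit c = orbit (A14 \<alpha>)" using orbit_eq by metis
    then show False using not_open_orbit_A14 W by metis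
  qed
  then show ?thesis using perm_subset_closures[OF p] fixed perm_A07 perm_A18 perm_A24 by blast
qed

lemma isomorphic_iff: "isomorphic c d \<longleftrightarrow> d \<in> orbit c"
proof
  assume "isomorphic c d"
  then obtain f where f: "Vector_Spaces.linear (*s) (*s) f" "bij f" "\<And>x y. f (mult c x y) = mult d (f x) (f y)"
    unfolding isomorphic_def by blast
  have m: "matrix f *v x = f x" for x using f(1) by (rule matrix_works)
  have "\<exists>B. B ** matrix f = mat 1"
    unfolding matrix_left_invertible_injective m using f(2) by (auto simp: bij_def inj_def)
  then have "invertible (matrix f)" by (simp add: invertible_left_inverse)
  then show "d \<in> orbit c" unfolding orbit_iff using f(3) m by metis
next
  assume "d \<in> orbit c"
  then obtain g where g: "invertible g" "\<And>x y. mult d (g *v x) (g *v y) = g *v mult c x y"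
    unfolding orbit_iff by blast
  show "isomorphic c d" unfolding isomorphic_def
  proof (intro exI[of _ "(*v) g"] conjI allI)
    show "Vector_Spaces.linear (*s) (*s) ((*v) g)" by (rule matrix_vector_mul_linear_gen)
    show "bij ((*v) g)"
      by (rule bijI') (use matrix_inv_vec[OF g(1)] in metis)+
  qed (simp add: g(2))
qed

lemma perm_iso_class: "perm_algebra c \<Longrightarrow> perm_iso `` {c} = orbit c"
  unfolding perm_iso_def using isomorphic_iff perm_orbit by auto

lemma rigid_classes: "{c. rigid c} // perm_iso = {orbit A07, orbit A18, orbit A24}"
proof -
  have "{c. rigid c} // perm_iso = (\<lambda>c. orbit c) ` {c. rigid c}"
    unfolding quotient_def using perm_iso_class by (auto simp: rigid_def)
  also have "\<dots> = {orbit A07, orbit A18, orbit A24}"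
  proof
    show "orbit ` {c. rigid c} \<subseteq> {orbit A07, orbit A18, orbit A24}" using rigid_cases orbit_eq by blast
  qed (use rigid_A07 rigid_A18 rigid_A24 in auto)
  finally show ?thesis .
qed

lemma card_rigid_classes: "card ({c. rigid c} // perm_iso) = 3"
proof -
  have "orbit A07 \<noteq> orbit A18" "orbit A07 \<noteq> orbit A24" "orbit A18 \<noteq> orbit A24"
    using commutative_orbit commutative_A07 not_commutative_A18 not_commutative_A24
      planes_closed_orbit planes_closed_A18 not_planes_closed orbit_refl by blast+
  then show ?thesis unfolding rigid_classes by simp
qed

theorem theorem33:
  shows "krull_dimension perm_variety = 9 \<and>
    irreducible_components perm_variety =
      {zariski closure_of orbit A07,
       zariski closure_of orbit A18,
       zariski closure_of orbit A24,
       zariski closure_of (\<Union>\<alpha>\<in>- {0}. orbit (A14 \<alpha>))} \<and>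
    card (irreducible_components perm_variety) = 4 \<and>
    card ({c. rigid c} // perm_iso) = 3"
  using krull_dimension_eq irreducible_components_eq card_four_closures card_rigid_classes
  by (simp add: four_closures_def)

end
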